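(* (a) For every integer $s$ with $1\leq s\leq 6$ and every field $\mathbb{F}$, there is a configuration of $s$ lines in $\mathbb{P}^2(\mathbb{F})$ with $U_3(s)$ triple points. (b) A configuration of $7$ lines with $7$ triple points in $\mathbb{P}^2(\mathbb{F})$ exists only if the field $\mathbb{F}$ has characteristic $2$, and in characteristic $2$ it exists (the smallest such configuration is the Fano plane, i.e. the configuration of all $7$ lines of $\mathbb{P}^2(\mathbb{F}_2)$). (c) A configuration of $8$ lines with $8$ triple points in $\mathbb{P}^2(\mathbb{F})$ exists over any field $\mathbb{F}$ containing a non-trivial third root of $1$. Moreover, over any field, every configuration of $8$ lines with $8$ triple points arises by taking out one line from a configuration of $9$ lines with $12$ triple points. (d) A configuration of $9$ lines with $12$ triple points in $\mathbb{P}^2(\mathbb{F})$ exists over any field $\mathbb{F}$ containing a non-trivial third root of $1$. (e) A configuration of $10$ lines in $\mathbb{P}^2(\mathbb{F})$ with $13$ points of multiplicity at least $3$ exists if and only if one of the following holds: (e1) $\mathbb{F}$ has characteristic $2$ and contains a non-trivial third root of $1$; in this case, one of the $13$ points of any such configuration has in fact multiplicity $4$; (e2) $\mathbb{F}$ has characteristic $5$. (f) There is no field $\mathbb{F}$ for which there exists a configuration of $11$ lines in $\mathbb{P}^2(\mathbb{F})$ with $17$ triple points. There exist (over some field) configurations of $11$ lines with $16$ triple points.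
   Context: For a field $\mathbb{F}$, $\mathbb{P}^2(\mathbb{F})$ is the projective plane over $\mathbb{F}$; its points and lines are the $\mathbb{F}$-rational ones. A configuration of $s$ lines is a set of $s$ mutually distinct lines in $\mathbb{P}^2(\mathbb{F})$. The multiplicity of a point with respect to a configuration is the number of configuration lines passing through it. A triple point of a configuration is a point of multiplicity exactly $3$. A non-trivial third root of $1$ in $\mathbb{F}$ is an element $\omega\in\mathbb{F}$ with $\omega^3=1$ and $\omega\neq 1$. For a positive integer $s$, $$U_3(s):=\left\lfloor\left\lfloor\frac{s-1}{2}\right\rfloor\cdot\frac{s}{3}\right\rfloor-\varepsilon(s),$$ where $\varepsilon(s)=1$ if $s\equiv 5 \pmod 6$ and $\varepsilon(s)=0$ otherwise; thus $U_3(1),\dots,U_3(6)$ are $0,0,1,1,2,4$. *)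

theory Defs
  imports "HOL-Algebra.Algebra"
begin

section \<open>The projective plane over a field\<close>

text \<open>
  Points are the classes of proportional nonzero vectors of \<open>F\<^sup>3\<close>; a line is the set of points
  on which a nonzero linear form vanishes.
\<close>

definition nonzero_vectors :: "('a, 'm) ring_scheme \<Rightarrow> ('a \<times> 'a \<times> 'a) set" where
  "nonzero_vectors F =
     carrier F \<times> carrier F \<times> carrier F - {(\<zero>\<^bsub>F\<^esub>, \<zero>\<^bsub>F\<^esub>, \<zero>\<^bsub>F\<^esub>)}"

definition proj_point :: "('a, 'm) ring_scheme \<Rightarrow> 'a \<times> 'a \<times> 'a \<Rightarrow> ('a \<times> 'a \<times> 'a) set" where
  "proj_point F = (\<lambda>(x, y, z).
     {(c \<otimes>\<^bsub>F\<^esub> x, c \<otimes>\<^bsub>F\<^esub> y, c \<otimes>\<^bsub>F\<^esub> z) | c. c \<in> carrier F - {\<zero>\<^bsub>F\<^esub>}})"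

definition points :: "('a, 'm) ring_scheme \<Rightarrow> ('a \<times> 'a \<times> 'a) set set" where
  "points F = proj_point F ` nonzero_vectors F"

definition proj_line ::
  "('a, 'm) ring_scheme \<Rightarrow> 'a \<times> 'a \<times> 'a \<Rightarrow> ('a \<times> 'a \<times> 'a) set set" where
  "proj_line F = (\<lambda>(a, b, c).
     {P \<in> points F. \<forall>(x, y, z) \<in> P.
        a \<otimes>\<^bsub>F\<^esub> x \<oplus>\<^bsub>F\<^esub> b \<otimes>\<^bsub>F\<^esub> y \<oplus>\<^bsub>F\<^esub> c \<otimes>\<^bsub>F\<^esub> z = \<zero>\<^bsub>F\<^esub>})"

definition lines :: "('a, 'm) ring_scheme \<Rightarrow> ('a \<times> 'a \<times> 'a) set set set" where
  "lines F = proj_line F ` nonzero_vectors F"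

section \<open>Line configurations\<close>

definition line_configuration ::
  "('a, 'm) ring_scheme \<Rightarrow> nat \<Rightarrow> ('a \<times> 'a \<times> 'a) set set set \<Rightarrow> bool" where
  "line_configuration F s C \<longleftrightarrow> C \<subseteq> lines F \<and> finite C \<and> card C = s"

definition point_multiplicity :: "'p set set \<Rightarrow> 'p \<Rightarrow> nat" where
  "point_multiplicity C P = card {L \<in> C. P \<in> L}"

definition triple_points ::
  "('a, 'm) ring_scheme \<Rightarrow> ('a \<times> 'a \<times> 'a) set set set \<Rightarrow> ('a \<times> 'a \<times> 'a) set set" where
  "triple_points F C = {P \<in> points F. point_multiplicity C P = 3}"

definition multiplicity_ge3_points ::
  "('a, 'm) ring_scheme \<Rightarrow> ('a \<times> 'a \<times> 'a) set set set \<Rightarrow> ('a \<times> 'a \<times> 'a) set set" where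
  "multiplicity_ge3_points F C = {P \<in> points F. point_multiplicity C P \<ge> 3}"

section \<open>The bound and the conditions on the field\<close>

text \<open>
  Division on \<open>int\<close> rounds down, so \<open>div\<close> is the floor of the quotient.
\<close>

definition U3 :: "nat \<Rightarrow> int" where
  "U3 s = ((int s - 1) div 2 * int s) div 3 - (if s mod 6 = 5 then 1 else 0)"

lemma U3_values: "map U3 [1, 2, 3, 4, 5, 6] = [0, 0, 1, 1, 2, 4]"
  by (simp add: U3_def)

text \<open>
  The library's order of a group element is \<open>0\<close> when the element has infinite order, so the order
  of \<open>\<one>\<close> in the additive group is the characteristic, including characteristic \<open>0\<close>.
\<close>

definition ring_characteristic :: "('a, 'm) ring_scheme \<Rightarrow> nat" where
  "ring_characteristic F = group.ord (add_monoid F) \<one>\<^bsub>F\<^esub>"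

definition has_nontrivial_cube_root_of_one :: "('a, 'm) ring_scheme \<Rightarrow> bool" where
  "has_nontrivial_cube_root_of_one F \<longleftrightarrow>
     (\<exists>\<omega> \<in> carrier F. \<omega> [^]\<^bsub>F\<^esub> (3::nat) = \<one>\<^bsub>F\<^esub> \<and> \<omega> \<noteq> \<one>\<^bsub>F\<^esub>)"

section \<open>Existence over some field\<close>

text \<open>
  Types cannot be quantified existentially, so ``over some field'' is expressed with a field
  whose carrier is a set of integers.  This loses no generality: the equations of finitely many
  lines involve finitely many coefficients; the subfield they generate is countable, it is
  therefore isomorphic to a field of this kind, and the lines, their intersection points and the
  multiplicities of these points are already visible over that subfield.
\<close>

definition configuration_over_some_field :: "nat \<Rightarrow> nat \<Rightarrow> bool" where
  "configuration_over_some_field s t \<longleftrightarrow>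
     (\<exists>F :: int ring. field F \<and>
        (\<exists>C. line_configuration F s C \<and> card (triple_points F C) = t))"

end

theory Submission
  imports Defs "HOL-Number_Theory.Residues"
begin

text \<open>
  Three lines are concurrent iff the determinant of their coefficient vectors vanishes, so a
  configuration of lines with indices \<open>0, \<dots>, n - 1\<close> is studied through its block system: the sets of
  at least three indices of lines with a common point. Two blocks share at most one index, and the
  block system knows the number and the multiplicities of the points that the theorem counts.

  The negative and the structural claims have a combinatorial and an algebraic half.

  Combinatorial half. The number of blocks in question is so large that only few pairs of lines lie
  in no block. Counting with parities shows what the graph of these missed pairs is: empty for 7
  lines with 7 triple points, a perfect matching for 8 lines with 8 triple points, a star with three
  rays and three separate edges (or three separate edges outside one block of size 4) for 10 lines
  with 13 points, and a 4-cycle for 11 lines with 17 triple points. Labels taken from this graph and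
  from the blocks of one or two lines fix so much of the block system that all ways to complete it
  can be listed by a small search (\<open>completions_complete\<close>). Every completion turns out to be a
  relabelling of one of seven systems; this is \<open>fano_unique\<close>, \<open>moebius_kantor_unique\<close>,
  \<open>ten_lines_classification\<close> and \<open>eleven_lines_classification\<close>.

  Algebraic half. Four lines of a model, no three of them concurrent, become the coordinate frame
  (\<open>normal_frame\<close>). Each further line then has one unknown coordinate, and the remaining blocks are
  equations between these unknowns. For the Fano system they say \<open>2 = 0\<close>. For the Moebius-Kantor
  system they make the four points in which the missed pairs meet collinear; the line through these
  points is the ninth line. In the system \<open>ten_menelaus\<close> a parameter satisfies \<open>g = 3\<close> and \<open>g\<^sup>2 = -1\<close>,
  so \<open>10 = 0\<close>, and \<open>2 = 0\<close> would make two lines equal. The systems \<open>ten_triple\<close>, \<open>ten_quadruple\<close> and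
  \<open>eleven_hexagon\<close> contain six lines in general position with four 1-factors of their fifteen
  intersection points, each carried by a further line. This forces a parameter \<open>c\<close> with
  \<open>c\<^sup>2 = c + 1\<close>, and three of the four further lines are concurrent iff \<open>2 = 0\<close>. Hence
  \<open>ten_quadruple\<close> lives in characteristic 2, where \<open>c\<close> is a non-trivial third root of 1, while the
  other two would need two of the further lines to meet both in a block and outside of all blocks.
  The system \<open>eleven_quadrangle\<close> leads to \<open>\<alpha>\<^sup>2 = 1\<close>, and either sign is contradictory.

  For the existence claims the lines are written down with integers or Eisenstein integers as
  coordinates, so that the vanishing of all determinants is decided by calculation; then
  \<open>realizes_blocks\<close> gives the exact block system.

  A field given as a record has no convenient arithmetic, therefore all coordinates are taken from a
  type-class ring that maps onto the field.
\<close>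

section \<open>Calculating in a field record as in a type-class ring\<close>

text \<open>
  A field record on a type \<open>'a\<close> is not an instance of a type class, but it is a quotient of one: the
  ring of formal ring expressions over \<open>'a\<close>, where expressions are identified if no evaluation in a
  commutative ring record distinguishes them. This ring satisfies the class axioms because every
  record does, and the evaluation in the given field is a homomorphism onto the field.
\<close>

datatype 'a ring_expr =
    Gen 'a | Zero | One
  | Add "'a ring_expr" "'a ring_expr" | Neg "'a ring_expr" | Mul "'a ring_expr" "'a ring_expr"

primrec ring_eval :: "'b ring \<Rightarrow> ('a \<Rightarrow> 'b) \<Rightarrow> 'a ring_expr \<Rightarrow> 'b" where
  "ring_eval R \<rho> (Gen a) = \<rho> a"
| "ring_eval R \<rho> Zero = \<zero>\<^bsub>R\<^esub>"
| "ring_eval R \<rho> One = \<one>\<^bsub>R\<^esub>"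
| "ring_eval R \<rho> (Add e f) = ring_eval R \<rho> e \<oplus>\<^bsub>R\<^esub> ring_eval R \<rho> f"
| "ring_eval R \<rho> (Neg e) = \<ominus>\<^bsub>R\<^esub> ring_eval R \<rho> e"
| "ring_eval R \<rho> (Mul e f) = ring_eval R \<rho> e \<otimes>\<^bsub>R\<^esub> ring_eval R \<rho> f"

lemma ring_eval_closed: "cring R \<Longrightarrow> range \<rho> \<subseteq> carrier R \<Longrightarrow> ring_eval R \<rho> e \<in> carrier R"
proof (induction e)
  case (Gen a) then show ?case by auto
qed (auto simp: cring.cring_simprules)

text \<open>
  The rings on \<open>'a\<close> alone would not do: if \<open>'a\<close> has only one element, they are all trivial and
  \<open>Zero\<close> would be identified with \<open>One\<close>. The rings on \<open>int\<close> include \<open>\<Z>\<close> and exclude this.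
\<close>

definition ring_expr_equiv :: "'a ring_expr \<Rightarrow> 'a ring_expr \<Rightarrow> bool" where
  "ring_expr_equiv e f \<longleftrightarrow>
     (\<forall>(R :: 'a ring) \<rho>. cring R \<and> range \<rho> \<subseteq> carrier R \<longrightarrow> ring_eval R \<rho> e = ring_eval R \<rho> f) \<and>
     (\<forall>(R :: int ring) \<rho>. cring R \<and> range \<rho> \<subseteq> carrier R \<longrightarrow> ring_eval R \<rho> e = ring_eval R \<rho> f)"

quotient_type 'a generic_ring = "'a ring_expr" / ring_expr_equiv
  proof (rule equivpI)
  show "reflp ring_expr_equiv" by (simp add: reflp_def ring_expr_equiv_def)
  show "symp ring_expr_equiv" unfolding symp_def ring_expr_equiv_def by metis
  show "transp ring_expr_equiv" unfolding transp_def ring_expr_equiv_def by metis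
qed

lemma Zero_not_equiv_One: "\<not> ring_expr_equiv (Zero :: 'a ring_expr) One"
proof
  assume "ring_expr_equiv (Zero :: 'a ring_expr) One"
  then have "cring \<Z> \<and> range (\<lambda>_ :: 'a. 0 :: int) \<subseteq> carrier \<Z> \<longrightarrow>
      ring_eval \<Z> (\<lambda>_ :: 'a. 0) Zero = ring_eval \<Z> (\<lambda>_ :: 'a. 0) One"
    unfolding ring_expr_equiv_def by (elim conjE allE[of _ "\<Z>"] allE[of _ "\<lambda>_. 0"])
  then show False by (simp add: int_is_cring)
qed


instantiation generic_ring :: (type) comm_ring_1
begin

lift_definition zero_generic_ring :: "'a generic_ring" is Zero .
lift_definition one_generic_ring :: "'a generic_ring" is One .
lift_definition plus_generic_ring :: "'a generic_ring \<Rightarrow> 'a generic_ring \<Rightarrow> 'a generic_ring"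
  is Add by (auto simp: ring_expr_equiv_def)
lift_definition uminus_generic_ring :: "'a generic_ring \<Rightarrow> 'a generic_ring"
  is Neg by (auto simp: ring_expr_equiv_def)
lift_definition minus_generic_ring :: "'a generic_ring \<Rightarrow> 'a generic_ring \<Rightarrow> 'a generic_ring"
  is "\<lambda>e f. Add e (Neg f)" by (auto simp: ring_expr_equiv_def)
lift_definition times_generic_ring :: "'a generic_ring \<Rightarrow> 'a generic_ring \<Rightarrow> 'a generic_ring"
  is Mul by (auto simp: ring_expr_equiv_def)

instance
proof
  show "(0 :: 'a generic_ring) \<noteq> 1"
    by transfer (rule Zero_not_equiv_One)
qed (transfer; simp add: ring_expr_equiv_def cring.cring_simprules ring_eval_closed)+

end

text \<open>
  The evaluation at the generators that are elements of the field; the other generators, which mean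
  nothing in the field, go to \<open>\<zero>\<close>.
\<close>

lift_definition generic_val :: "'a ring \<Rightarrow> 'a generic_ring \<Rightarrow> 'a" is
  "\<lambda>F e. if cring F then ring_eval F (\<lambda>a. if a \<in> carrier F then a else \<zero>\<^bsub>F\<^esub>) e else undefined"
  unfolding ring_expr_equiv_def by (simp add: image_subset_iff cring.cring_simprules)

lemma generic_val_hom:
  assumes "cring F"
  shows "generic_val F x \<in> carrier F"
    and "generic_val F (x + y) = generic_val F x \<oplus>\<^bsub>F\<^esub> generic_val F y"
    and "generic_val F (x * y) = generic_val F x \<otimes>\<^bsub>F\<^esub> generic_val F y"
    and "generic_val F 1 = \<one>\<^bsub>F\<^esub>"
    and "a \<in> carrier F \<Longrightarrow> \<exists>x. generic_val F x = a"
proof -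
  show "generic_val F x \<in> carrier F"
    using assms by transfer (simp add: ring_eval_closed image_subset_iff cring.cring_simprules)
  show "generic_val F (x + y) = generic_val F x \<oplus>\<^bsub>F\<^esub> generic_val F y"
    "generic_val F (x * y) = generic_val F x \<otimes>\<^bsub>F\<^esub> generic_val F y"
    "generic_val F 1 = \<one>\<^bsub>F\<^esub>"
    using assms by (transfer; simp)+
  show "\<exists>x. generic_val F x = a" if "a \<in> carrier F"
    using that assms by transfer (rule_tac x = "Gen a" in exI, simp)
qed

section \<open>Points and lines by coordinates\<close>

type_synonym 'r vec = "'r \<times> 'r \<times> 'r"

fun dot :: "'r::comm_ring_1 vec \<Rightarrow> 'r vec \<Rightarrow> 'r" where
  "dot (a, b, c) (x, y, z) = a * x + b * y + c * z"

fun cross :: "'r::comm_ring_1 vec \<Rightarrow> 'r vec \<Rightarrow> 'r vec" where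
  "cross (a, b, c) (x, y, z) = (b * z - c * y, c * x - a * z, a * y - b * x)"

definition det3 :: "'r::comm_ring_1 vec \<Rightarrow> 'r vec \<Rightarrow> 'r vec \<Rightarrow> 'r" where
  "det3 u v w = dot u (cross v w)"

fun smul :: "'r::comm_ring_1 \<Rightarrow> 'r vec \<Rightarrow> 'r vec" where
  "smul c (x, y, z) = (c * x, c * y, c * z)"

lemma det3_simp: "det3 (a, b, c) (d, e, f) (g, h, i) =
    a * (e * i - f * h) + b * (f * g - d * i) + c * (d * h - e * g)"
  by (simp add: det3_def)

lemma dot_smul_right: "dot u (smul c p) = c * dot u p"
  by (cases u; cases p) (simp add: algebra_simps)

lemma smul_smul: "smul c (smul d p) = smul (c * d) p"
  by (cases p) (simp add: algebra_simps)

lemma dot_cross_self: "dot u (cross u v) = 0" "dot v (cross u v) = 0"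
  by (cases u; cases v; simp add: algebra_simps)+

lemma det3_rotate: "det3 v w u = det3 u v w"
  by (cases u; cases v; cases w) (simp add: det3_simp algebra_simps)

lemma det3_swap: "det3 v u w = - det3 u v w"
  by (cases u; cases v; cases w) (simp add: det3_simp algebra_simps)

lemma det3_repeat [simp]: "det3 u u w = 0" "det3 u w u = 0" "det3 w u u = 0"
  by (cases u; cases w; simp add: det3_simp algebra_simps)+

text \<open>
  Everything below happens in a class ring \<open>'r\<close> with a homomorphism \<open>val\<close> onto the field. Equations
  in the field become statements \<open>Z x\<close>, read: \<open>x\<close> is zero in the field. The set of these \<open>x\<close> is a
  maximal ideal, which is all the arithmetic that is needed.
\<close>

locale field_presentation = field R for R :: "'a ring" (structure) +
  fixes val :: "'r::comm_ring_1 \<Rightarrow> 'a"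
  assumes val_closed [simp]: "val x \<in> carrier R"
    and val_add: "val (x + y) = val x \<oplus> val y"
    and val_mult: "val (x * y) = val x \<otimes> val y"
    and val_1: "val 1 = \<one>"
    and val_surj: "a \<in> carrier R \<Longrightarrow> \<exists>x. val x = a"
begin

definition Z :: "'r \<Rightarrow> bool" where "Z x \<longleftrightarrow> val x = \<zero>"

lemma val_0 [simp]: "val 0 = \<zero>"
  using val_add[of 0 0] by (simp add: add.l_cancel_one')

lemma val_minus: "val (- x) = \<ominus> val x"
proof -
  have "val (- x) \<oplus> val x = \<zero>"
    using val_add[of "- x" x] by simp
  then show ?thesis by (simp add: minus_equality)
qed

lemma val_eq_iff: "val x = val y \<longleftrightarrow> Z (x - y)"
proof -
  have "val (x - y) = val x \<ominus> val y"
    using val_add[of x "- y"] by (simp add: val_minus a_minus_def)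
  then show ?thesis by (simp add: Z_def)
qed

lemma Z_0 [simp]: "Z 0" by (simp add: Z_def)

lemma Z_1 [simp]: "\<not> Z 1" by (simp add: Z_def val_1)

lemma Z_add: "Z x \<Longrightarrow> Z y \<Longrightarrow> Z (x + y)" by (simp add: Z_def val_add)

lemma Z_minus [simp]: "Z (- x) \<longleftrightarrow> Z x" by (simp add: Z_def val_minus)

lemma Z_mult_iff [simp]: "Z (x * y) \<longleftrightarrow> Z x \<or> Z y"
  by (simp add: Z_def val_mult integral_iff)

lemma Z_diff: "Z x \<Longrightarrow> Z y \<Longrightarrow> Z (x - y)"
  using Z_add[of x "- y"] by simp

lemma Z_diff_commute: "Z (x - y) \<longleftrightarrow> Z (y - x)"
  using Z_minus[of "x - y"] by simp

lemma Z_inverse: assumes "\<not> Z x" obtains y where "Z (x * y - 1)"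
proof -
  obtain y where "val y = inv val x"
    using assms val_surj[of "inv val x"] field_Units by (auto simp: Z_def)
  then have "val (x * y) = val 1"
    using assms field_Units by (simp add: Z_def val_mult val_1)
  then show ?thesis using that by (simp add: val_eq_iff)
qed

fun valv :: "'r vec \<Rightarrow> 'a vec" where
  "valv (x, y, z) = (val x, val y, val z)"

fun null :: "'r vec \<Rightarrow> bool" where
  "null (x, y, z) \<longleftrightarrow> Z x \<and> Z y \<and> Z z"

definition ln :: "'r vec \<Rightarrow> 'a vec set set" where "ln u = proj_line R (valv u)"
definition pt :: "'r vec \<Rightarrow> 'a vec set" where "pt p = proj_point R (valv p)"

lemma nonzero_vectors_eq: "nonzero_vectors R = valv ` {u. \<not> null u}"
proof -
  have "v \<in> valv ` {u. \<not> null u}" if "v \<in> nonzero_vectors R" for v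
  proof -
    obtain a b c where v: "v = (a, b, c)" by (cases v)
    then have "a \<in> carrier R" "b \<in> carrier R" "c \<in> carrier R"
      using that by (auto simp: nonzero_vectors_def)
    then obtain x y z where "val x = a" "val y = b" "val z = c"
      by (meson val_surj)
    then show ?thesis
      using that v by (intro image_eqI[of _ _ "(x, y, z)"]) (auto simp: nonzero_vectors_def Z_def)
  qed
  moreover have "valv u \<in> nonzero_vectors R" if "\<not> null u" for u
    using that by (cases u) (auto simp: nonzero_vectors_def Z_def)
  ultimately show ?thesis by blast
qed

lemma lines_eq: "lines R = ln ` {u. \<not> null u}"
  by (simp add: lines_def nonzero_vectors_eq ln_def image_image)

lemma points_eq: "points R = pt ` {p. \<not> null p}"
  by (simp add: points_def nonzero_vectors_eq pt_def image_image)

lemma pt_eq_multiples: "pt p = {valv (smul d p) |d. \<not> Z d}"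
proof -
  obtain x y z where p: "p = (x, y, z)" by (cases p)
  have "pt p = {(c \<otimes> val x, c \<otimes> val y, c \<otimes> val z) |c. c \<in> carrier R - {\<zero>}}"
    by (simp add: pt_def proj_point_def p)
  also have "\<dots> = {valv (smul d p) |d. \<not> Z d}"
    using val_surj by (auto simp: p val_mult Z_def)
  finally show ?thesis .
qed

lemma pt_in_ln: assumes "\<not> null p" shows "pt p \<in> ln u \<longleftrightarrow> Z (dot u p)"
proof -
  define on_line where "on_line = (\<lambda>(x, y, z). case valv u of (a, b, c) \<Rightarrow>
      a \<otimes> x \<oplus> b \<otimes> y \<oplus> c \<otimes> z = \<zero>)"
  have on_line_valv: "on_line (valv w) \<longleftrightarrow> Z (dot u w)" for w
    by (cases u; cases w) (simp add: on_line_def Z_def val_add val_mult)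
  have "pt p \<in> points R"
    using assms by (auto simp: points_eq)
  then have "pt p \<in> ln u \<longleftrightarrow> (\<forall>w \<in> pt p. on_line w)"
    by (cases u) (simp add: ln_def proj_line_def on_line_def)
  also have "\<dots> \<longleftrightarrow> (\<forall>d. \<not> Z d \<longrightarrow> on_line (valv (smul d p)))"
    unfolding pt_eq_multiples by blast
  also have "\<dots> \<longleftrightarrow> Z (dot u p)"
    by (auto simp: on_line_valv dot_smul_right intro: Z_1)
  finally show ?thesis .
qed

lemma null_cross_commute: "null (cross v u) \<longleftrightarrow> null (cross u v)"
  by (cases u; cases v) (auto simp: Z_diff_commute mult.commute)

text \<open>
  The vanishing minors determine \<open>q\<close> from any nonzero coordinate of \<open>p\<close>, so the factor is a quotient
  of corresponding coordinates; which coordinate of \<open>p\<close> is nonzero is not known.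
\<close>

lemma parallel_multiple:
  assumes "\<not> null p" "null (cross p q)"
  obtains d where "valv q = valv (smul d p)"
proof -
  obtain x y z x' y' z' where p: "p = (x, y, z)" and q: "q = (x', y', z')"
    by (cases p; cases q)
  have minors: "Z (y * z' - z * y')" "Z (z * x' - x * z')" "Z (x * y' - y * x')"
    using assms(2) by (auto simp: p q)
  then have minors': "Z (z * y' - y * z')" "Z (x * z' - z * x')" "Z (y * x' - x * y')"
    by (simp_all add: Z_diff_commute)
  have step: "Z (b' - a' * e * b)" if "Z (a * e - 1)" "Z (a * b' - b * a')" for a a' b b' e
  proof -
    have "b' - a' * e * b = e * (a * b' - b * a') - b' * (a * e - 1)"
      by (simp add: algebra_simps)
    then show ?thesis using that by (auto intro!: Z_diff)
  qed
  have step': "Z (a' - a' * e * a)" if "Z (a * e - 1)" for a a' e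
    using step[OF that, of a' a] by (simp add: mult.commute)
  from assms(1) consider "\<not> Z x" | "\<not> Z y" | "\<not> Z z" by (auto simp: p)
  then show ?thesis
  proof cases
    case 1
    then obtain e where "Z (x * e - 1)" by (rule Z_inverse)
    then have "valv q = valv (smul (x' * e) p)"
      by (simp add: p q val_eq_iff) (blast intro: step step' minors minors')
    then show ?thesis by (rule that)
  next
    case 2
    then obtain e where "Z (y * e - 1)" by (rule Z_inverse)
    then have "valv q = valv (smul (y' * e) p)"
      by (simp add: p q val_eq_iff) (blast intro: step step' minors minors')
    then show ?thesis by (rule that)
  next
    case 3
    then obtain e where "Z (z * e - 1)" by (rule Z_inverse)
    then have "valv q = valv (smul (z' * e) p)"
      by (simp add: p q val_eq_iff) (blast intro: step step' minors minors')
    then show ?thesis by (rule that)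
  qed
qed

lemma valv_smul_cong: "valv p = valv q \<Longrightarrow> valv (smul c p) = valv (smul c q)"
  by (cases p; cases q) (simp add: val_mult)

lemma pt_multiple:
  assumes "valv q = valv (smul d p)" "\<not> null q"
  shows "pt q \<subseteq> pt p"
proof -
  have "\<not> Z d"
  proof
    assume "Z d"
    with assms show False by (cases p; cases q) (auto simp: Z_def val_mult)
  qed
  have "valv (smul e q) = valv (smul (e * d) p)" for e
    using valv_smul_cong[OF assms(1), of e] by (simp add: smul_smul)
  moreover have "\<not> Z (e * d)" if "\<not> Z e" for e
    using that \<open>\<not> Z d\<close> by simp
  ultimately show ?thesis unfolding pt_eq_multiples by blast
qed

lemma pt_eqI:
  assumes "\<not> null p" "\<not> null q" "null (cross p q)"
  shows "pt p = pt q"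
proof -
  obtain d where "valv q = valv (smul d p)" using parallel_multiple assms by blast
  moreover obtain e where "valv p = valv (smul e q)"
    using parallel_multiple[of q p] assms null_cross_commute by blast
  ultimately show ?thesis using pt_multiple assms by (metis subset_antisym)
qed

lemma ln_subset_points: "ln u \<subseteq> points R"
  by (cases u) (auto simp: ln_def proj_line_def)

lemma ln_eqI:
  assumes "\<not> null u" "\<not> null v" "null (cross u v)"
  shows "ln u = ln v"
proof -
  obtain d where d: "valv v = valv (smul d u)" using parallel_multiple assms by blast
  have "\<not> Z d"
  proof
    assume "Z d"
    with d assms show False by (cases u; cases v) (auto simp: Z_def val_mult)
  qed
  have "val (dot v p) = val (dot (smul d u) p)" for p
    using d by (cases u; cases v; cases p) (simp add: val_add val_mult)
  moreover have "dot (smul d u) p = d * dot u p" for p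
    by (cases u; cases p) (simp add: algebra_simps)
  ultimately have "Z (dot v p) \<longleftrightarrow> Z (dot u p)" for p
    using \<open>\<not> Z d\<close> by (metis Z_def Z_mult_iff)
  then have "pt p \<in> ln v \<longleftrightarrow> pt p \<in> ln u" if "\<not> null p" for p
    using that by (simp add: pt_in_ln)
  then show ?thesis
    using ln_subset_points unfolding points_eq by blast
qed

lemma meet_on_lines:
  assumes "\<not> null (cross u v)"
  shows "pt (cross u v) \<in> ln u" "pt (cross u v) \<in> ln v"
  using assms by (simp_all add: pt_in_ln dot_cross_self)

text \<open>
  A vector orthogonal to \<open>u\<close> and \<open>v\<close> is parallel to their cross product, by the expansion of the double
  cross product.
\<close>

lemma meet_unique:
  assumes "\<not> null (cross u v)" "P \<in> ln u" "P \<in> ln v"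
  shows "P = pt (cross u v)"
proof -
  have "P \<in> points R" using assms(2) ln_subset_points by blast
  then obtain p where p: "P = pt p" "\<not> null p" by (auto simp: points_eq)
  have "Z (dot u p)" "Z (dot v p)" using assms p by (simp_all add: pt_in_ln)
  moreover have "cross p (cross (a, b, c) (x, y, z)) =
     (a * dot (x, y, z) p - x * dot (a, b, c) p, b * dot (x, y, z) p - y * dot (a, b, c) p,
      c * dot (x, y, z) p - z * dot (a, b, c) p)" for a b c x y z
    by (cases p) (simp add: algebra_simps)
  ultimately have "null (cross p (cross u v))"
    by (cases u; cases v) (auto intro!: Z_diff simp del: dot.simps cross.simps)
  then show ?thesis using pt_eqI p assms(1) by simp
qed

text \<open>
  A point on the first line and off the second is found on one of the three coordinate lines: the
  second line's form takes the coordinates of the cross product as values at these points.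
\<close>

lemma ln_neqI: assumes "\<not> null (cross u v)" shows "ln u \<noteq> ln v"
proof -
  obtain e where e: "\<not> Z (dot v (cross u e))"
  proof -
    obtain a b c x y z where "u = (a, b, c)" "v = (x, y, z)" by (cases u; cases v)
    then show ?thesis
      using assms that[of "(1, 0, 0)"] that[of "(0, 1, 0)"] that[of "(0, 0, 1)"]
      by (auto simp: mult.commute Z_diff_commute)
  qed
  moreover have "\<not> null (cross u e)"
  proof
    assume "null (cross u e)"
    then have "Z (dot v (cross u e))"
      by (cases "cross u e"; cases v) (auto intro!: Z_add)
    with e show False by simp
  qed
  ultimately have "pt (cross u e) \<in> ln u" "pt (cross u e) \<notin> ln v"
    by (simp_all add: pt_in_ln dot_cross_self)
  then show ?thesis by blast
qed

section \<open>The block system of a configuration\<close>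

definition distinct_lines :: "nat \<Rightarrow> (nat \<Rightarrow> 'r vec) \<Rightarrow> bool" where
  "distinct_lines n v \<longleftrightarrow>
     (\<forall>i<n. \<not> null (v i)) \<and> (\<forall>i<n. \<forall>j<n. i \<noteq> j \<longrightarrow> \<not> null (cross (v i) (v j)))"

definition config :: "nat \<Rightarrow> (nat \<Rightarrow> 'r vec) \<Rightarrow> 'a vec set set set" where
  "config n v = (\<lambda>i. ln (v i)) ` {..<n}"

definition through :: "nat \<Rightarrow> (nat \<Rightarrow> 'r vec) \<Rightarrow> 'a vec set \<Rightarrow> nat set" where
  "through n v P = {i. i < n \<and> P \<in> ln (v i)}"

definition blocks :: "nat \<Rightarrow> (nat \<Rightarrow> 'r vec) \<Rightarrow> nat set set" where
  "blocks n v = {B. (\<exists>P \<in> points R. B = through n v P) \<and> 3 \<le> card B}"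

lemma obtain_config:
  assumes "line_configuration R n C"
  obtains v where "distinct_lines n v" "C = config n v"
proof -
  have C: "C \<subseteq> lines R" "finite C" "card C = n"
    using assms by (auto simp: line_configuration_def)
  obtain h where h: "bij_betw h {..<n} C"
    using ex_bij_betw_nat_finite[OF C(2)] C(3) by (auto simp: atLeast0LessThan)
  have "\<forall>i<n. \<exists>u. \<not> null u \<and> ln u = h i"
  proof (intro allI impI)
    fix i assume "i < n"
    then have "h i \<in> lines R" using h C(1) by (auto simp: bij_betw_def)
    then show "\<exists>u. \<not> null u \<and> ln u = h i" unfolding lines_eq by blast
  qed
  then obtain v where v: "\<And>i. i < n \<Longrightarrow> \<not> null (v i) \<and> ln (v i) = h i" by metis
  have "distinct_lines n v"
    unfolding distinct_lines_def
  proof (intro conjI allI impI)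
    fix i j assume "i < n" "j < n" "i \<noteq> j"
    then have "ln (v i) \<noteq> ln (v j)"
      using v h by (auto simp: bij_betw_def inj_on_def)
    then show "\<not> null (cross (v i) (v j))"
      using v \<open>i < n\<close> \<open>j < n\<close> ln_eqI by blast
  qed (use v in blast)
  moreover have "C = config n v"
    using h v by (force simp: config_def bij_betw_def)
  ultimately show ?thesis using that by blast
qed

lemma inj_on_ln: "distinct_lines n v \<Longrightarrow> inj_on (\<lambda>i. ln (v i)) {..<n}"
  by (rule inj_onI) (metis ln_neqI distinct_lines_def lessThan_iff)

lemma line_configuration_config:
  assumes "distinct_lines n v" shows "line_configuration R n (config n v)"
proof -
  have "config n v \<subseteq> lines R"
    using assms unfolding config_def lines_eq distinct_lines_def by blast
  then show ?thesis
    using inj_on_ln[OF assms] by (auto simp: line_configuration_def config_def lines_eq distinct_lines_def card_image)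
qed

lemma point_multiplicity_config:
  assumes "distinct_lines n v"
  shows "point_multiplicity (config n v) P = card (through n v P)"
proof -
  have "inj_on (\<lambda>i. ln (v i)) (through n v P)"
    using inj_on_ln[OF assms] by (rule inj_on_subset) (auto simp: through_def)
  moreover have "{L \<in> config n v. P \<in> L} = (\<lambda>i. ln (v i)) ` through n v P"
    by (auto simp: config_def through_def)
  ultimately show ?thesis by (simp add: point_multiplicity_def card_image)
qed

lemma through_eq_meet:
  assumes "distinct_lines n v" "i \<in> through n v P" "j \<in> through n v P" "i \<noteq> j"
  shows "P = pt (cross (v i) (v j))"
  using assms meet_unique by (auto simp: distinct_lines_def through_def)

lemma two_in_block:
  assumes "3 \<le> card B" obtains i j where "i \<in> B" "j \<in> B" "i \<noteq> j"
proof -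
  have "\<not> card B \<le> Suc 0" using assms by simp
  then show ?thesis using that assms card_le_Suc0_iff_eq[of B]
    by (metis One_nat_def card.infinite not_numeral_le_zero)
qed

text \<open>
  A point of multiplicity at least 2 is determined by the lines through it, hence points of the
  configuration can be replaced by blocks.
\<close>

lemma bij_betw_blocks:
  assumes "distinct_lines n v"
  shows "bij_betw (through n v) (multiplicity_ge3_points R (config n v)) (blocks n v)"
    and "bij_betw (through n v) (triple_points R (config n v)) {B \<in> blocks n v. card B = 3}"
proof -
  have inj: "P = Q" if "through n v P = through n v Q" "3 \<le> card (through n v P)" for P Q
  proof -
    obtain i j where "i \<in> through n v P" "j \<in> through n v P" "i \<noteq> j"
      using two_in_block[OF \<open>3 \<le> card (through n v P)\<close>] .
    then show ?thesis
      using through_eq_meet[OF assms, of i P j] through_eq_meet[OF assms, of i Q j]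
        \<open>through n v P = through n v Q\<close> by simp
  qed
  show "bij_betw (through n v) (multiplicity_ge3_points R (config n v)) (blocks n v)"
    using inj by (auto simp: bij_betw_def inj_on_def multiplicity_ge3_points_def blocks_def
        point_multiplicity_config[OF assms])
  show "bij_betw (through n v) (triple_points R (config n v)) {B \<in> blocks n v. card B = 3}"
    using inj by (auto simp: bij_betw_def inj_on_def triple_points_def blocks_def
        point_multiplicity_config[OF assms])
qed

lemma block_subset: "B \<in> blocks n v \<Longrightarrow> B \<subseteq> {..<n}"
  by (auto simp: blocks_def through_def)

lemma block_card: "B \<in> blocks n v \<Longrightarrow> 3 \<le> card B"
  by (auto simp: blocks_def)

lemma block_unique:
  assumes "distinct_lines n v" "B \<in> blocks n v" "B' \<in> blocks n v" "i \<in> B" "j \<in> B" "i \<in> B'" "j \<in> B'" "i \<noteq> j"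
  shows "B = B'"
  using assms through_eq_meet[OF assms(1)] unfolding blocks_def by blast

text \<open>
  Concurrency of three lines is an algebraic as well as a combinatorial condition; all later
  arguments pass between the two sides through this equivalence.
\<close>

lemma det3_iff_block:
  assumes "distinct_lines n v" "i < n" "j < n" "k < n" "i \<noteq> j" "i \<noteq> k" "j \<noteq> k"
  shows "Z (det3 (v i) (v j) (v k)) \<longleftrightarrow> (\<exists>B \<in> blocks n v. {i, j, k} \<subseteq> B)"
proof -
  have nn: "\<not> null (cross (v j) (v k))" using assms by (simp add: distinct_lines_def)
  let ?P = "pt (cross (v j) (v k))"
  have jk: "j \<in> through n v ?P" "k \<in> through n v ?P"
    using assms meet_on_lines[OF nn] by (auto simp: through_def)
  have "Z (det3 (v i) (v j) (v k)) \<longleftrightarrow> ?P \<in> ln (v i)"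
    by (simp add: det3_def pt_in_ln nn)
  also have "\<dots> \<longleftrightarrow> (\<exists>B \<in> blocks n v. {i, j, k} \<subseteq> B)"
  proof
    assume "?P \<in> ln (v i)"
    then have sub: "{i, j, k} \<subseteq> through n v ?P" using jk assms by (auto simp: through_def)
    have "card {i, j, k} = 3" using assms by simp
    moreover have "finite (through n v ?P)" by (simp add: through_def)
    ultimately have "3 \<le> card (through n v ?P)" using sub card_mono by metis
    then show "\<exists>B \<in> blocks n v. {i, j, k} \<subseteq> B"
      using sub nn unfolding blocks_def points_eq by blast
  next
    assume "\<exists>B \<in> blocks n v. {i, j, k} \<subseteq> B"
    then obtain P where P: "{i, j, k} \<subseteq> through n v P" by (auto simp: blocks_def)
    then have "P = ?P" using through_eq_meet[OF assms(1)] assms(7) by blast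
    then show "?P \<in> ln (v i)" using P by (auto simp: through_def)
  qed
  finally show ?thesis .
qed

end

section \<open>Counting in block systems\<close>

locale block_system =
  fixes C :: "'a set" and \<B> :: "'a set set"
  assumes finite_C: "finite C"
    and block_sub: "B \<in> \<B> \<Longrightarrow> B \<subseteq> C"
    and card_ge3: "B \<in> \<B> \<Longrightarrow> 3 \<le> card B"
    and block_eqI: "\<lbrakk>B \<in> \<B>; B' \<in> \<B>; x \<in> B; y \<in> B; x \<in> B'; y \<in> B'; x \<noteq> y\<rbrakk> \<Longrightarrow> B = B'"
begin

definition missed :: "'a \<Rightarrow> 'a set" where
  "missed x = {y \<in> C. y \<noteq> x \<and> \<not> (\<exists>B \<in> \<B>. x \<in> B \<and> y \<in> B)}"

lemma finite_\<B>: "finite \<B>"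
  using finite_C block_sub by (meson PowI finite_Pow_iff rev_finite_subset subsetI)

lemma finite_block: "B \<in> \<B> \<Longrightarrow> finite B"
  using finite_C block_sub finite_subset by blast

lemma missed_sym: "x \<in> C \<Longrightarrow> y \<in> missed x \<Longrightarrow> x \<in> missed y"
  by (auto simp: missed_def)

lemma missed_sub: "missed x \<subseteq> C" by (auto simp: missed_def)

lemma not_in_missed: "x \<notin> missed x" by (simp add: missed_def)

lemma finite_missed: "finite (missed x)"
  using finite_C missed_sub finite_subset by blast

text \<open>
  The blocks through \<open>x\<close> partition the other elements that are not missed by \<open>x\<close>.
\<close>

lemma degree:
  assumes "x \<in> C"
  shows "card (missed x) + (\<Sum>B | B \<in> \<B> \<and> x \<in> B. card B - 1) = card C - 1"
proof -
  let ?I = "{B. B \<in> \<B> \<and> x \<in> B}"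
  have I: "finite ?I" using finite_\<B> by simp
  have "C - {x} = missed x \<union> (\<Union>B \<in> ?I. B - {x})"
    using block_sub by (auto simp: missed_def)
  moreover have disjoint: "missed x \<inter> (\<Union>B \<in> ?I. B - {x}) = {}" by (auto simp: missed_def)
  moreover have "card (\<Union>B \<in> ?I. B - {x}) = (\<Sum>B \<in> ?I. card (B - {x}))"
  proof (rule card_UN_disjoint[OF I])
    show "\<forall>B \<in> ?I. \<forall>B' \<in> ?I. B \<noteq> B' \<longrightarrow> (B - {x}) \<inter> (B' - {x}) = {}"
      using block_eqI by blast
  qed (use finite_block in auto)
  moreover have "finite (\<Union>B \<in> ?I. B - {x})" using I finite_block by auto
  note card_Un_disjoint[OF finite_missed this disjoint]
  ultimately have "card (C - {x}) = card (missed x) + (\<Sum>B \<in> ?I. card (B - {x}))"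
    by (simp only:)
  moreover have "(\<Sum>B \<in> ?I. card (B - {x})) = (\<Sum>B \<in> ?I. card B - 1)"
    using finite_block by (intro sum.cong) auto
  ultimately show ?thesis using assms finite_C by simp
qed

lemma total_degree:
  "(\<Sum>x \<in> C. card (missed x)) + (\<Sum>B \<in> \<B>. card B * (card B - 1)) = card C * (card C - 1)"
proof -
  have "(\<Sum>x \<in> C. \<Sum>B | B \<in> \<B> \<and> x \<in> B. card B - 1) = (\<Sum>B \<in> \<B>. \<Sum>x | x \<in> C \<and> x \<in> B. card B - 1)"
    by (rule sum.swap_restrict[OF finite_C finite_\<B>])
  also have "\<dots> = (\<Sum>B \<in> \<B>. card B * (card B - 1))"
  proof (rule sum.cong)
    fix B assume "B \<in> \<B>"
    then have "{x. x \<in> C \<and> x \<in> B} = B" using block_sub by blast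
    then show "(\<Sum>x | x \<in> C \<and> x \<in> B. card B - 1) = card B * (card B - 1)" by simp
  qed simp
  finally have "(\<Sum>x \<in> C. card (missed x)) + (\<Sum>B \<in> \<B>. card B * (card B - 1)) =
      (\<Sum>x \<in> C. card (missed x) + (\<Sum>B | B \<in> \<B> \<and> x \<in> B. card B - 1))"
    by (simp add: sum.distrib)
  also have "\<dots> = (\<Sum>x \<in> C. card C - 1)" by (intro sum.cong refl degree)
  also have "\<dots> = card C * (card C - 1)" by simp
  finally show ?thesis .
qed

lemma weight_ge: assumes "B \<in> \<B>" "k \<le> card B" shows "k * (k - 1) \<le> card B * (card B - 1)"
  using assms by (intro mult_le_mono) auto

text \<open>
  Each triple uses up six ordered pairs and any larger block at least twelve.
\<close>

lemma all_triples:
  assumes "card C * (card C - 1) < 6 * card {B \<in> \<B>. card B = 3} + 12"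
  shows "\<forall>B \<in> \<B>. card B = 3"
proof (rule ccontr)
  assume "\<not> (\<forall>B \<in> \<B>. card B = 3)"
  then obtain B0 where B0: "B0 \<in> \<B>" "card B0 \<noteq> 3" by blast
  then have "4 \<le> card B0" using card_ge3[of B0] by simp
  let ?T = "{B \<in> \<B>. card B = 3}"
  have "(\<Sum>B \<in> insert B0 ?T. card B * (card B - 1)) = card B0 * (card B0 - 1) + card ?T * 6"
    using finite_\<B> B0 by simp
  moreover have "12 \<le> card B0 * (card B0 - 1)"
    using weight_ge[OF B0(1) \<open>4 \<le> card B0\<close>] by simp
  moreover have "(\<Sum>B \<in> insert B0 ?T. card B * (card B - 1)) \<le> (\<Sum>B \<in> \<B>. card B * (card B - 1))"
    using finite_\<B> B0 by (intro sum_mono2) auto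
  ultimately show False using total_degree assms by linarith
qed

lemma total_missed_triples:
  assumes "\<forall>B \<in> \<B>. card B = 3"
  shows "(\<Sum>x \<in> C. card (missed x)) + 6 * card \<B> = card C * (card C - 1)"
  using total_degree assms by simp

text \<open>
  Triples through \<open>x\<close> cover the other elements in pairs.
\<close>

lemma even_missed:
  assumes "x \<in> C" "\<And>B. B \<in> \<B> \<Longrightarrow> x \<in> B \<Longrightarrow> card B = 3"
  shows "even (card (missed x)) \<longleftrightarrow> even (card C - 1)"
proof -
  have "(\<Sum>B | B \<in> \<B> \<and> x \<in> B. card B - 1) = (\<Sum>B | B \<in> \<B> \<and> x \<in> B. 2)"
    using assms(2) by (intro sum.cong) auto
  then have "even (\<Sum>B | B \<in> \<B> \<and> x \<in> B. card B - 1)" by simp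
  then show ?thesis unfolding degree[OF assms(1), symmetric] by simp
qed

definition third :: "'a \<Rightarrow> 'a \<Rightarrow> 'a" where
  "third x y = (THE z. {x, y, z} \<in> \<B> \<and> z \<noteq> x \<and> z \<noteq> y)"

lemma third_eqI: assumes "{x, y, z} \<in> \<B>" "x \<noteq> y" "x \<noteq> z" "y \<noteq> z" shows "third x y = z"
  unfolding third_def
proof (rule the_equality)
  fix w assume w: "{x, y, w} \<in> \<B> \<and> w \<noteq> x \<and> w \<noteq> y"
  then have "{x, y, w} = {x, y, z}" using block_eqI[of "{x, y, w}" "{x, y, z}" x y] assms by simp
  then show "w = z" using w by blast
qed (use assms in simp)

lemma third_block:
  assumes "x \<in> C" "y \<in> C" "x \<noteq> y" "y \<notin> missed x" "\<And>B. B \<in> \<B> \<Longrightarrow> x \<in> B \<Longrightarrow> y \<in> B \<Longrightarrow> card B = 3"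
  shows "{x, y, third x y} \<in> \<B>" "third x y \<noteq> x" "third x y \<noteq> y" "third x y \<in> C"
    "third x y \<notin> missed x" "third x (third x y) = y" "third y x = third x y"
proof -
  obtain B where B: "B \<in> \<B>" "x \<in> B" "y \<in> B" using assms by (auto simp: missed_def)
  then have "card (B - {x, y}) = 1" using assms(3,5) finite_block by (simp add: card_Diff_subset)
  then obtain z where "B - {x, y} = {z}" by (auto simp: card_1_singleton_iff)
  then have z: "B = {x, y, z}" "z \<noteq> x" "z \<noteq> y" using B by auto
  then have "third x y = z" using third_eqI B assms(3) by simp
  moreover have "third x z = y" "third y x = z"
    using third_eqI[of x z y] third_eqI[of y x z] z B assms(3) by (simp_all add: insert_commute)
  ultimately show "{x, y, third x y} \<in> \<B>" "third x y \<noteq> x" "third x y \<noteq> y" "third x y \<in> C"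
    "third x y \<notin> missed x" "third x (third x y) = y" "third y x = third x y"
    using B z block_sub by (auto simp: missed_def)
qed

end

section \<open>Completing a partial block system\<close>

definition upair :: "nat \<Rightarrow> nat \<Rightarrow> nat \<times> nat" where "upair i j = (min i j, max i j)"

text \<open>
  Exhaustive search for the systems of triples that extend the blocks \<open>acc\<close> and cover the pairs in
  \<open>U\<close>, each once: the first uncovered pair must lie in some triple \<open>{i, j, k}\<close>, and \<open>k\<close> is possible
  only if the other two pairs of this triple are uncovered as well.
\<close>

function completions :: "nat \<Rightarrow> (nat \<times> nat) list \<Rightarrow> nat list list \<Rightarrow> nat list list list" where
  "completions n [] acc = [acc]"
| "completions n ((i, j) # U) acc = concat (map
     (\<lambda>k. completions n (filter (\<lambda>(a, b). a \<notin> {i, j, k} \<or> b \<notin> {i, j, k}) U) ([i, j, k] # acc))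
     (filter (\<lambda>k. upair i k \<in> set U \<and> upair j k \<in> set U) [0..<n]))"
  by pat_completeness auto
termination
  by (relation "measure (\<lambda>(n, U, acc). length U)") (auto simp: le_imp_less_Suc)

definition open_pairs :: "nat \<Rightarrow> (nat \<times> nat) list \<Rightarrow> nat list list \<Rightarrow> (nat \<times> nat) list" where
  "open_pairs n E acc = filter (\<lambda>(i, j). (i, j) \<notin> set E \<and> \<not> (\<exists>B \<in> set acc. i \<in> set B \<and> j \<in> set B))
     (concat (map (\<lambda>i. map (\<lambda>j. (i, j)) [Suc i..<n]) [0..<n]))"

text \<open>
  The system searched for, \<open>\<S>\<close>, has a block through the first uncovered pair, and the search tries it.
  The invariant is that the uncovered pairs are those pairs inside blocks of \<open>\<S>\<close> that no block of
  \<open>acc\<close> covers; it survives the step because another block shares at most one element with the new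
  one.
\<close>

lemma completions_complete:
  assumes "\<And>B. B \<in> \<S> \<Longrightarrow> B \<subseteq> {..<n}"
    and uniq: "\<And>B B' i j. \<lbrakk>B \<in> \<S>; B' \<in> \<S>; i \<in> B; j \<in> B; i \<in> B'; j \<in> B'; i \<noteq> j\<rbrakk> \<Longrightarrow> B = B'"
    and "set ` set acc \<subseteq> \<S>"
    and "\<And>i j. (i, j) \<in> set U \<Longrightarrow> i < j \<and> (\<exists>B \<in> \<S>. card B = 3 \<and> i \<in> B \<and> j \<in> B \<and>
           (\<forall>a \<in> B. \<forall>b \<in> B. a < b \<longrightarrow> (a, b) \<in> set U))"
    and "\<And>B. B \<in> \<S> \<Longrightarrow> B \<in> set ` set acc \<or> (\<exists>(i, j) \<in> set U. i \<in> B \<and> j \<in> B)"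
  shows "\<exists>r \<in> set (completions n U acc). \<S> = set ` set r"
  using assms(1,3-)
proof (induction n U acc rule: completions.induct)
  case (1 n acc)
  then show ?case by auto
next
  case (2 n i j U acc)
  have ij: "i < j" using "2.prems"(3)[of i j] by simp
  obtain B where B: "B \<in> \<S>" "card B = 3" "i \<in> B" "j \<in> B"
      "\<And>a b. a \<in> B \<Longrightarrow> b \<in> B \<Longrightarrow> a < b \<Longrightarrow> (a, b) \<in> set ((i, j) # U)"
    using "2.prems"(3)[of i j] by auto
  have "finite B" using B(2) card.infinite by fastforce
  then have "card (B - {i, j}) = 1" using B ij by (simp add: card_Diff_subset)
  then obtain k where "B - {i, j} = {k}" by (auto simp: card_1_singleton_iff)
  then have Bk: "B = {i, j, k}" "k \<noteq> i" "k \<noteq> j" using B by auto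
  have "k < n" using "2.prems"(1)[OF B(1)] Bk by auto
  have up: "upair a k \<in> set ((i, j) # U)" if "a \<in> B" "a \<noteq> k" for a
    using B(5)[of a k] B(5)[of k a] that Bk by (auto simp: upair_def min_def max_def)
  have upU: "upair i k \<in> set U" "upair j k \<in> set U"
    using up[of i] up[of j] Bk by (auto simp: upair_def min_def max_def split: if_splits)
  let ?U = "filter (\<lambda>(a, b). a \<notin> {i, j, k} \<or> b \<notin> {i, j, k}) U"
  have "\<exists>r \<in> set (completions n ?U ([i, j, k] # acc)). \<S> = set ` set r"
  proof (rule "2.IH")
    show "k \<in> set (filter (\<lambda>k. upair i k \<in> set U \<and> upair j k \<in> set U) [0..<n])"
      using upU \<open>k < n\<close> by simp
    show "B \<subseteq> {..<n}" if "B \<in> \<S>" for B using "2.prems"(1) that .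
    show "set ` set ([i, j, k] # acc) \<subseteq> \<S>" using "2.prems"(2) B(1) Bk by simp
  next
    fix a b assume ab: "(a, b) \<in> set ?U"
    then have "(a, b) \<in> set ((i, j) # U)" by simp
    from "2.prems"(3)[OF this] obtain B' where B': "a < b" "B' \<in> \<S>" "card B' = 3" "a \<in> B'" "b \<in> B'"
      "\<And>c d. c \<in> B' \<Longrightarrow> d \<in> B' \<Longrightarrow> c < d \<Longrightarrow> (c, d) \<in> set ((i, j) # U)" by blast
    have "B' \<noteq> B" using ab B' Bk by auto
    have "(c, d) \<in> set ?U" if "c \<in> B'" "d \<in> B'" "c < d" for c d
    proof -
      have "c \<notin> B \<or> d \<notin> B" using uniq[OF B'(2) B(1)] that \<open>B' \<noteq> B\<close> by blast
      then show ?thesis using B'(6)[OF that] Bk by auto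
    qed
    then show "a < b \<and> (\<exists>B \<in> \<S>. card B = 3 \<and> a \<in> B \<and> b \<in> B \<and>
           (\<forall>c \<in> B. \<forall>d \<in> B. c < d \<longrightarrow> (c, d) \<in> set ?U))" using B' by blast
  next
    fix B' assume B': "B' \<in> \<S>"
    show "B' \<in> set ` set ([i, j, k] # acc) \<or> (\<exists>(a, b) \<in> set ?U. a \<in> B' \<and> b \<in> B')"
    proof (cases "B' = B \<or> B' \<in> set ` set acc")
      case True
      then show ?thesis using Bk by auto
    next
      case False
      then obtain a b where ab: "(a, b) \<in> set ((i, j) # U)" "a \<in> B'" "b \<in> B'"
        using "2.prems"(4)[OF B'] by blast
      then have "a < b" using "2.prems"(3) by blast
      then have "a \<notin> B \<or> b \<notin> B" using uniq[OF B' B(1)] ab False by blast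
      then show ?thesis using ab Bk by auto
    qed
  qed
  then show ?case using upU \<open>k < n\<close> by auto
qed

definition partners :: "(nat \<times> nat) list \<Rightarrow> nat \<Rightarrow> nat list" where
  "partners E i = map snd (filter (\<lambda>e. fst e = i) E) @ map fst (filter (\<lambda>e. snd e = i) E)"

lemma set_partners: "j \<in> set (partners E i) \<longleftrightarrow> (i, j) \<in> set E \<or> (j, i) \<in> set E"
  by (force simp: partners_def)

definition relabels :: "nat \<Rightarrow> nat list \<Rightarrow> nat list list \<Rightarrow> nat list list \<Rightarrow> bool" where
  "relabels n p T r \<longleftrightarrow> distinct p \<and> length p = n \<and> set p \<subseteq> set [0..<n] \<and>
     set (map (\<lambda>B. set (map ((!) p) B)) T) = set (map set r)"

text \<open>
  The block system is isomorphic to the one given by the list \<open>T\<close> on the indices below \<open>n\<close>.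
\<close>

definition has_model :: "nat \<Rightarrow> nat list list \<Rightarrow> 'a set \<Rightarrow> 'a set set \<Rightarrow> bool" where
  "has_model n T C \<B> \<longleftrightarrow> (\<exists>\<phi>. bij_betw \<phi> {..<n} C \<and> \<B> = (\<lambda>B. \<phi> ` set B) ` set T)"

text \<open>
  The bridge from a labelling of \<open>C\<close> to the classification: if the labels place the blocks \<open>acc\<close> and the
  missed pairs \<open>E\<close>, then the whole system is one of the completions, and a list of relabellings that
  carry the models to all completions proves that one of the models is present.
\<close>

lemma (in block_system) model_by_completion:
  assumes xs: "distinct xs" "set xs = C" "length xs = n"
    and acc: "\<And>B. B \<in> set acc \<Longrightarrow> set B \<subseteq> {..<n} \<and> (!) xs ` set B \<in> \<B>"
    and triples: "\<And>B. B \<in> \<B> \<Longrightarrow> card B = 3 \<or> (\<exists>A \<in> set acc. B = (!) xs ` set A)"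
    and E: "list_all (\<lambda>(i, j). i < j \<and> j < n) E"
      "map missed xs = map (\<lambda>i. (!) xs ` set (partners E i)) [0..<n]"
    and check: "list_all (\<lambda>r. list_ex (\<lambda>(T, p). relabels n p T r) models) (completions n (open_pairs n E acc) acc)"
  shows "\<exists>(T, p) \<in> set models. has_model n T C \<B>"
proof -
  define \<phi> where "\<phi> = (!) xs"
  have bij: "bij_betw \<phi> {..<n} C" unfolding \<phi>_def using xs by (intro bij_betw_nth) auto
  define \<S> where "\<S> = {B. B \<subseteq> {..<n} \<and> \<phi> ` B \<in> \<B>}"
  have inj: "inj_on \<phi> {..<n}" using bij by (simp add: bij_betw_def)
  have uniq: "B = B'" if "B \<in> \<S>" "B' \<in> \<S>" "i \<in> B" "j \<in> B" "i \<in> B'" "j \<in> B'" "i \<noteq> j" for B B' i j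
  proof -
    have "\<phi> i \<noteq> \<phi> j" using inj that by (auto simp: \<S>_def inj_on_def)
    then have "\<phi> ` B = \<phi> ` B'" using block_eqI[of "\<phi> ` B" "\<phi> ` B'" "\<phi> i" "\<phi> j"] that by (auto simp: \<S>_def)
    then show ?thesis using inj that inj_on_image_eq_iff by (metis (no_types, lifting) \<S>_def mem_Collect_eq)
  qed
  have surj: "\<exists>A \<in> \<S>. B = \<phi> ` A" if "B \<in> \<B>" for B
  proof -
    have "B \<subseteq> \<phi> ` {..<n}" using bij block_sub[OF that] by (simp add: bij_betw_def)
    then obtain A where "A \<subseteq> {..<n}" "B = \<phi> ` A" by (elim subset_imageE)
    then show ?thesis using that by (auto simp: \<S>_def)
  qed
  have accS: "set ` set acc \<subseteq> \<S>" using acc by (auto simp: \<S>_def \<phi>_def)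
  have E_less: "a < b \<and> b < n" if "(a, b) \<in> set E" for a b
    using E(1) that by (auto simp: list_all_iff)
  have covered: "(i, j) \<notin> set E \<longleftrightarrow> (\<exists>B \<in> \<S>. i \<in> B \<and> j \<in> B)" if "i < j" "j < n" for i j
  proof -
    have "\<phi> i \<in> C" "\<phi> j \<in> C" "\<phi> i \<noteq> \<phi> j" using bij that inj by (auto simp: bij_betw_def inj_on_def)
    moreover have "\<phi> j \<in> missed (\<phi> i) \<longleftrightarrow> (i, j) \<in> set E"
    proof -
      have "map missed xs ! i = map (\<lambda>i. (!) xs ` set (partners E i)) [0..<n] ! i" by (simp only: E(2))
      then have "missed (\<phi> i) = \<phi> ` set (partners E i)" using that xs by (simp add: \<phi>_def)
      moreover have "set (partners E i) \<subseteq> {..<n}"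
        using E_less by (fastforce simp: set_partners)
      ultimately have "\<phi> j \<in> missed (\<phi> i) \<longleftrightarrow> j \<in> set (partners E i)"
        using inj_on_image_mem_iff[OF inj] that by simp
      then show ?thesis using E_less[of j i] that by (auto simp: set_partners)
    qed
    ultimately have "(i, j) \<notin> set E \<longleftrightarrow> (\<exists>B \<in> \<B>. \<phi> i \<in> B \<and> \<phi> j \<in> B)"
      by (auto simp: missed_def)
    also have "\<dots> \<longleftrightarrow> (\<exists>B \<in> \<S>. i \<in> B \<and> j \<in> B)"
    proof
      assume "\<exists>B \<in> \<B>. \<phi> i \<in> B \<and> \<phi> j \<in> B"
      then obtain A where A: "A \<in> \<S>" "\<phi> i \<in> \<phi> ` A" "\<phi> j \<in> \<phi> ` A" using surj by blast
      then have "i \<in> A" "j \<in> A" using inj_on_image_mem_iff[OF inj] that by (auto simp: \<S>_def)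
      then show "\<exists>B \<in> \<S>. i \<in> B \<and> j \<in> B" using A by blast
    qed (auto simp: \<S>_def)
    finally show ?thesis .
  qed
  have triple: "card A = 3" if "A \<in> \<S>" "A \<notin> set ` set acc" for A
  proof -
    have A: "A \<subseteq> {..<n}" "\<phi> ` A \<in> \<B>" using that by (auto simp: \<S>_def)
    have "\<not> (\<exists>A' \<in> set acc. \<phi> ` A = \<phi> ` set A')"
      using that A acc inj by (metis image_eqI inj_on_image_eq_iff)
    then have "card (\<phi> ` A) = 3" using triples[OF A(2)] by (simp add: \<phi>_def)
    then show ?thesis using card_image[OF inj_on_subset[OF inj A(1)]] by simp
  qed
  have mem_open: "(i, j) \<in> set (open_pairs n E acc) \<longleftrightarrow>
      i < j \<and> j < n \<and> (i, j) \<notin> set E \<and> \<not> (\<exists>B \<in> set acc. i \<in> set B \<and> j \<in> set B)" for i j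
    by (auto simp: open_pairs_def intro!: bexI[of _ i])
  have "\<exists>r \<in> set (completions n (open_pairs n E acc) acc). \<S> = set ` set r"
  proof (rule completions_complete[OF _ uniq accS])
    show "B \<subseteq> {..<n}" if "B \<in> \<S>" for B using that by (simp add: \<S>_def)
  next
    fix i j assume ij: "(i, j) \<in> set (open_pairs n E acc)"
    then obtain B where B: "B \<in> \<S>" "i \<in> B" "j \<in> B" using covered mem_open by blast
    have "B \<notin> set ` set acc" using ij B mem_open by auto
    then have "card B = 3" using triple B by blast
    moreover have "(a, b) \<in> set (open_pairs n E acc)" if "a \<in> B" "b \<in> B" "a < b" for a b
    proof -
      have "b < n" using B that by (auto simp: \<S>_def)
      moreover have "\<not> (\<exists>A \<in> set acc. a \<in> set A \<and> b \<in> set A)"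
        using uniq[OF B(1) _ that(1,2)] that(3) accS \<open>B \<notin> set ` set acc\<close> by blast
      ultimately show ?thesis using covered[of a b] B that mem_open by blast
    qed
    ultimately show "i < j \<and> (\<exists>B \<in> \<S>. card B = 3 \<and> i \<in> B \<and> j \<in> B \<and>
           (\<forall>a \<in> B. \<forall>b \<in> B. a < b \<longrightarrow> (a, b) \<in> set (open_pairs n E acc)))"
      using B ij mem_open by blast
  next
    fix B assume B: "B \<in> \<S>"
    show "B \<in> set ` set acc \<or> (\<exists>(i, j) \<in> set (open_pairs n E acc). i \<in> B \<and> j \<in> B)"
    proof (cases "B \<in> set ` set acc")
      case False
      have "\<not> card B \<le> Suc 0" using triple[OF B False] by simp
      moreover have "finite B" using B finite_subset by (auto simp: \<S>_def)
      ultimately obtain a b where "a \<in> B" "b \<in> B" "a \<noteq> b" using card_le_Suc0_iff_eq by blast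
      then obtain i j where ij: "i \<in> B" "j \<in> B" "i < j" by (metis linorder_neq_iff)
      have "j < n" using B ij by (auto simp: \<S>_def)
      moreover have "\<not> (\<exists>A \<in> set acc. i \<in> set A \<and> j \<in> set A)"
        using uniq[OF B _ ij(1,2)] ij(3) accS False by blast
      ultimately show ?thesis using covered[of i j] B ij mem_open by blast
    qed simp
  qed
  then obtain r where r: "r \<in> set (completions n (open_pairs n E acc) acc)" "\<S> = set ` set r" by blast
  then obtain T p where Tp: "(T, p) \<in> set models" "relabels n p T r"
    using check by (fastforce simp: list_all_iff list_ex_iff)
  then have p: "distinct p" "length p = n" "set p \<subseteq> {..<n}" and
    T: "\<S> = (\<lambda>B. (!) p ` set B) ` set T"
    using r(2) by (auto simp: relabels_def image_image)
  have "card (set p) = n" using p distinct_card by blast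
  then have "set p = {..<n}" using p card_subset_eq by (metis card_lessThan finite_lessThan)
  then have "bij_betw ((!) p) {..<n} {..<n}" using p by (intro bij_betw_nth) auto
  then have "bij_betw (\<phi> \<circ> (!) p) {..<n} C" using bij bij_betw_trans by blast
  moreover have "\<B> = (\<lambda>B. (\<phi> \<circ> (!) p) ` set B) ` set T"
  proof -
    have "\<B> = (`) \<phi> ` \<S>" using surj unfolding \<S>_def by blast
    then show ?thesis using T by (simp add: image_image image_comp)
  qed
  ultimately show ?thesis using Tp(1) unfolding has_model_def by blast
qed

section \<open>Classification of the block systems\<close>

text \<open>
  Two fixed point free involutions without a common pair on six points are the two classes of
  alternate edges of a hexagon: walk along \<open>g\<close> and \<open>f\<close> in turn. The walk cannot close after four
  steps, since the remaining two points would be exchanged by both involutions.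
\<close>

lemma hexagon:
  assumes card_S: "card S = 6"
    and f: "\<And>y. y \<in> S \<Longrightarrow> f y \<in> S \<and> f y \<noteq> y \<and> f (f y) = y"
    and g: "\<And>y. y \<in> S \<Longrightarrow> g y \<in> S \<and> g y \<noteq> y \<and> g (g y) = y"
    and fg: "\<And>y. y \<in> S \<Longrightarrow> f y \<noteq> g y"
  obtains y0 y1 y2 y3 y4 y5 where
    "distinct [y0, y1, y2, y3, y4, y5]" "S = set [y0, y1, y2, y3, y4, y5]"
    "g y0 = y1" "g y2 = y3" "g y4 = y5" "f y1 = y2" "f y3 = y4" "f y5 = y0"
proof -
  have fin: "finite S" using card_S card.infinite by fastforce
  obtain y0 where y0: "y0 \<in> S" using card_S by fastforce
  define y1 where "y1 = g y0"
  define y2 where "y2 = f y1"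
  define y3 where "y3 = g y2"
  define y4 where "y4 = f y3"
  define y5 where "y5 = g y4"
  note y_defs = y1_def y2_def y3_def y4_def y5_def
  have S: "y1 \<in> S" "y2 \<in> S" "y3 \<in> S" "y4 \<in> S" "y5 \<in> S"
    unfolding y_defs using y0 f g by auto
  have pred: "g y1 = y0" "f y2 = y1" "g y3 = y2" "f y4 = y3" "g y5 = y4"
    unfolding y_defs using y0 f g by auto
  have n2: "y1 \<noteq> y0" "y2 \<noteq> y1" "y2 \<noteq> y0"
    using f[OF S(1)] g[OF y0] fg[OF S(1)] pred(1) by (auto simp: y1_def y2_def)
  have n3: "y3 \<noteq> y2" "y3 \<noteq> y1" "y3 \<noteq> y0"
    using g[OF S(2)] pred(1,3) n2 by (metis y3_def, metis, metis y1_def)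
  have n4: "y4 \<noteq> y3" "y4 \<noteq> y2" "y4 \<noteq> y1"
    using f[OF S(3)] fg[OF S(3)] pred(2-4) n3 by (metis y4_def, metis y4_def, metis y2_def)
  have "y4 \<noteq> y0"
  proof
    assume closed: "y4 = y0"
    have "card (S - {y0, y1, y2, y3}) = 2"
      using fin card_S y0 S n2 n3 by (simp add: card_Diff_subset)
    then obtain u v where uv: "S - {y0, y1, y2, y3} = {u, v}" "u \<noteq> v"
      by (auto simp: card_2_iff)
    then have "u \<in> S" by blast
    have "u \<notin> {y0, y1, y2, y3}" using uv by blast
    have images: "f ` {y0, y1, y2, y3} \<subseteq> {y0, y1, y2, y3}" "g ` {y0, y1, y2, y3} \<subseteq> {y0, y1, y2, y3}"
      using pred closed by (simp_all flip: y_defs)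
    then have "f (f u) \<in> {y0, y1, y2, y3}" if "f u \<in> {y0, y1, y2, y3}"
      using that by blast
    moreover have "g (g u) \<in> {y0, y1, y2, y3}" if "g u \<in> {y0, y1, y2, y3}"
      using that images by blast
    ultimately have "f u \<notin> {y0, y1, y2, y3}" "g u \<notin> {y0, y1, y2, y3}"
      using f[OF \<open>u \<in> S\<close>] g[OF \<open>u \<in> S\<close>] \<open>u \<notin> _\<close> by metis+
    then have "f u = v" "g u = v" using f[OF \<open>u \<in> S\<close>] g[OF \<open>u \<in> S\<close>] uv by blast+
    then show False using fg[OF \<open>u \<in> S\<close>] by simp
  qed
  note n4 = n4 this
  have n5: "y5 \<noteq> y4" "y5 \<noteq> y3" "y5 \<noteq> y2" "y5 \<noteq> y1" "y5 \<noteq> y0"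
    using g[OF S(4)] pred(1,3,5) n4 by (metis y5_def, metis, metis y3_def, metis, metis y1_def)
  have dist: "distinct [y0, y1, y2, y3, y4, y5]" using n2 n3 n4 n5 by auto
  have SS: "S = set [y0, y1, y2, y3, y4, y5]"
  proof (rule card_subset_eq[symmetric])
    show "card (set [y0, y1, y2, y3, y4, y5]) = card S" using distinct_card[OF dist] card_S by simp
  qed (use fin y0 S in auto)
  have f5: "f y5 = y0"
  proof -
    have "f y5 \<in> S" "f y5 \<noteq> y5" "f (f y5) = y5" using f S by auto
    moreover have "f y5 \<noteq> y1" "f y5 \<noteq> y2" "f y5 \<noteq> y3" "f y5 \<noteq> y4"
      using calculation(3) pred(2,4) n5 by (metis y2_def, metis, metis y4_def, metis)
    ultimately show ?thesis using SS by auto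
  qed
  show ?thesis
    by (rule that[OF dist SS]) (fact y_defs[symmetric] | fact f5)+
qed

text \<open>
  The rotations and reflections of the hexagon with vertices \<open>4, \<dots>, 9\<close> that keep its two classes of
  edges apart. They are the ambiguity left by a labelling of this hexagon.
\<close>

definition hexagon_symmetries :: "nat list list" where
  "hexagon_symmetries =
    [[0, 1, 2, 3, 4, 5, 6, 7, 8, 9], [0, 1, 2, 3, 6, 7, 8, 9, 4, 5], [0, 1, 2, 3, 8, 9, 4, 5, 6, 7],
     [0, 1, 2, 3, 5, 4, 9, 8, 7, 6], [0, 1, 2, 3, 7, 6, 5, 4, 9, 8], [0, 1, 2, 3, 9, 8, 7, 6, 5, 4]]"

definition fano :: "nat list list" where
  "fano = [[0, 1, 2], [0, 3, 4], [1, 3, 5], [2, 3, 6], [0, 5, 6], [1, 4, 6], [2, 4, 5]]"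

text \<open>
  The missed pairs are \<open>01\<close>, \<open>23\<close>, \<open>45\<close>, \<open>67\<close>.
\<close>

definition moebius_kantor :: "nat list list" where
  "moebius_kantor = [[0, 3, 4], [0, 5, 6], [0, 2, 7], [1, 2, 5], [1, 3, 6], [1, 4, 7], [2, 4, 6], [3, 5, 7]]"

text \<open>
  The fifteen pairs of the six points \<open>4, \<dots>, 9\<close> fall into five 1-factors. Four of them are attached
  to the points \<open>0, \<dots>, 3\<close>; the fifth, \<open>45\<close>, \<open>67\<close>, \<open>89\<close>, is free. The factor of \<open>0\<close> and the free one
  form the hexagon.
\<close>

definition hexagon_factors :: "nat list list" where
  "hexagon_factors =
    [[0, 5, 6], [0, 7, 8], [0, 4, 9], [1, 4, 7], [1, 6, 8], [1, 5, 9],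
     [2, 5, 8], [2, 4, 6], [2, 7, 9], [3, 6, 9], [3, 4, 8], [3, 5, 7]]"

text \<open>
  Read as points and collinear triples: \<open>4\<close>, \<open>6\<close>, \<open>8\<close> are on the sides of the triangle \<open>1, 2, 3\<close> and on
  a common line, as in the theorem of Menelaus.
\<close>

definition ten_menelaus :: "nat list list" where
  "ten_menelaus =
    [[0, 4, 9], [0, 5, 6], [0, 7, 8], [1, 2, 4], [1, 3, 6], [1, 5, 8], [1, 7, 9],
     [2, 3, 8], [2, 5, 7], [2, 6, 9], [3, 4, 7], [3, 5, 9], [4, 6, 8]]"

definition ten_triple :: "nat list list" where "ten_triple = hexagon_factors @ [[1, 2, 3]]"

definition ten_quadruple :: "nat list list" where "ten_quadruple = hexagon_factors @ [[0, 1, 2, 3]]"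

definition eleven_hexagon :: "nat list list" where
  "eleven_hexagon = hexagon_factors @ [[4, 5, 10], [6, 7, 10], [8, 9, 10], [0, 2, 10], [1, 3, 10]]"

definition eleven_quadrangle :: "nat list list" where
  "eleven_quadrangle =
    [[0, 2, 4], [1, 3, 5], [4, 5, 6], [0, 6, 7], [1, 6, 8], [2, 6, 9], [3, 6, 10], [0, 5, 8], [0, 9, 10],
     [1, 4, 9], [1, 7, 10], [2, 5, 10], [2, 7, 8], [3, 4, 7], [3, 8, 9], [4, 8, 10], [5, 7, 9]]"

text \<open>
  The completions of the partial systems that are met in the classification, compared with the
  models. For the six-point systems they are the images of one another under the symmetries of the
  hexagon; in the case of ten triples an exchange of \<open>2\<close> and \<open>3\<close> comes in as well.
\<close>

lemma check_fano:
  "list_all (\<lambda>r. list_ex (\<lambda>(T, p). relabels 7 p T r) [(fano, [0, 1, 2, 3, 4, 5, 6])])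
    (let acc = [[0, 1, 2], [0, 3, 4], [1, 3, 5], [2, 3, 6]] in completions 7 (open_pairs 7 [] acc) acc)"
  by code_simp

lemma check_moebius_kantor:
  "list_all (\<lambda>r. list_ex (\<lambda>(T, p). relabels 8 p T r) [(moebius_kantor, [0, 1, 2, 3, 4, 5, 6, 7])])
    (let acc = [[0, 3, 4], [0, 5, 6], [0, 7, 2]]
     in completions 8 (open_pairs 8 [(0, 1), (2, 3), (4, 5), (6, 7)] acc) acc)"
  by code_simp

lemma check_ten_quadruple:
  "list_all (\<lambda>r. list_ex (\<lambda>(T, p). relabels 10 p T r) (map (Pair ten_quadruple) hexagon_symmetries))
    (let acc = [[0, 1, 2, 3], [0, 5, 6], [0, 7, 8], [0, 9, 4]]
     in completions 10 (open_pairs 10 [(4, 5), (6, 7), (8, 9)] acc) acc)"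
  by code_simp

lemma check_ten_triples:
  "list_all (\<lambda>r. list_ex (\<lambda>(T, p). relabels 10 p T r)
      (map (Pair ten_menelaus) (hexagon_symmetries @ map (\<lambda>p. [0, 1, 3, 2] @ drop 4 p) hexagon_symmetries)
        @ map (Pair ten_triple) hexagon_symmetries))
    (let acc = [[0, 5, 6], [0, 7, 8], [0, 9, 4]]
     in completions 10 (open_pairs 10 [(0, 1), (0, 2), (0, 3), (4, 5), (6, 7), (8, 9)] acc) acc)"
  by code_simp

lemma check_eleven_hexagon:
  "list_all (\<lambda>r. list_ex (\<lambda>(T, p). relabels 11 p T r) (map (\<lambda>p. (eleven_hexagon, p @ [10])) hexagon_symmetries))
    (let acc = [[0, 2, 10], [1, 3, 10], [10, 4, 5], [10, 6, 7], [10, 8, 9], [0, 5, 6], [0, 7, 8], [0, 9, 4]]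
     in completions 11 (open_pairs 11 [(0, 1), (1, 2), (2, 3), (0, 3)] acc) acc)"
  by code_simp

lemma check_eleven_quadrangle:
  "list_all (\<lambda>r. list_ex (\<lambda>(T, p). relabels 11 p T r)
      [(eleven_quadrangle, [0, 1, 2, 3, 4, 5, 6, 7, 8, 9, 10]),
       (eleven_quadrangle, [0, 3, 2, 1, 4, 5, 6, 7, 10, 9, 8])])
    (let acc = [[0, 2, 4], [1, 3, 5], [4, 5, 6], [0, 6, 7], [1, 6, 8], [2, 6, 9], [3, 6, 10]]
     in completions 11 (open_pairs 11 [(0, 1), (1, 2), (2, 3), (0, 3)] acc) acc)"
  by code_simp

lemma card_numeral_nonempty: "card A = numeral k \<Longrightarrow> \<exists>x. x \<in> A"
  by (rule ccontr) auto

context block_system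
begin

text \<open>
  The blocks through \<open>x0\<close> pair the elements of \<open>S\<close>. Together with a second pairing that shares no pair
  with it they give a hexagon, hence labels for \<open>S\<close>.
\<close>

lemma hexagon_labels:
  assumes x0: "x0 \<in> C" and S: "S \<subseteq> C" "card S = 6"
    and y: "\<And>y. y \<in> S \<Longrightarrow> y \<noteq> x0 \<and> y \<notin> missed x0 \<and> third x0 y \<in> S"
    and triples: "\<And>B y. B \<in> \<B> \<Longrightarrow> x0 \<in> B \<Longrightarrow> y \<in> B \<Longrightarrow> y \<in> S \<Longrightarrow> card B = 3"
    and g: "\<And>y. y \<in> S \<Longrightarrow> g y \<in> S \<and> g y \<noteq> y \<and> g (g y) = y \<and> {x0, y, g y} \<notin> \<B>"
  obtains y0 y1 y2 y3 y4 y5 where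
    "distinct [y0, y1, y2, y3, y4, y5]" "S = set [y0, y1, y2, y3, y4, y5]"
    "g y0 = y1" "g y2 = y3" "g y4 = y5" "{x0, y1, y2} \<in> \<B>" "{x0, y3, y4} \<in> \<B>" "{x0, y5, y0} \<in> \<B>"
proof -
  have third: "{x0, y, third x0 y} \<in> \<B>" "third x0 y \<noteq> y" "third x0 (third x0 y) = y" if "y \<in> S" for y
  proof -
    have "y \<in> C" "x0 \<noteq> y" "y \<notin> missed x0" using S(1) y[OF that] that by auto
    moreover have "\<And>B. B \<in> \<B> \<Longrightarrow> x0 \<in> B \<Longrightarrow> y \<in> B \<Longrightarrow> card B = 3" using triples that by blast
    ultimately show "{x0, y, third x0 y} \<in> \<B>" "third x0 y \<noteq> y" "third x0 (third x0 y) = y"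
      using third_block[OF x0] by blast+
  qed
  obtain y0 y1 y2 y3 y4 y5 where ys: "distinct [y0, y1, y2, y3, y4, y5]"
      "S = set [y0, y1, y2, y3, y4, y5]" "g y0 = y1" "g y2 = y3" "g y4 = y5"
      "third x0 y1 = y2" "third x0 y3 = y4" "third x0 y5 = y0"
  proof (rule hexagon[OF S(2), of "third x0" g])
    show "third x0 z \<in> S \<and> third x0 z \<noteq> z \<and> third x0 (third x0 z) = z" if "z \<in> S" for z
      using y third that by blast
    show "g z \<in> S \<and> g z \<noteq> z \<and> g (g z) = z" if "z \<in> S" for z
      using g that by blast
    show "third x0 z \<noteq> g z" if "z \<in> S" for z
      using g[OF that] third[OF that] by metis
  qed
  show ?thesis
    by (rule that[OF ys(1-5)]) (use third(1)[of y1] third(1)[of y3] third(1)[of y5] ys in auto)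
qed

text \<open>
  Here the second pairing consists of the missed pairs.
\<close>

lemma mate_hexagon_labels:
  assumes x0: "x0 \<in> C" and S: "S \<subseteq> C" "card S = 6"
    and y: "\<And>y. y \<in> S \<Longrightarrow> y \<noteq> x0 \<and> y \<notin> missed x0 \<and> third x0 y \<in> S"
    and triples: "\<And>B y. B \<in> \<B> \<Longrightarrow> x0 \<in> B \<Longrightarrow> y \<in> B \<Longrightarrow> y \<in> S \<Longrightarrow> card B = 3"
    and mates: "\<And>y. y \<in> S \<Longrightarrow> missed y \<subseteq> S \<and> card (missed y) = 1"
  obtains y0 y1 y2 y3 y4 y5 where
    "distinct [y0, y1, y2, y3, y4, y5]" "S = set [y0, y1, y2, y3, y4, y5]"
    "missed y0 = {y1}" "missed y1 = {y0}" "missed y2 = {y3}" "missed y3 = {y2}"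
    "missed y4 = {y5}" "missed y5 = {y4}"
    "{x0, y1, y2} \<in> \<B>" "{x0, y3, y4} \<in> \<B>" "{x0, y5, y0} \<in> \<B>"
proof -
  define g where "g y = the_elem (missed y)" for y
  have g: "missed y = {g y}" "g y \<in> S" if "y \<in> S" for y
    using mates[OF that] by (auto simp: g_def card_1_singleton_iff)
  have gg: "g y \<noteq> y \<and> g (g y) = y \<and> {x0, y, g y} \<notin> \<B>" if "y \<in> S" for y
  proof -
    have "g y \<in> missed y" using g that by simp
    then have "g y \<noteq> y" "\<not> (\<exists>B \<in> \<B>. y \<in> B \<and> g y \<in> B)" "y \<in> missed (g y)"
      using missed_sym[of y "g y"] S(1) that by (auto simp: missed_def)
    moreover have "{x0, y, g y} \<notin> \<B>"
    proof
      assume "{x0, y, g y} \<in> \<B>"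
      then have "\<exists>B \<in> \<B>. y \<in> B \<and> g y \<in> B" by (rule rev_bexI) simp
      with calculation(2) show False by contradiction
    qed
    ultimately show ?thesis using g[of "g y"] g(2)[OF that] by simp
  qed
  obtain y0 y1 y2 y3 y4 y5 where ys:
      "distinct [y0, y1, y2, y3, y4, y5]" "S = set [y0, y1, y2, y3, y4, y5]" "g y0 = y1" "g y2 = y3" "g y4 = y5"
      "{x0, y1, y2} \<in> \<B>" "{x0, y3, y4} \<in> \<B>" "{x0, y5, y0} \<in> \<B>"
  proof (rule hexagon_labels[OF x0 S y triples])
    show "g z \<in> S \<and> g z \<noteq> z \<and> g (g z) = z \<and> {x0, z, g z} \<notin> \<B>" if "z \<in> S" for z
      using g(2)[OF that] gg[OF that] by simp
  qed
  then have "y0 \<in> S" "y2 \<in> S" "y4 \<in> S" by simp_all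
  then have "missed y0 = {y1}" "missed y1 = {y0}" "missed y2 = {y3}" "missed y3 = {y2}"
    "missed y4 = {y5}" "missed y5 = {y4}"
    using g gg ys(3-5) by metis+
  then show ?thesis using that ys by blast
qed

lemma card_triples:
  assumes "card C * (card C - 1) < 6 * card {B \<in> \<B>. card B = 3} + 12"
  shows "(\<Sum>x \<in> C. card (missed x)) + 6 * card {B \<in> \<B>. card B = 3} = card C * (card C - 1)"
proof -
  have "{B \<in> \<B>. card B = 3} = \<B>" using all_triples[OF assms] by blast
  then show ?thesis using total_missed_triples[OF all_triples[OF assms]] by simp
qed

text \<open>
  No pair is missed. A triangle \<open>a, b, d\<close> and the third elements on the lines of the complete
  quadrangle \<open>a, b, c, d\<close> exhaust the seven elements.
\<close>

theorem fano_unique: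
  assumes "card C = 7" "card {B \<in> \<B>. card B = 3} = 7"
  shows "has_model 7 fano C \<B>"
proof -
  have triples: "\<And>B. B \<in> \<B> \<Longrightarrow> card B = 3" using all_triples assms by simp
  have "(\<Sum>x \<in> C. card (missed x)) = 0" using card_triples assms by simp
  then have missed: "missed x = {}" if "x \<in> C" for x
    using that finite_C finite_missed by (auto simp: sum_eq_0_iff)
  have third: "{x, y, third x y} \<in> \<B>" "third x y \<noteq> x" "third x y \<noteq> y" "third x y \<in> C"
      "third x (third x y) = y" "third y x = third x y" if "x \<in> C" "y \<in> C" "x \<noteq> y" for x y
    using third_block[OF that] missed triples that by auto
  obtain a where a: "a \<in> C" using card_numeral_nonempty[OF assms(1)] by blast
  have "card (C - {a}) = 6" using assms a finite_C by simp
  from card_numeral_nonempty[OF this] obtain b where b: "b \<in> C" "b \<noteq> a" by blast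
  define c where "c = third a b"
  have c: "c \<in> C" "c \<noteq> a" "c \<noteq> b" "third a c = b" "third b c = a"
    using third(2-6)[of a b] third(5)[of b a] a b by (auto simp: c_def)
  have "card (C - {a, b, c}) = 4" using assms a b c finite_C by (simp add: card_Diff_subset)
  from card_numeral_nonempty[OF this] obtain d where "d \<in> C - {a, b, c}" by blast
  then have d: "d \<in> C" "d \<noteq> a" "d \<noteq> b" "d \<noteq> c" by auto
  define e f g where "e = third a d" and "f = third b d" and "g = third c d"
  have e: "e \<in> C" "e \<noteq> a" "e \<noteq> d" "third a e = d" "third d e = a"
    using third(2-6)[of a d] third(5)[of d a] a d by (auto simp: e_def)
  have f: "f \<in> C" "f \<noteq> b" "f \<noteq> d" "third b f = d" "third d f = b"
    using third(2-6)[of b d] third(5)[of d b] b d by (auto simp: f_def)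
  have g: "g \<in> C" "g \<noteq> c" "g \<noteq> d" "third c g = d" "third d g = c"
    using third(2-6)[of c d] third(5)[of d c] c d by (auto simp: g_def)
  have cb: "third c a = b" "third c b = a" "third b a = c"
    using third(6)[of a c] third(6)[of b c] third(6)[of a b] a b c by (auto simp: c_def)
  have "e \<noteq> b" using e(4) d(4) c_def by metis
  moreover have "e \<noteq> c" using e(4) d(3) c(4) by metis
  moreover have "f \<noteq> a" using f(4) d(4) cb(3) by metis
  moreover have "f \<noteq> c" using f(4) d(2) c(5) by metis
  moreover have "g \<noteq> a" using g(4) d(3) cb(1) by metis
  moreover have "g \<noteq> b" using g(4) d(2) cb(2) by metis
  moreover have "e \<noteq> f" using e(5) f(5) b(2) by metis
  moreover have "e \<noteq> g" using e(5) g(5) c(2) by metis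
  moreover have "f \<noteq> g" using f(5) g(5) c(3) by metis
  ultimately have dist: "distinct [a, b, c, d, e, f, g]" using a b c d e f g by auto
  have setC: "set [a, b, c, d, e, f, g] = C"
    by (rule card_subset_eq) (use finite_C a b c d e f g distinct_card[OF dist] assms in auto)
  have "\<exists>(T, p :: nat list) \<in> set [(fano, [0, 1, 2, 3, 4, 5, 6])]. has_model 7 T C \<B>"
  proof (rule model_by_completion[OF dist setC _ _ _ _ _ check_fano[unfolded Let_def]])
    fix B assume "B \<in> set [[0, 1, 2], [0, 3, 4], [1, 3, 5], [2, 3, 6 :: nat]]"
    then show "set B \<subseteq> {..<7} \<and> (!) [a, b, c, d, e, f, g] ` set B \<in> \<B>"
      using third(1)[of a b] third(1)[of a d] third(1)[of b d] third(1)[of c d] a b c d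
      by (auto simp: c_def e_def f_def g_def)
  next
    show "map missed [a, b, c, d, e, f, g] =
        map (\<lambda>i. (!) [a, b, c, d, e, f, g] ` set (partners [] i)) [0..<7]"
      using missed a b c d e f g by (simp add: upt_rec partners_def)
  qed (use triples in auto)
  then show ?thesis by simp
qed

text \<open>
  The numbers of missed partners are odd and add up to 8, so they are all 1. An element, its mate and
  the hexagon made of the other six label the system, and the completion is unique.
\<close>

theorem moebius_kantor_unique:
  assumes "card C = 8" "card {B \<in> \<B>. card B = 3} = 8"
  shows "has_model 8 moebius_kantor C \<B>"
proof -
  have triples: "\<And>B. B \<in> \<B> \<Longrightarrow> card B = 3" using all_triples assms by simp
  have odd: "odd (card (missed x))" if "x \<in> C" for x
    using even_missed[OF that] triples assms by simp
  have "(\<Sum>x \<in> C. card (missed x)) = 8" using card_triples assms by simp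
  also have "(\<Sum>x \<in> C. card (missed x)) = (\<Sum>x \<in> C. 1 + (card (missed x) - 1))"
    using odd by (intro sum.cong) (auto simp: odd_pos)
  also have "\<dots> = 8 + (\<Sum>x \<in> C. card (missed x) - 1)" by (simp only: sum.distrib) (simp add: assms)
  finally have "card (missed x) - 1 = 0" if "x \<in> C" for x
    using that finite_C by (auto simp: sum_eq_0_iff)
  then have one: "card (missed x) = 1" if "x \<in> C" for x
    using odd that by (metis One_nat_def Suc_pred odd_pos)
  obtain x0 where x0: "x0 \<in> C" using card_numeral_nonempty[OF assms(1)] by blast
  obtain x1 where x1: "missed x0 = {x1}" using one[OF x0] by (auto simp: card_1_singleton_iff)
  have x1C: "x1 \<in> C" "x1 \<noteq> x0" using x1 missed_sub not_in_missed by blast+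
  obtain w where "missed x1 = {w}" using one[OF x1C(1)] by (auto simp: card_1_singleton_iff)
  then have x1': "missed x1 = {x0}" using missed_sym[OF x0, of x1] x1 by auto
  define S where "S = C - {x0, x1}"
  have S: "S \<subseteq> C" "card S = 6"
    using assms x0 x1C finite_C by (auto simp: S_def card_Diff_subset)
  have mS: "missed y \<subseteq> S \<and> card (missed y) = 1" if "y \<in> S" for y
    using that one missed_sub[of y] missed_sym[of y] x1 x1' by (auto simp: S_def)
  obtain y0 y1 y2 y3 y4 y5 where ys: "distinct [y0, y1, y2, y3, y4, y5]" "S = set [y0, y1, y2, y3, y4, y5]"
    and m: "missed y0 = {y1}" "missed y1 = {y0}" "missed y2 = {y3}" "missed y3 = {y2}" "missed y4 = {y5}" "missed y5 = {y4}"
    and bl: "{x0, y1, y2} \<in> \<B>" "{x0, y3, y4} \<in> \<B>" "{x0, y5, y0} \<in> \<B>"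
  proof (rule mate_hexagon_labels[OF x0 S])
    fix y assume y: "y \<in> S"
    then have "y \<in> C" "x0 \<noteq> y" "y \<notin> missed x0" using x1 by (auto simp: S_def)
    then show "y \<noteq> x0 \<and> y \<notin> missed x0 \<and> third x0 y \<in> S"
      using third_block[OF x0 _ _ _ triples, of y] x1 by (auto simp: S_def)
  qed (use triples mS in auto)
  let ?xs = "[x0, x1, y0, y1, y2, y3, y4, y5]"
  have sets: "x0 \<notin> S" "x1 \<notin> S" by (auto simp: S_def)
  then have dist: "distinct ?xs" using ys x1C by auto
  have setC: "set ?xs = C" using ys x0 x1C unfolding S_def by auto
  have "\<exists>(T, p :: nat list) \<in> set [(moebius_kantor, [0, 1, 2, 3, 4, 5, 6, 7])]. has_model 8 T C \<B>"
  proof (rule model_by_completion[OF dist setC _ _ _ _ _ check_moebius_kantor[unfolded Let_def]])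
    fix B assume "B \<in> set [[0, 3, 4], [0, 5, 6], [0, 7, 2 :: nat]]"
    then show "set B \<subseteq> {..<8} \<and> (!) ?xs ` set B \<in> \<B>" using bl by (auto simp: numeral_eq_Suc)
  next
    show "map missed ?xs = map (\<lambda>i. (!) ?xs ` set (partners [(0, 1), (2, 3), (4, 5), (6, 7)] i)) [0..<8]"
      by (simp add: upt_rec partners_def m x1 x1')
  qed (use triples in auto)
  then show ?thesis by simp
qed

text \<open>
  The numbers of missed partners are odd and add up to 12 over ten elements: one element \<open>x0\<close> misses
  three others and every other element misses one.
\<close>

lemma ten_lines_all_triples:
  assumes "card C = 10" "card \<B> = 13" and triples: "\<And>B. B \<in> \<B> \<Longrightarrow> card B = 3"
  shows "has_model 10 ten_menelaus C \<B> \<or> has_model 10 ten_triple C \<B>"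
proof -
  have odd: "odd (card (missed x))" if "x \<in> C" for x
    using even_missed[OF that] triples assms by simp
  have "(\<Sum>x \<in> C. card (missed x)) = 12" using total_missed_triples triples assms by simp
  also have "(\<Sum>x \<in> C. card (missed x)) = (\<Sum>x \<in> C. 1 + 2 * (card (missed x) div 2))"
    using odd by (intro sum.cong) (auto simp: odd_two_times_div_two_succ)
  also have "\<dots> = 10 + 2 * (\<Sum>x \<in> C. card (missed x) div 2)"
    by (simp only: sum.distrib sum_distrib_left) (simp add: assms)
  finally have "(\<Sum>x \<in> C. card (missed x) div 2) = 1" by simp
  then obtain x0 where x0: "x0 \<in> C" "card (missed x0) div 2 = 1"
      "\<And>y. y \<in> C \<Longrightarrow> x0 \<noteq> y \<Longrightarrow> card (missed y) div 2 = 0"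
    using sum_eq_1_iff[OF finite_C] by auto
  have "card (missed x0) = 3"
    using odd_two_times_div_two_succ[OF odd[OF x0(1)]] x0(2) by simp
  then obtain x1 x2 x3 where xs: "missed x0 = {x1, x2, x3}" "x1 \<noteq> x2" "x1 \<noteq> x3" "x2 \<noteq> x3"
    by (auto simp: card_3_iff)
  have one: "card (missed y) = 1" if "y \<in> C" "y \<noteq> x0" for y
    using odd_two_times_div_two_succ[OF odd[OF that(1)]] x0(3) that by simp
  have xC: "x1 \<in> C" "x2 \<in> C" "x3 \<in> C" "x1 \<noteq> x0" "x2 \<noteq> x0" "x3 \<noteq> x0"
    using xs(1) missed_sub[of x0] not_in_missed[of x0] by auto
  have mx: "missed y = {x0}" if "y \<in> {x1, x2, x3}" for y
  proof -
    have "y \<in> C" "y \<noteq> x0" using that xC by auto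
    then obtain w where "missed y = {w}" using one by (auto simp: card_1_singleton_iff)
    moreover have "x0 \<in> missed y" using missed_sym[OF x0(1)] xs(1) that by blast
    ultimately show ?thesis by auto
  qed
  define S where "S = C - {x0, x1, x2, x3}"
  have S: "S \<subseteq> C" "card S = 6"
    using assms x0 xC xs finite_C by (auto simp: S_def card_Diff_subset)
  have mS: "missed y \<subseteq> S \<and> card (missed y) = 1" if "y \<in> S" for y
    using that one missed_sub[of y] missed_sym[of y] xs(1) mx by (fastforce simp: S_def)
  obtain y0 y1 y2 y3 y4 y5 where ys: "distinct [y0, y1, y2, y3, y4, y5]" "S = set [y0, y1, y2, y3, y4, y5]"
    and m: "missed y0 = {y1}" "missed y1 = {y0}" "missed y2 = {y3}" "missed y3 = {y2}" "missed y4 = {y5}" "missed y5 = {y4}"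
    and bl: "{x0, y1, y2} \<in> \<B>" "{x0, y3, y4} \<in> \<B>" "{x0, y5, y0} \<in> \<B>"
  proof (rule mate_hexagon_labels[OF x0(1) S])
    fix y assume y: "y \<in> S"
    then have "y \<in> C" "x0 \<noteq> y" "y \<notin> missed x0" using xs by (auto simp: S_def)
    then show "y \<noteq> x0 \<and> y \<notin> missed x0 \<and> third x0 y \<in> S"
      using third_block[OF x0(1) _ _ _ triples, of y] xs by (auto simp: S_def)
  qed (use triples mS in auto)
  let ?xs = "[x0, x1, x2, x3, y0, y1, y2, y3, y4, y5]"
  have sets: "x0 \<notin> S" "x1 \<notin> S" "x2 \<notin> S" "x3 \<notin> S" by (auto simp: S_def)
  then have dist: "distinct ?xs" using ys xC xs by auto
  have setC: "set ?xs = C" using ys x0 xC unfolding S_def by auto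
  have "\<exists>(T, p) \<in> set (map (Pair ten_menelaus) (hexagon_symmetries @ map (\<lambda>p. [0, 1, 3, 2] @ drop 4 p) hexagon_symmetries)
        @ map (Pair ten_triple) hexagon_symmetries). has_model 10 T C \<B>"
  proof (rule model_by_completion[OF dist setC _ _ _ _ _ check_ten_triples[unfolded Let_def]])
    fix B assume "B \<in> set [[0, 5, 6], [0, 7, 8], [0, 9, 4 :: nat]]"
    then show "set B \<subseteq> {..<10} \<and> (!) ?xs ` set B \<in> \<B>" using bl by (auto simp: numeral_eq_Suc)
  next
    show "map missed ?xs =
        map (\<lambda>i. (!) ?xs ` set (partners [(0, 1), (0, 2), (0, 3), (4, 5), (6, 7), (8, 9)] i)) [0..<10]"
      by (simp add: upt_rec partners_def m xs(1) mx)
  qed (use triples in auto)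
  then show ?thesis by auto
qed

text \<open>
  The 13 blocks use at least 78 of the 90 ordered pairs, each block of size 4 uses six more and a
  block of size 5 fourteen more. Two blocks of size 4 would use all pairs, against the parity of the
  number of missed partners at an element outside of both. So there is one such block \<open>Q\<close>, and by
  parity each of the six elements outside of it misses exactly one other.
\<close>

lemma ten_lines_quadruple:
  assumes "card C = 10" "card \<B> = 13" and Q: "Q \<in> \<B>" "card Q \<noteq> 3"
  shows "has_model 10 ten_quadruple C \<B>"
proof -
  let ?D = "{B \<in> \<B>. card B \<noteq> 3}"
  let ?w = "\<lambda>B :: 'a set. card B * (card B - 1)"
  have fD: "finite ?D" using finite_\<B> by simp
  have ge: "6 \<le> ?w B" if "B \<in> \<B>" for B using weight_ge[OF that, of 3] card_ge3[OF that] by simp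
  have "(\<Sum>B \<in> \<B>. ?w B) = (\<Sum>B \<in> \<B>. 6 + (?w B - 6))" using ge by (intro sum.cong) auto
  also have "\<dots> = 78 + (\<Sum>B \<in> \<B>. ?w B - 6)" by (simp only: sum.distrib) (simp add: assms)
  also have "(\<Sum>B \<in> \<B>. ?w B - 6) = (\<Sum>B \<in> ?D. ?w B - 6)"
    using finite_\<B> by (intro sum.mono_neutral_right) auto
  finally have total: "(\<Sum>x \<in> C. card (missed x)) + (\<Sum>B \<in> ?D. ?w B - 6) = 12"
    using total_degree assms by simp
  have four: "card B = 4" if "B \<in> ?D" for B
  proof (rule ccontr)
    assume "card B \<noteq> 4"
    then have "5 \<le> card B" using that card_ge3[of B] by auto
    then have "20 \<le> ?w B" using that weight_ge[of B 5] by simp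
    moreover have "?w B - 6 \<le> (\<Sum>B \<in> ?D. ?w B - 6)"
      by (rule member_le_sum[OF that _ fD]) simp
    ultimately show False using total by linarith
  qed
  have "?w B - 6 = 6" if "B \<in> ?D" for B using four[OF that] by simp
  then have "(\<Sum>B \<in> ?D. ?w B - 6) = (\<Sum>B \<in> ?D. 6)" by (intro sum.cong) auto
  then have total: "(\<Sum>x \<in> C. card (missed x)) + 6 * card ?D = 12" using total by simp
  have "?D = {Q}"
  proof (rule ccontr)
    assume "?D \<noteq> {Q}"
    then obtain Q' where Q': "Q' \<in> ?D" "Q' \<noteq> Q" using Q by blast
    have "{Q, Q'} \<subseteq> ?D" using Q Q' by simp
    then have "card {Q, Q'} \<le> card ?D" by (rule card_mono[OF fD])
    moreover have "card {Q, Q'} = 2" using Q' by simp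
    ultimately have D: "card ?D = 2" using total by linarith
    then have eq: "?D = {Q, Q'}"
      using card_seteq[OF fD \<open>{Q, Q'} \<subseteq> ?D\<close>] \<open>card {Q, Q'} = 2\<close> by simp
    have "(\<Sum>x \<in> C. card (missed x)) = 0" using total D by simp
    then have zero: "card (missed x) = 0" if "x \<in> C" for x using that finite_C by simp
    have "card (Q \<union> Q') \<le> card Q + card Q'" by (rule card_Un_le)
    also have "\<dots> < card C" using four[of Q] four[of Q'] Q Q' assms(1) by simp
    finally have "\<not> C \<subseteq> Q \<union> Q'"
      using card_mono[of "Q \<union> Q'" C] finite_block Q Q' by fastforce
    then obtain x where x: "x \<in> C" "x \<notin> Q" "x \<notin> Q'" by blast
    have "card B = 3" if "B \<in> \<B>" "x \<in> B" for B using that x eq by blast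
    then have "even (card (missed x)) \<longleftrightarrow> even (card C - 1)" by (intro even_missed[OF x(1)])
    then show False using zero[OF x(1)] assms(1) by simp
  qed
  then have triples: "card B = 3" if "B \<in> \<B>" "B \<noteq> Q" for B using that by blast
  have six: "(\<Sum>x \<in> C. card (missed x)) = 6" using total \<open>?D = {Q}\<close> by simp
  have cQ: "card Q = 4" using four Q by simp
  have QC: "Q \<subseteq> C" using block_sub Q by simp
  define S where "S = C - Q"
  have S: "S \<subseteq> C" "card S = 6"
    using assms(1) QC cQ finite_C finite_subset[OF QC] by (auto simp: S_def card_Diff_subset)
  have finS: "finite S" using S finite_C finite_subset by blast
  have odd: "odd (card (missed x))" if "x \<in> S" for x
  proof -
    have "card B = 3" if "B \<in> \<B>" "x \<in> B" for B using triples that \<open>x \<in> S\<close> by (auto simp: S_def)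
    then have "even (card (missed x)) \<longleftrightarrow> even (card C - 1)"
      using \<open>x \<in> S\<close> S(1) by (intro even_missed) auto
    then show ?thesis using assms(1) by simp
  qed
  have split: "(\<Sum>x \<in> S. card (missed x)) + (\<Sum>x \<in> Q. card (missed x)) = 6"
    using sum.subset_diff[OF QC finite_C, of "\<lambda>x. card (missed x)"] six by (simp add: S_def)
  have "(\<Sum>x \<in> S. card (missed x)) = (\<Sum>x \<in> S. 1 + (card (missed x) - 1))"
    using odd by (intro sum.cong) (auto simp: odd_pos)
  also have "\<dots> = 6 + (\<Sum>x \<in> S. card (missed x) - 1)" by (simp only: sum.distrib) (simp add: S)
  finally have zero: "(\<Sum>x \<in> S. card (missed x) - 1) = 0" "(\<Sum>x \<in> Q. card (missed x)) = 0"
    using split by linarith+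
  have one: "card (missed x) = 1" if "x \<in> S" for x
  proof -
    have "card (missed x) - 1 = 0" using zero(1) finS that by simp
    then show ?thesis using odd_pos[OF odd[OF that]] by linarith
  qed
  have mQ: "missed x = {}" if "x \<in> Q" for x
    using zero(2) that finite_subset[OF QC finite_C] finite_missed by simp
  have "card Q = Suc (Suc (Suc (Suc 0)))" using cQ by simp
  then obtain x0 x1 x2 x3 where xs: "Q = {x0, x1, x2, x3}" "distinct [x0, x1, x2, x3]"
    by (auto simp: card_Suc_eq)
  have x0: "x0 \<in> Q" "x0 \<in> C" using xs QC by auto
  have mS: "missed y \<subseteq> S \<and> card (missed y) = 1" if "y \<in> S" for y
    using that one missed_sub[of y] missed_sym[of y] mQ S(1) by (fastforce simp: S_def)
  obtain y0 y1 y2 y3 y4 y5 where ys: "distinct [y0, y1, y2, y3, y4, y5]" "S = set [y0, y1, y2, y3, y4, y5]"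
    and m: "missed y0 = {y1}" "missed y1 = {y0}" "missed y2 = {y3}" "missed y3 = {y2}" "missed y4 = {y5}" "missed y5 = {y4}"
    and bl: "{x0, y1, y2} \<in> \<B>" "{x0, y3, y4} \<in> \<B>" "{x0, y5, y0} \<in> \<B>"
  proof (rule mate_hexagon_labels[OF x0(2) S])
    fix y assume y: "y \<in> S"
    then have yC: "y \<in> C" "x0 \<noteq> y" "y \<notin> missed x0" using x0 mQ by (auto simp: S_def)
    have "card B = 3" if "B \<in> \<B>" "x0 \<in> B" "y \<in> B" for B
      using triples that y by (auto simp: S_def)
    note third = third_block[OF x0(2) yC this]
    have "third x0 y \<notin> Q"
    proof
      assume "third x0 y \<in> Q"
      then have "{x0, y, third x0 y} = Q" using block_eqI[OF third(1) Q(1), of x0 "third x0 y"] x0 third(2) by simp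
      then show False using y by (auto simp: S_def)
    qed
    then show "y \<noteq> x0 \<and> y \<notin> missed x0 \<and> third x0 y \<in> S" using yC third(4) by (simp add: S_def)
  next
    fix B y assume "B \<in> \<B>" "x0 \<in> B" "y \<in> B" "y \<in> S"
    then show "card B = 3" using triples by (auto simp: S_def)
  qed (rule mS)
  let ?xs = "[x0, x1, x2, x3, y0, y1, y2, y3, y4, y5]"
  have sets: "x0 \<notin> S" "x1 \<notin> S" "x2 \<notin> S" "x3 \<notin> S" using xs by (auto simp: S_def)
  then have dist: "distinct ?xs" using ys xs by auto
  have "C = Q \<union> S" using QC by (auto simp: S_def)
  then have setC: "set ?xs = C" using ys xs by auto
  have mQ': "missed x0 = {}" "missed x1 = {}" "missed x2 = {}" "missed x3 = {}" using mQ xs by auto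
  have "\<exists>(T, p) \<in> set (map (Pair ten_quadruple) hexagon_symmetries). has_model 10 T C \<B>"
  proof (rule model_by_completion[OF dist setC _ _ _ _ _ check_ten_quadruple[unfolded Let_def]])
    fix B assume "B \<in> set [[0, 1, 2, 3], [0, 5, 6], [0, 7, 8], [0, 9, 4 :: nat]]"
    then show "set B \<subseteq> {..<10} \<and> (!) ?xs ` set B \<in> \<B>" using bl xs Q by (auto simp: numeral_eq_Suc)
  next
    fix B assume "B \<in> \<B>"
    then show "card B = 3 \<or> (\<exists>A \<in> set [[0, 1, 2, 3], [0, 5, 6], [0, 7, 8], [0, 9, 4]]. B = (!) ?xs ` set A)"
      using triples[of B] xs(1) by (auto simp: numeral_eq_Suc)
  next
    show "map missed ?xs = map (\<lambda>i. (!) ?xs ` set (partners [(4, 5), (6, 7), (8, 9)] i)) [0..<10]"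
      by (simp add: upt_rec partners_def m mQ')
  qed simp_all
  then show ?thesis by auto
qed

theorem ten_lines_classification:
  assumes "card C = 10" "card \<B> = 13"
  shows "has_model 10 ten_menelaus C \<B> \<or> has_model 10 ten_triple C \<B> \<or> has_model 10 ten_quadruple C \<B>"
  using ten_lines_all_triples[OF assms] ten_lines_quadruple[OF assms] by blast

text \<open>
  A graph with four edges and only even degrees is a 4-cycle: the vertices of positive degree number
  at most four, so the degrees are 2 and there are exactly four of these vertices.
\<close>

lemma missed_four_cycle:
  assumes even: "\<And>x. x \<in> C \<Longrightarrow> even (card (missed x))"
    and eight: "(\<Sum>x \<in> C. card (missed x)) = 8"
  obtains a b c d where "distinct [a, b, c, d]" "set [a, b, c, d] \<subseteq> C"
    "missed a = {b, d}" "missed b = {a, c}" "missed c = {b, d}" "missed d = {a, c}"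
    "\<forall>x \<in> C. x \<notin> {a, b, c, d} \<longrightarrow> missed x = {}"
proof -
  define P where "P = {x \<in> C. missed x \<noteq> {}}"
  have fP: "finite P" using finite_C by (simp add: P_def)
  have two: "2 \<le> card (missed x)" if "x \<in> P" for x
  proof -
    have "card (missed x) \<noteq> 0" "even (card (missed x))"
      using that even finite_missed by (auto simp: P_def)
    then show ?thesis by presburger
  qed
  have sumP: "(\<Sum>x \<in> P. card (missed x)) = 8"
    using eight finite_C by (subst sum.mono_neutral_left[of C]) (auto simp: P_def)
  have "card P * 2 \<le> (\<Sum>x \<in> P. card (missed x))"
    using sum_bounded_below[of P 2 "\<lambda>x. card (missed x)"] two by simp
  then have P4: "card P \<le> 4" using sumP by simp
  have sub: "missed x \<subseteq> P - {x}" if "x \<in> P" for x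
  proof
    fix y assume y: "y \<in> missed x"
    then have "x \<in> missed y" using missed_sym that by (auto simp: P_def)
    then show "y \<in> P - {x}" using y by (auto simp: P_def missed_def)
  qed
  have eq2: "card (missed x) = 2" if "x \<in> P" for x
  proof -
    have "card (missed x) \<le> card (P - {x})" by (rule card_mono) (use fP sub that in auto)
    also have "\<dots> \<le> 3" using P4 that fP by simp
    finally have "card (missed x) \<le> 3" .
    moreover have "even (card (missed x))" using even that by (simp add: P_def)
    ultimately show ?thesis using two[OF that] by presburger
  qed
  then have "card P * 2 = 8" using sumP by simp
  then have cP: "card P = 4" by simp
  obtain a where a: "a \<in> P" using card_numeral_nonempty[OF cP] by blast
  obtain b d where bd: "missed a = {b, d}" "b \<noteq> d" using eq2[OF a] by (auto simp: card_2_iff)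
  have bdP: "b \<in> P" "d \<in> P" "b \<noteq> a" "d \<noteq> a" using sub[OF a] bd by auto
  have "card (P - {a, b, d}) = 1" using a bdP bd cP fP by (simp add: card_Diff_subset)
  then obtain c where c: "P - {a, b, d} = {c}" by (auto simp: card_1_singleton_iff)
  then have c': "c \<in> P" "c \<noteq> a" "c \<noteq> b" "c \<noteq> d" and P: "P = {a, b, c, d}" using a bdP by auto
  have PC: "P \<subseteq> C" by (auto simp: P_def)
  have "a \<notin> missed c" using missed_sym[of c a] c' bd PC by auto
  then have "missed c \<subseteq> {b, d}" using sub[OF c'(1)] P by auto
  then have mc: "missed c = {b, d}" using eq2[OF c'(1)] bd(2) by (intro card_subset_eq) auto
  have "{a, c} \<subseteq> missed b" "{a, c} \<subseteq> missed d"
    using missed_sym[of a] missed_sym[of c] a c' bd(1) mc PC by auto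
  then have "missed b = {a, c}" "missed d = {a, c}"
    using eq2 bdP c'(2) finite_missed by (metis card_2_iff card_subset_eq)+
  moreover have "\<forall>x \<in> C. x \<notin> {a, b, c, d} \<longrightarrow> missed x = {}"
    using P unfolding P_def by blast
  moreover have "distinct [a, b, c, d]" "set [a, b, c, d] \<subseteq> C" using bd(2) bdP c' P PC by auto
  ultimately show ?thesis using that[of a b c d] bd(1) mc by simp
qed

text \<open>
  The missed pairs form a 4-cycle \<open>a, b, c, d\<close>, whose diagonals \<open>ac\<close> and \<open>bd\<close> lie in blocks with third
  elements \<open>x\<close> and \<open>y\<close>. If \<open>x = y\<close>, the blocks through \<open>a\<close> and through \<open>x\<close> pair the other six elements.
  If \<open>x \<noteq> y\<close>, the third element \<open>z\<close> of the block through \<open>x\<close> and \<open>y\<close> has four more blocks, one through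
  each vertex of the cycle, and their third elements are the four missing labels.
\<close>

theorem eleven_lines_classification:
  assumes "card C = 11" "card {B \<in> \<B>. card B = 3} = 17"
  shows "has_model 11 eleven_hexagon C \<B> \<or> has_model 11 eleven_quadrangle C \<B>"
proof -
  have triples: "\<And>B. B \<in> \<B> \<Longrightarrow> card B = 3" using all_triples assms by simp
  have ev: "even (card (missed x))" if "x \<in> C" for x
    using even_missed[OF that] triples assms by simp
  have eight: "(\<Sum>x \<in> C. card (missed x)) = 8" using card_triples assms by simp
  obtain a b c d where dist4: "distinct [a, b, c, d]" and sub4: "set [a, b, c, d] \<subseteq> C"
    and m: "missed a = {b, d}" "missed b = {a, c}" "missed c = {b, d}" "missed d = {a, c}"
    and others: "\<forall>x \<in> C. x \<notin> {a, b, c, d} \<longrightarrow> missed x = {}"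
    using missed_four_cycle[OF ev eight] by blast
  have m0: "missed x = {}" if "x \<in> C" "x \<notin> {a, b, c, d}" for x using others that by blast
  have C4: "a \<in> C" "b \<in> C" "c \<in> C" "d \<in> C" using sub4 by auto
  note third = third_block[OF _ _ _ _ triples]
  define x where "x = third a c"
  define y where "y = third b d"
  have x: "{a, c, x} \<in> \<B>" "x \<noteq> a" "x \<noteq> c" "x \<in> C" "x \<notin> missed a" "third a x = c"
    unfolding x_def using third(1-6)[of a c] C4 dist4 m by auto
  have y: "{b, d, y} \<in> \<B>" "y \<noteq> b" "y \<noteq> d" "y \<in> C" "y \<notin> missed b" "third b y = d"
    unfolding y_def using third(1-6)[of b d] C4 dist4 m by auto
  have xbd: "x \<noteq> b" "x \<noteq> d" using x(5) m by auto
  have yac: "y \<noteq> a" "y \<noteq> c" using y(5) m by auto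
  have mx: "missed x = {}" using m0 x xbd by simp
  have my: "missed y = {}" using m0 y yac by simp
  have unique: "u = w" if "{p, q, u} \<in> \<B>" "{p, q, w} \<in> \<B>" "p \<noteq> q" "p \<noteq> u" "q \<noteq> u" "p \<noteq> w" "q \<noteq> w" for p q u w
    using third_eqI[OF that(1)] third_eqI[OF that(2)] that by simp
  show ?thesis
  proof (cases "x = y")
    case True
    have xac: "third x a = c" "third x c = a" "third x b = d" "third x d = b"
      using third_eqI[of x a c] third_eqI[of x c a] third_eqI[of x b d] third_eqI[of x d b]
        x y dist4 True by (auto simp: insert_commute)
    define S where "S = C - {a, b, c, d, x}"
    have S: "S \<subseteq> C" "card S = 6"
      using assms C4 x xbd dist4 finite_C by (auto simp: S_def card_Diff_subset)
    have thx: "{x, z, third x z} \<in> \<B>" "third x z \<noteq> x" "third x z \<noteq> z" "third x z \<in> S" "third x (third x z) = z"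
      if "z \<in> S" for z
    proof -
      have z: "z \<in> C" "x \<noteq> z" "z \<notin> missed x" "z \<notin> {a, b, c, d}" using that mx by (auto simp: S_def)
      show t: "{x, z, third x z} \<in> \<B>" "third x z \<noteq> x" "third x z \<noteq> z" "third x (third x z) = z"
        using third(1-3,6)[OF x(4) z(1-3)] by auto
      have "third x z \<notin> {a, b, c, d}" using t(4) xac z(4) by auto
      then show "third x z \<in> S" using third(4)[OF x(4) z(1-3)] t by (simp add: S_def)
    qed
    have tha: "{a, z, third a z} \<in> \<B>" "z \<noteq> a" "z \<notin> missed a" "third a z \<in> S" if "z \<in> S" for z
    proof -
      have z: "z \<in> C" "a \<noteq> z" "z \<notin> missed a" "z \<noteq> c" "z \<noteq> x" using that m by (auto simp: S_def)
      show "{a, z, third a z} \<in> \<B>" "z \<noteq> a" "z \<notin> missed a"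
        using third(1)[OF C4(1) z(1-3)] z by auto
      have "third a z \<noteq> c" "third a z \<noteq> x"
        using third(6)[OF C4(1) z(1-3)] z x_def x(6) by metis+
      then show "third a z \<in> S" using third(2,4,5)[OF C4(1) z(1-3)] m by (simp add: S_def)
    qed
    obtain y0 y1 y2 y3 y4 y5 where ys:
        "distinct [y0, y1, y2, y3, y4, y5]" "S = set [y0, y1, y2, y3, y4, y5]"
        "third x y0 = y1" "third x y2 = y3" "third x y4 = y5"
        "{a, y1, y2} \<in> \<B>" "{a, y3, y4} \<in> \<B>" "{a, y5, y0} \<in> \<B>"
    proof (rule hexagon_labels[OF C4(1) S])
      fix z assume z: "z \<in> S"
      then show "z \<noteq> a \<and> z \<notin> missed a \<and> third a z \<in> S" using tha by blast
      have "{a, z, third x z} \<notin> \<B>"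
      proof
        assume "{a, z, third x z} \<in> \<B>"
        then have "a = x"
          using unique[of z "third x z" a x] thx[OF z] z by (auto simp: insert_commute S_def)
        then show False using x by simp
      qed
      then show "third x z \<in> S \<and> third x z \<noteq> z \<and> third x (third x z) = z \<and> {a, z, third x z} \<notin> \<B>"
        using thx[OF z] by simp
    qed (use triples in auto)
    have xb: "{x, y0, y1} \<in> \<B>" "{x, y2, y3} \<in> \<B>" "{x, y4, y5} \<in> \<B>"
      using thx(1)[of y0] thx(1)[of y2] thx(1)[of y4] ys by auto
    have my: "missed y0 = {}" "missed y1 = {}" "missed y2 = {}" "missed y3 = {}" "missed y4 = {}" "missed y5 = {}"
      using m0 ys(2) by (auto simp: S_def)
    let ?xs = "[a, b, c, d, y0, y1, y2, y3, y4, y5, x]"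
    have sets: "a \<notin> S" "b \<notin> S" "c \<notin> S" "d \<notin> S" "x \<notin> S" by (auto simp: S_def)
    then have dist: "distinct ?xs" using ys dist4 x xbd by auto
    have "C = {a, b, c, d, x} \<union> S" using C4 x by (auto simp: S_def)
    then have setC: "set ?xs = C" using ys by auto
    have "\<exists>(T, p) \<in> set (map (\<lambda>p. (eleven_hexagon, p @ [10])) hexagon_symmetries). has_model 11 T C \<B>"
    proof (rule model_by_completion[OF dist setC _ _ _ _ _ check_eleven_hexagon[unfolded Let_def]])
      fix B assume "B \<in> set [[0, 2, 10], [1, 3, 10], [10, 4, 5], [10, 6, 7], [10, 8, 9], [0, 5, 6], [0, 7, 8], [0, 9, 4 :: nat]]"
      then show "set B \<subseteq> {..<11} \<and> (!) ?xs ` set B \<in> \<B>"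
        using ys xb x(1) y(1) True by (auto simp: numeral_eq_Suc)
    next
      show "map missed ?xs = map (\<lambda>i. (!) ?xs ` set (partners [(0, 1), (1, 2), (2, 3), (0, 3)] i)) [0..<11]"
        by (simp add: upt_rec partners_def m my mx insert_commute)
    qed (use triples in auto)
    then show ?thesis by auto
  next
    case False
    define z where "z = third x y"
    have z: "{x, y, z} \<in> \<B>" "z \<noteq> x" "z \<noteq> y" "z \<in> C"
      unfolding z_def using third(1-4)[OF x(4) y(4) False] mx by auto
    have zn: "z \<noteq> a" "z \<noteq> b" "z \<noteq> c" "z \<noteq> d"
    proof -
      show "z \<noteq> a"
      proof
        assume "z = a"
        then have "{a, x, y} \<in> \<B>" "{a, x, c} \<in> \<B>" using z(1) x(1) by (simp_all add: insert_commute)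
        then have "y = c" by (rule unique) (use x y xbd yac dist4 False in auto)
        then show False using yac by simp
      qed
      show "z \<noteq> c"
      proof
        assume "z = c"
        then have "{c, x, y} \<in> \<B>" "{c, x, a} \<in> \<B>" using z(1) x(1) by (simp_all add: insert_commute)
        then have "y = a" by (rule unique) (use x y xbd yac dist4 False in auto)
        then show False using yac by simp
      qed
      show "z \<noteq> b"
      proof
        assume "z = b"
        then have "{b, y, x} \<in> \<B>" "{b, y, d} \<in> \<B>" using z(1) y(1) by (simp_all add: insert_commute)
        then have "x = d" by (rule unique) (use x y xbd yac dist4 False in auto)
        then show False using xbd by simp
      qed
      show "z \<noteq> d"
      proof
        assume "z = d"
        then have "{d, y, x} \<in> \<B>" "{d, y, b} \<in> \<B>" using z(1) y(1) by (simp_all add: insert_commute)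
        then have "x = b" by (rule unique) (use x y xbd yac dist4 False in auto)
        then show False using xbd by simp
      qed
    qed
    have mz: "missed z = {}" using m0 z zn by simp
    define t where "t = third z"
    have t: "{z, p, t p} \<in> \<B>" "t p \<noteq> z" "t p \<noteq> p" "t p \<in> C" "t (t p) = p" if "p \<in> {a, b, c, d}" for p
    proof -
      have "p \<in> C" "z \<noteq> p" "p \<notin> missed z" using that C4 zn mz by auto
      then show "{z, p, t p} \<in> \<B>" "t p \<noteq> z" "t p \<noteq> p" "t p \<in> C" "t (t p) = p"
        unfolding t_def using third(1-4,6)[OF z(4)] by auto
    qed
    have txy: "t x = y" "t y = x"
      unfolding t_def using third_eqI[of z x y] third_eqI[of z y x] z False by (auto simp: insert_commute)
    have tx: "t p \<noteq> x" "t p \<noteq> y" if "p \<in> {a, b, c, d}" for p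
      using t(5)[OF that] txy that x y xbd yac by auto
    have covered: "q \<notin> missed p" if "{z, p, q} \<in> \<B>" for p q using that by (auto simp: missed_def)
    have tn: "t a \<noteq> b" "t a \<noteq> d" "t b \<noteq> a" "t b \<noteq> c" "t c \<noteq> b" "t c \<noteq> d" "t d \<noteq> a" "t d \<noteq> c"
      using covered[OF t(1)[of a]] covered[OF t(1)[of b]] covered[OF t(1)[of c]] covered[OF t(1)[of d]] m by auto
    have tac: "t a \<noteq> c" "t c \<noteq> a"
      using unique[of a c z x] t(1)[of a] t(1)[of c] x z zn dist4 by (auto simp: insert_commute)
    have tbd: "t b \<noteq> d" "t d \<noteq> b"
      using unique[of b d z y] t(1)[of b] t(1)[of d] y z zn dist4 by (auto simp: insert_commute)
    have tt: "t p \<noteq> t q" if "p \<in> {a, b, c, d}" "q \<in> {a, b, c, d}" "p \<noteq> q" for p q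
      using t(5)[OF that(1)] t(5)[OF that(2)] that(3) by auto
    let ?xs = "[a, b, c, d, x, y, z, t a, t b, t c, t d]"
    have tdist: "distinct [t a, t b, t c, t d]" using tt dist4 by simp
    have dist: "distinct ?xs"
      using dist4 tdist x(2,3) xbd y(2,3) yac False z(2,3) zn t(2,3)[of a] t(2,3)[of b] t(2,3)[of c] t(2,3)[of d]
        tx[of a] tx[of b] tx[of c] tx[of d] tn tac tbd by auto
    have "set ?xs \<subseteq> C" using C4 x(4) y(4) z(4) t(4) by auto
    then have setC: "set ?xs = C"
      using distinct_card[OF dist] assms(1) finite_C by (intro card_subset_eq) auto
    have mt: "missed (t p) = {}" if "p \<in> {a, b, c, d}" for p
    proof (rule m0[OF t(4)[OF that]])
      show "t p \<notin> {a, b, c, d}" using dist that by auto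
    qed
    have "\<exists>(T, p :: nat list) \<in> set [(eleven_quadrangle, [0, 1, 2, 3, 4, 5, 6, 7, 8, 9, 10]),
       (eleven_quadrangle, [0, 3, 2, 1, 4, 5, 6, 7, 10, 9, 8])]. has_model 11 T C \<B>"
    proof (rule model_by_completion[OF dist setC _ _ _ _ _ check_eleven_quadrangle[unfolded Let_def]])
      fix B assume "B \<in> set [[0, 2, 4], [1, 3, 5], [4, 5, 6], [0, 6, 7], [1, 6, 8], [2, 6, 9], [3, 6, 10 :: nat]]"
      then show "set B \<subseteq> {..<11} \<and> (!) ?xs ` set B \<in> \<B>"
        using x(1) y(1) z(1) t(1)[of a] t(1)[of b] t(1)[of c] t(1)[of d]
        by (auto simp: numeral_eq_Suc insert_commute)
    next
      show "map missed ?xs = map (\<lambda>i. (!) ?xs ` set (partners [(0, 1), (1, 2), (2, 3), (0, 3)] i)) [0..<11]"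
        by (simp add: upt_rec partners_def m my mx mz mt insert_commute)
    qed (use triples in auto)
    then show ?thesis by auto
  qed
qed

end

section \<open>Normal forms of coordinates\<close>

fun coord :: "nat \<Rightarrow> 'r vec \<Rightarrow> 'r" where
  "coord i (x, y, z) = (if i = 0 then x else if i = 1 then y else z)"

lemma det3_matrix_product:
  fixes p q r u v t :: "'r::comm_ring_1 vec"
  shows "det3 (dot p u, dot q u, dot r u) (dot p v, dot q v, dot r v) (dot p t, dot q t, dot r t) =
    det3 p q r * det3 u v t"
  by (cases p; cases q; cases r; cases u; cases v; cases t) (simp add: det3_simp algebra_simps)

lemma det3_crosses:
  fixes a b c :: "'r::comm_ring_1 vec"
  shows "det3 (cross b c) (cross c a) (cross a b) = det3 a b c * det3 a b c"
  by (cases a; cases b; cases c) (simp add: det3_simp algebra_simps)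

lemma det3_diagonal:
  "det3 (e1 * x1, e2 * y1, e3 * z1) (e1 * x2, e2 * y2, e3 * z2) (e1 * x3, e2 * y3, e3 * z3) =
    e1 * e2 * e3 * det3 (x1, y1, z1) (x2, y2, z2) (x3, y3, z3)"
  for e1 :: "'r::comm_ring_1"
  by (simp add: det3_simp algebra_simps)

lemma det3_smul: "det3 (smul d u) (smul e v) (smul f w) = d * e * f * det3 u v w"
  by (cases u; cases v; cases w) (simp add: det3_simp algebra_simps)

context field_presentation
begin

text \<open>
  A choice of one ring element for each field element, with \<open>0\<close> and \<open>1\<close> for zero and one. Coordinates
  made of such elements satisfy \<open>x = y\<close>, and not only \<open>Z (x - y)\<close>, when they agree in the field.
\<close>

definition representative :: "'r \<Rightarrow> 'r" where
  "representative x = (if val x = val 0 then 0 else if val x = val 1 then 1 else SOME y. val y = val x)"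

lemma val_representative: "val (representative x) = val x"
proof -
  have "val (SOME y. val y = val x) = val x" by (rule someI[of _ x]) simp
  then show ?thesis by (auto simp: representative_def)
qed

lemma representative_cong: "val x = val y \<Longrightarrow> representative x = representative y"
  by (simp add: representative_def)

definition reduced :: "'r \<Rightarrow> bool" where "reduced x \<longleftrightarrow> representative x = x"

lemma reduced_representative: "reduced (representative x)"
  unfolding reduced_def by (rule representative_cong) (rule val_representative)

lemma reduced_0: "reduced 0" and reduced_1: "reduced 1"
  using Z_1 by (simp_all add: reduced_def representative_def Z_def)

lemma reduced_eqI: "reduced x \<Longrightarrow> reduced y \<Longrightarrow> Z (x - y) \<Longrightarrow> x = y"
  using representative_cong[of x y] by (simp add: reduced_def val_eq_iff)

lemma reduced_Z: "reduced x \<Longrightarrow> Z x \<Longrightarrow> x = 0"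
  using reduced_eqI[OF _ reduced_0, of x] by simp

fun reducedv :: "'r vec \<Rightarrow> bool" where
  "reducedv (x, y, z) \<longleftrightarrow> reduced x \<and> reduced y \<and> reduced z"

fun representativev :: "'r vec \<Rightarrow> 'r vec" where
  "representativev (x, y, z) = (representative x, representative y, representative z)"

definition inverse_mod :: "'r \<Rightarrow> 'r" where
  "inverse_mod x = (if Z x then 1 else SOME y. Z (x * y - 1))"

lemma inverse_mod: "\<not> Z x \<Longrightarrow> Z (x * inverse_mod x - 1)" "\<not> Z (inverse_mod x)"
proof -
  show inv: "Z (x * inverse_mod x - 1)" if nz: "\<not> Z x" for x
  proof -
    obtain y where "Z (x * y - 1)" using Z_inverse[OF nz] .
    then show ?thesis using nz unfolding inverse_mod_def by (auto intro: someI2)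
  qed
  show "\<not> Z (inverse_mod x)"
  proof
    assume zero: "Z (inverse_mod x)"
    show False
    proof (cases "Z x")
      case True
      then show False using zero by (simp add: inverse_mod_def)
    next
      case False
      then have "Z (x * inverse_mod x - 1)" by (rule inv)
      moreover have "Z (x * inverse_mod x)" using zero by simp
      ultimately have "Z (x * inverse_mod x - (x * inverse_mod x - 1))" by (rule Z_diff[rotated])
      then show False by simp
    qed
  qed
qed

lemma representative_inverse: "\<not> Z x \<Longrightarrow> representative (inverse_mod x * x) = 1"
  using inverse_mod(1)[of x] representative_cong[of "inverse_mod x * x" 1]
  by (simp add: val_eq_iff mult.commute reduced_1[unfolded reduced_def])

lemma representative_Z: "Z x \<Longrightarrow> representative x = 0"
  by (simp add: representative_def Z_def)

lemma valv_representativev: "valv (representativev u) = valv u"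
  by (cases u) (simp add: val_representative)

lemma det3_cong: "valv u = valv u' \<Longrightarrow> valv v = valv v' \<Longrightarrow> valv w = valv w' \<Longrightarrow>
    val (det3 u v w) = val (det3 u' v' w')"
  by (cases u; cases v; cases w; cases u'; cases v'; cases w')
    (simp add: det3_simp val_add val_mult val_minus diff_conv_add_uminus del: add_uminus_conv_diff)

text \<open>
  The vectors \<open>w\<close> are projectively equivalent to \<open>v\<close>, the frame \<open>a, b, c, d\<close> is the standard one, and the
  coordinate number \<open>lead i\<close> of every other vector is made 1 where possible.
\<close>

definition normal_coordinates ::
  "nat \<Rightarrow> nat \<Rightarrow> nat \<Rightarrow> nat \<Rightarrow> (nat \<Rightarrow> nat) \<Rightarrow> (nat \<Rightarrow> 'r vec) \<Rightarrow> (nat \<Rightarrow> 'r vec) \<Rightarrow> bool" where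
  "normal_coordinates a b c d lead v w \<longleftrightarrow>
    (\<forall>i j k. Z (det3 (w i) (w j) (w k)) \<longleftrightarrow> Z (det3 (v i) (v j) (v k))) \<and>
    w a = (1, 0, 0) \<and> w b = (0, 1, 0) \<and> w c = (0, 0, 1) \<and> w d = (1, 1, 1) \<and>
    (\<forall>i. reducedv (w i)) \<and>
    (\<forall>i. i \<notin> {a, b, c, d} \<longrightarrow> coord (lead i) (w i) \<noteq> 0 \<longrightarrow> coord (lead i) (w i) = 1)"

text \<open>
  By Cramer's rule the coordinates of \<open>u\<close> with respect to \<open>v a\<close>, \<open>v b\<close>, \<open>v c\<close> are three determinants
  with a common factor, which is left out. The factors \<open>e1\<close>, \<open>e2\<close>, \<open>e3\<close> turn \<open>v d\<close> into the unit point,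
  and the factors \<open>s i\<close> normalize the single vectors. The change of coordinates multiplies all
  determinants by one constant that is not zero.
\<close>

lemma normal_frame:
  fixes v :: "nat \<Rightarrow> 'r vec" and lead :: "nat \<Rightarrow> nat"
  assumes "\<not> Z (det3 (v a) (v b) (v c))" "\<not> Z (det3 (v d) (v b) (v c))"
    "\<not> Z (det3 (v a) (v d) (v c))" "\<not> Z (det3 (v a) (v b) (v d))"
  shows "\<exists>w. normal_coordinates a b c d lead v w"
proof -
  define e1 where "e1 = inverse_mod (det3 (v d) (v b) (v c))"
  define e2 where "e2 = inverse_mod (det3 (v a) (v d) (v c))"
  define e3 where "e3 = inverse_mod (det3 (v a) (v b) (v d))"
  define g where "g u = (e1 * det3 u (v b) (v c), e2 * det3 (v a) u (v c), e3 * det3 (v a) (v b) u)" for u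
  have nz: "\<not> Z e1" "\<not> Z e2" "\<not> Z e3" unfolding e1_def e2_def e3_def by (rule inverse_mod(2))+
  have g_dot: "g u = (e1 * dot (cross (v b) (v c)) u, e2 * dot (cross (v c) (v a)) u, e3 * dot (cross (v a) (v b)) u)" for u
  proof -
    have "det3 u (v b) (v c) = dot (cross (v b) (v c)) u" for u
      by (cases "v b"; cases "v c"; cases u) (simp add: det3_simp algebra_simps)
    moreover have "det3 (v a) u (v c) = dot (cross (v c) (v a)) u" for u
      by (cases "v a"; cases "v c"; cases u) (simp add: det3_simp algebra_simps)
    moreover have "det3 (v a) (v b) u = dot (cross (v a) (v b)) u" for u
      by (cases "v a"; cases "v b"; cases u) (simp add: det3_simp algebra_simps)
    ultimately show ?thesis by (simp add: g_def)
  qed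
  have det_g: "det3 (g x) (g y) (g z) = e1 * e2 * e3 * (det3 (v a) (v b) (v c) * det3 (v a) (v b) (v c)) * det3 x y z" for x y z
    unfolding g_dot det3_diagonal det3_matrix_product det3_crosses by (simp add: mult.assoc)
  define s where "s i = (if i = a then inverse_mod (coord 0 (g (v i))) else if i = b then inverse_mod (coord 1 (g (v i)))
     else if i = c then inverse_mod (coord 2 (g (v i))) else if i = d then 1 else inverse_mod (coord (lead i) (g (v i))))" for i
  have s: "\<not> Z (s i)" for i unfolding s_def by (auto simp: inverse_mod(2))
  define w where "w i = representativev (smul (s i) (g (v i)))" for i
  have "normal_coordinates a b c d lead v w"
    unfolding normal_coordinates_def
  proof (intro conjI allI impI)
    show "Z (det3 (w i) (w j) (w k)) \<longleftrightarrow> Z (det3 (v i) (v j) (v k))" for i j k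
    proof -
      have "val (det3 (w i) (w j) (w k)) = val (det3 (smul (s i) (g (v i))) (smul (s j) (g (v j))) (smul (s k) (g (v k))))"
        unfolding w_def by (rule det3_cong) (rule valv_representativev)+
      then have "Z (det3 (w i) (w j) (w k)) \<longleftrightarrow> Z (s i * s j * s k * (e1 * e2 * e3 *
          (det3 (v a) (v b) (v c) * det3 (v a) (v b) (v c)) * det3 (v i) (v j) (v k)))"
        by (simp only: Z_def det3_smul det_g)
      then show ?thesis using assms(1) nz s by simp
    qed
    show "reducedv (w i)" for i
      by (cases "smul (s i) (g (v i))") (simp add: w_def reduced_representative)
    show "w a = (1, 0, 0)"
      using assms nz by (simp add: w_def s_def g_def representative_inverse representative_Z)
    show "w b = (0, 1, 0)"
      using assms nz by (auto simp: w_def s_def g_def representative_inverse representative_Z)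
    show "w c = (0, 0, 1)"
      using assms nz by (auto simp: w_def s_def g_def representative_inverse representative_Z)
    show "w d = (1, 1, 1)"
      using assms by (auto simp: w_def s_def g_def e1_def e2_def e3_def representative_inverse representative_Z)
    show "coord (lead i) (w i) = 1" if "i \<notin> {a, b, c, d}" "coord (lead i) (w i) \<noteq> 0" for i
    proof -
      obtain x y z where g: "g (v i) = (x, y, z)" by (cases "g (v i)")
      have s: "s i = inverse_mod (coord (lead i) (x, y, z))" using that(1) g by (simp add: s_def)
      have "coord (lead i) (w i) = representative (inverse_mod (coord (lead i) (x, y, z)) * coord (lead i) (x, y, z))"
        by (simp add: w_def s g)
      then show ?thesis using that(2) representative_inverse representative_Z by (metis Z_mult_iff)
    qed
  qed
  then show ?thesis by blast
qed

section \<open>Coordinates of the models\<close>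

definition realizes :: "nat \<Rightarrow> nat list list \<Rightarrow> (nat \<Rightarrow> 'r vec) \<Rightarrow> bool" where
  "realizes n T w \<longleftrightarrow> (\<forall>i<n. \<forall>j<n. \<forall>k<n. i \<noteq> j \<longrightarrow> i \<noteq> k \<longrightarrow> j \<noteq> k \<longrightarrow>
     (Z (det3 (w i) (w j) (w k)) \<longleftrightarrow> list_ex (\<lambda>B. {i, j, k} \<subseteq> set B) T))"

lemma realizesD:
  assumes "realizes n T w" "i < n" "j < n" "k < n" "i \<noteq> j" "i \<noteq> k" "j \<noteq> k"
  shows "Z (det3 (w i) (w j) (w k)) \<longleftrightarrow> list_ex (\<lambda>B. {i, j, k} \<subseteq> set B) T"
  using assms by (simp add: realizes_def)

lemma block_system_blocks: "distinct_lines n v \<Longrightarrow> block_system {..<n} (blocks n v)"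
  by unfold_locales (use block_subset block_card block_unique in blast)+

lemma realization:
  assumes v: "distinct_lines n v" and T: "has_model n T {..<n} (blocks n v)"
    and T_sub: "list_all (\<lambda>B. set B \<subseteq> {..<n}) T"
  obtains w where "realizes n T w" "distinct_lines n w" "config n w = config n v"
proof -
  obtain \<phi> where bij: "bij_betw \<phi> {..<n} {..<n}" and blocks: "blocks n v = (\<lambda>B. \<phi> ` set B) ` set T"
    using T by (auto simp: has_model_def)
  have lt: "\<phi> i < n" if "i < n" for i using bij that by (auto simp: bij_betw_def)
  have inj_on: "inj_on \<phi> {..<n}" using bij by (simp add: bij_betw_def)
  then have inj: "\<phi> i = \<phi> j \<longleftrightarrow> i = j" if "i < n" "j < n" for i j
    using that by (auto simp: inj_on_def)
  have mem: "\<phi> i \<in> \<phi> ` set B \<longleftrightarrow> i \<in> set B" if "i < n" "B \<in> set T" for i B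
    using inj_on_image_mem_iff[OF inj_on, of i "set B"] T_sub that by (auto simp: list_all_iff)
  define w where "w = v \<circ> \<phi>"
  have "realizes n T w"
    unfolding realizes_def
  proof (intro allI impI)
    fix i j k assume ijk: "i < n" "j < n" "k < n" "i \<noteq> j" "i \<noteq> k" "j \<noteq> k"
    have "Z (det3 (w i) (w j) (w k)) \<longleftrightarrow> (\<exists>B \<in> blocks n v. {\<phi> i, \<phi> j, \<phi> k} \<subseteq> B)"
      unfolding w_def comp_apply by (rule det3_iff_block[OF v]) (use lt inj ijk in auto)
    also have "\<dots> \<longleftrightarrow> (\<exists>B \<in> set T. {i, j, k} \<subseteq> set B)"
      using mem ijk by (simp add: blocks)
    finally show "Z (det3 (w i) (w j) (w k)) \<longleftrightarrow> list_ex (\<lambda>B. {i, j, k} \<subseteq> set B) T"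
      by (simp add: list_ex_iff)
  qed
  moreover have "distinct_lines n w"
    using v lt inj by (simp add: distinct_lines_def w_def)
  moreover have "config n w = config n v"
  proof -
    have "config n w = (\<lambda>i. ln (v i)) ` \<phi> ` {..<n}" by (simp add: config_def w_def image_image)
    then show ?thesis using bij by (simp add: bij_betw_def config_def)
  qed
  ultimately show ?thesis using that by blast
qed

lemma normal_coordinates_realizes:
  "normal_coordinates a b c d lead v w \<Longrightarrow> realizes n T v \<Longrightarrow> realizes n T w"
  by (simp add: normal_coordinates_def realizes_def)

lemma reduced_Z_iff: "reduced x \<Longrightarrow> Z x \<longleftrightarrow> x = 0"
  using reduced_Z by auto

lemma reduced_diff_iff: "reduced x \<Longrightarrow> reduced y \<Longrightarrow> Z (x - y) \<longleftrightarrow> x = y"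
  using reduced_eqI by auto

text \<open>
  Consequences of polynomial equations are proved by naming cofactors: the factors \<open>k1, \<dots>, k4\<close> are
  given in the application, and the identity is left to the simplifier.
\<close>

lemma Z_combination:
  assumes "Z e1" "Z e2" "Z e3" "Z e4" "t = k1 * e1 + k2 * e2 + k3 * e3 + k4 * e4"
  shows "Z t"
  unfolding assms(5) using assms(1-4) by (intro Z_add) simp_all

lemma Z_det3_null: "null q \<Longrightarrow> Z (det3 u v q)"
proof -
  assume "null q"
  then have "Z (dot (cross u v) q)" by (cases "cross u v"; cases q) (auto intro!: Z_add)
  also have "dot (cross u v) q = det3 u v q"
    by (cases u; cases v; cases q) (simp add: det3_simp algebra_simps)
  finally show ?thesis .
qed

lemmas normalize = det3_simp reduced_Z_iff reduced_diff_iff reduced_0 reduced_1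

text \<open>
  In the frame \<open>0, 1, 2, 3\<close> the other lines are \<open>(c, 1, 1)\<close>, \<open>(0, 1, d)\<close>, \<open>(1, b, 1)\<close>, \<open>(1, 0, a)\<close>. The
  last four blocks give \<open>b * d = a * c = b * c = 1\<close> and \<open>a + d = 1\<close>, hence \<open>a = b\<close>, \<open>c = d\<close> and
  \<open>a\<^sup>2 - a + 1 = 0\<close>, and under these conditions the line \<open>(1, 1, 0)\<close> passes through the four points in
  which the missed pairs meet.
\<close>

lemma moebius_kantor_ninth_line:
  assumes v: "realizes 8 moebius_kantor v"
  obtains q where "\<not> null q" "Z (det3 (v 0) (v 1) q)" "Z (det3 (v 2) (v 3) q)"
    "Z (det3 (v 4) (v 5) q)" "Z (det3 (v 6) (v 7) q)"
proof -
  note D = realizesD[OF v, unfolded moebius_kantor_def]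
  \<comment> \<open>The line through the intersection of \<open>v 0\<close> and \<open>v 1\<close> in the pencil of \<open>v 2\<close> and \<open>v 3\<close>.\<close>
  define q where "q = (case v 2 of (x, y, z) \<Rightarrow> case v 3 of (x', y', z') \<Rightarrow>
    (det3 (v 0) (v 1) (v 3) * x - det3 (v 0) (v 1) (v 2) * x',
     det3 (v 0) (v 1) (v 3) * y - det3 (v 0) (v 1) (v 2) * y',
     det3 (v 0) (v 1) (v 3) * z - det3 (v 0) (v 1) (v 2) * z'))"
  have det_q: "det3 x y q = det3 (v 0) (v 1) (v 3) * det3 x y (v 2) - det3 (v 0) (v 1) (v 2) * det3 x y (v 3)" for x y
    by (cases x; cases y; cases "v 2"; cases "v 3") (simp add: q_def det3_simp algebra_simps)
  have q01: "Z (det3 (v 0) (v 1) q)" and q23: "Z (det3 (v 2) (v 3) q)"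
    and q02: "\<not> Z (det3 (v 0) (v 2) q)"
    using D[of 0 1 2] D[of 0 1 3] D[of 0 2 3] by (simp_all add: det_q mult.commute)
  have "\<not> null q" using q02 Z_det3_null by blast
  let ?v = "v(8 := q)"
  obtain w where W: "normal_coordinates 0 1 2 3 (\<lambda>i. if i \<in> {6, 7, 8} then 0 else 1) ?v w"
    using normal_frame[of ?v 0 1 2 3 "\<lambda>i. if i \<in> {6, 7, 8} then 0 else 1"] D[of 0 1 2] D[of 3 1 2] D[of 0 3 2] D[of 0 1 3] by auto
  have same: "Z (det3 (w i) (w j) (w k)) \<longleftrightarrow> Z (det3 (?v i) (?v j) (?v k))" for i j k
    using W by (simp add: normal_coordinates_def)
  have frame: "w 0 = (1, 0, 0)" "w 1 = (0, 1, 0)" "w 2 = (0, 0, 1)" "w 3 = (1, 1, 1)"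
    using W by (simp_all add: normal_coordinates_def)
  have red: "reducedv (w i)" for i using W by (simp add: normal_coordinates_def)
  have lead: "i \<notin> {0, 1, 2, 3} \<Longrightarrow> coord (if i \<in> {6, 7, 8} then 0 else 1) (w i) \<noteq> 0 \<Longrightarrow>
      coord (if i \<in> {6, 7, 8} then 0 else 1) (w i) = 1" for i
    using W by (simp add: normal_coordinates_def)
  have DW: "Z (det3 (w i) (w j) (w k)) \<longleftrightarrow> Z (det3 (v i) (v j) (v k))" if "i < 8" "j < 8" "k < 8" for i j k
    using same[of i j k] that by simp
  obtain a where w7: "w 7 = (1, 0, a)"
  proof (cases "w 7")
    case (fields x y z)
    then show ?thesis using that[of z] DW[of 0 2 7] DW[of 1 2 7] D[of 0 2 7] D[of 1 2 7] red[of 7] lead[of 7]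
      by (simp del: One_nat_def add: frame normalize)
  qed
  obtain c where w4: "w 4 = (c, 1, 1)"
  proof (cases "w 4")
    case (fields x y z)
    then show ?thesis using that[of x] DW[of 0 3 4] DW[of 0 2 4] D[of 0 3 4] D[of 0 2 4] red[of 4] lead[of 4]
      by (simp del: One_nat_def add: frame normalize)
  qed
  obtain b where w6: "w 6 = (1, b, 1)"
  proof (cases "w 6")
    case (fields x y z)
    then show ?thesis using that[of y] DW[of 1 3 6] DW[of 1 2 6] D[of 1 3 6] D[of 1 2 6] red[of 6] lead[of 6]
      by (simp del: One_nat_def add: frame normalize)
  qed
  obtain d where w5: "w 5 = (0, 1, d)"
  proof (cases "w 5")
    case (fields x y z)
    then show ?thesis using that[of z] DW[of 1 2 5] DW[of 0 2 5] D[of 1 2 5] D[of 0 2 5] red[of 5] lead[of 5]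
      by (simp del: One_nat_def add: frame normalize)
  qed
  have w8: "w 8 = (1, 1, 0)"
  proof (cases "w 8")
    case (fields x y z)
    then show ?thesis using same[of 0 1 8] same[of 2 3 8] same[of 0 2 8] q01 q23 q02 red[of 8] lead[of 8]
      by (simp del: One_nat_def add: frame normalize)
  qed
  have bd: "Z (1 - b * d)" using D[of 0 5 6] DW[of 0 5 6] by (simp del: One_nat_def add: frame w5 w6 det3_simp Z_diff_commute mult.commute)
  have ac: "Z (1 - a * c)" using D[of 1 4 7] DW[of 1 4 7] by (simp del: One_nat_def add: frame w4 w7 det3_simp Z_diff_commute mult.commute)
  have bc: "Z (1 - b * c)" using D[of 2 4 6] DW[of 2 4 6] by (simp del: One_nat_def add: frame w4 w6 det3_simp Z_diff_commute mult.commute)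
  have ad: "Z (a + d - 1)" using D[of 3 5 7] DW[of 3 5 7] by (simp del: One_nat_def add: frame w5 w7 det3_simp algebra_simps)
  have "Z (det3 (w 4) (w 5) (w 8))"
    by (rule Z_combination[OF bd ac bc ad, of _ "- c" "- 1" d "- c"]) (simp add: w4 w5 w8 det3_simp algebra_simps)
  then have q45: "Z (det3 (v 4) (v 5) q)" using same[of 4 5 8] by simp
  have "Z (det3 (w 6) (w 7) (w 8))"
    by (rule Z_combination[OF bd ac bc ad, of _ 1 "b * d + a * b" "- a * d - a * a" a])
      (simp add: w6 w7 w8 det3_simp algebra_simps)
  then have q67: "Z (det3 (v 6) (v 7) q)" using same[of 6 7 8] by simp
  show ?thesis using that \<open>\<not> null q\<close> q01 q23 q45 q67 by blast
qed

text \<open>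
  The diagonal points of the frame are \<open>(1, 1, 0)\<close>, \<open>(1, 0, 1)\<close>, \<open>(0, 1, 1)\<close>, with determinant \<open>-2\<close>.
\<close>

lemma fano_characteristic:
  assumes v: "realizes 7 fano v"
  shows "Z 2"
proof -
  note D = realizesD[OF v, unfolded fano_def]
  obtain w where W: "normal_coordinates 0 1 3 6 (\<lambda>i. if i = 5 then 1 else 0) v w"
    using normal_frame[of v 0 1 3 6 "\<lambda>i. if i = 5 then 1 else 0"] D[of 0 1 3] D[of 6 1 3] D[of 0 6 3] D[of 0 1 6] by auto
  note D = realizesD[OF normal_coordinates_realizes[OF W v], unfolded fano_def]
  have frame: "w 0 = (1, 0, 0)" "w 1 = (0, 1, 0)" "w 3 = (0, 0, 1)" "w 6 = (1, 1, 1)"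
    using W by (simp_all add: normal_coordinates_def)
  have red: "reducedv (w i)" for i using W by (simp add: normal_coordinates_def)
  have lead: "i \<notin> {0, 1, 3, 6} \<Longrightarrow> coord (if i = 5 then 1 else 0) (w i) \<noteq> 0 \<Longrightarrow>
      coord (if i = 5 then 1 else 0) (w i) = 1" for i
    using W by (simp add: normal_coordinates_def)
  have w2: "w 2 = (1, 1, 0)"
  proof (cases "w 2")
    case (fields x y z)
    then show ?thesis using D[of 0 1 2] D[of 2 3 6] D[of 1 3 2] red[of 2] lead[of 2]
      by (simp del: One_nat_def add: frame normalize)
  qed
  have w4: "w 4 = (1, 0, 1)"
  proof (cases "w 4")
    case (fields x y z)
    then show ?thesis using D[of 0 3 4] D[of 1 4 6] D[of 1 3 4] red[of 4] lead[of 4]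
      by (simp del: One_nat_def add: frame normalize)
  qed
  have w5: "w 5 = (0, 1, 1)"
  proof (cases "w 5")
    case (fields x y z)
    then show ?thesis using D[of 1 3 5] D[of 0 5 6] D[of 0 3 5] red[of 5] lead[of 5]
      by (simp del: One_nat_def add: frame normalize)
  qed
  have "Z (det3 (w 2) (w 4) (w 5))" using D[of 2 4 5] by simp
  then have "Z (- 2)" by (simp add: w2 w4 w5 det3_simp)
  then show ?thesis by (simp only: Z_minus)
qed

text \<open>
  In the frame \<open>1, 2, 3, 5\<close> the blocks outside of \<open>0\<close> leave one parameter \<open>g\<close> with \<open>g\<^sup>2 = -1\<close>. The three
  blocks of \<open>0\<close> are three linear equations for its coordinates, and their compatibility says \<open>g = 3\<close>.
\<close>

lemma menelaus_characteristic:
  assumes v: "realizes 10 ten_menelaus v"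
  shows "Z 10" "\<not> Z 2"
proof -
  note D = realizesD[OF v, unfolded ten_menelaus_def]
  define lead where "lead i = (if i \<in> {0, 8} then 1 else 0 :: nat)" for i :: nat
  obtain w where W: "normal_coordinates 1 2 3 5 lead v w"
    using normal_frame[of v 1 2 3 5 lead] D[of 1 2 3] D[of 5 2 3] D[of 1 5 3] D[of 1 2 5] by auto
  note D = realizesD[OF normal_coordinates_realizes[OF W v], unfolded ten_menelaus_def]
  have frame: "w 1 = (1, 0, 0)" "w 2 = (0, 1, 0)" "w 3 = (0, 0, 1)" "w 5 = (1, 1, 1)"
    using W by (simp_all add: normal_coordinates_def)
  have red: "reducedv (w i)" for i using W by (simp add: normal_coordinates_def)
  have lead: "i \<notin> {1, 2, 3, 5} \<Longrightarrow> coord (lead i) (w i) \<noteq> 0 \<Longrightarrow> coord (lead i) (w i) = 1" for i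
    using W by (simp add: normal_coordinates_def)
  note lead = lead[unfolded lead_def]
  have w8: "w 8 = (0, 1, 1)"
  proof (cases "w 8")
    case (fields x y z)
    then show ?thesis using D[of 2 3 8] D[of 1 5 8] D[of 1 3 8] red[of 8] lead[of 8]
      by (simp del: One_nat_def add: frame normalize)
  qed
  obtain g where w9: "w 9 = (1, 1, g)"
  proof (cases "w 9")
    case (fields x y z)
    then show ?thesis using that[of z] D[of 3 5 9] D[of 2 3 9] red[of 9] lead[of 9]
      by (simp del: One_nat_def add: frame normalize)
  qed
  obtain h where w7: "w 7 = (1, h, 1)"
  proof (cases "w 7")
    case (fields x y z)
    then show ?thesis using that[of y] D[of 2 5 7] D[of 2 3 7] red[of 7] lead[of 7]
      by (simp del: One_nat_def add: frame normalize)
  qed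
  have g: "reduced g" and h: "reduced h" using red[of 9] red[of 7] by (simp_all add: w9 w7)
  have w6: "w 6 = (1, 0, g)"
  proof (cases "w 6")
    case (fields x y z)
    then show ?thesis using D[of 1 3 6] D[of 2 6 9] D[of 2 3 6] red[of 6] lead[of 6] g
      by (simp del: One_nat_def add: frame w9 normalize)
  qed
  have w4: "w 4 = (1, h, 0)"
  proof (cases "w 4")
    case (fields x y z)
    then show ?thesis using D[of 1 2 4] D[of 3 4 7] D[of 2 3 4] red[of 4] lead[of 4] h
      by (simp del: One_nat_def add: frame w7 normalize)
  qed
  obtain x z where w0: "w 0 = (x, 1, z)"
  proof (cases "w 0")
    case (fields x y z)
    then show ?thesis using that[of x z] D[of 0 1 3] red[of 0] lead[of 0]
      by (simp del: One_nat_def add: frame normalize)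
  qed
  have "Z (det3 (w 1) (w 7) (w 9))" using D[of 1 7 9] by simp
  then have hg: "Z (h * g - 1)" by (simp del: One_nat_def add: frame w7 w9 det3_simp)
  have "Z (det3 (w 4) (w 6) (w 8))" using D[of 4 6 8] by simp
  then have gh: "Z (- g - h)" by (simp add: w4 w6 w8 det3_simp algebra_simps)
  \<comment> \<open>The blocks \<open>179\<close> and \<open>468\<close> say \<open>h * g = 1\<close> and \<open>h = - g\<close>.\<close>
  have r: "Z (g * g + 1)"
    by (rule Z_combination[OF hg gh Z_0 Z_0, of _ "- 1" "- g" 0 0]) (simp add: algebra_simps)
  have e1: "Z (det3 (w 5) (w 6) (w 0))" using D[of 5 6 0] by simp
  have e2: "Z (det3 (w 4) (w 9) (w 0))" using D[of 4 9 0] by simp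
  have e3: "Z (det3 (w 7) (w 8) (w 0))" using D[of 7 8 0] by simp
  have e1: "Z (x * g + (1 - g) - z)" using e1 by (simp del: One_nat_def add: frame w6 w0 det3_simp algebra_simps)
  have e2: "Z (x - g + (1 + g) * z)"
    by (rule Z_combination[OF e2 hg gh Z_0, of _ 1 "- x" "- z" 0]) (simp del: One_nat_def add: w4 w9 w0 det3_simp algebra_simps)
  have e3: "Z (- (g + 1) * x - 1 + z)"
    by (rule Z_combination[OF e3 gh Z_0 Z_0, of _ 1 x 0 0]) (simp add: w7 w8 w0 det3_simp algebra_simps)
  have g3: "Z (3 - g)"
    by (rule Z_combination[OF e1 e2 e3 r, of _ "2 + 2 * g + g * g" 1 "(2 + 2 * g + g * g) - (1 + g)" "2 + g"])
      (simp add: algebra_simps)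
  show "Z 10"
    by (rule Z_combination[OF r g3 Z_0 Z_0, of _ 1 "3 + g" 0 0]) (simp add: algebra_simps)
  show "\<not> Z 2"
  proof
    assume "Z 2"
    with g3 have "Z (g - 1)"
      by (rule Z_combination[OF _ _ Z_0 Z_0, of _ _ _ "- 1" 1 0 0]) (simp add: algebra_simps)
    moreover have "\<not> Z (det3 (w 1) (w 5) (w 9))" using D[of 1 5 9] by simp
    ultimately show False by (simp del: One_nat_def add: frame w9 det3_simp)
  qed
qed

text \<open>
  In the frame \<open>7, 8, 9, 10\<close> the blocks \<open>149\<close>, \<open>347\<close>, \<open>135\<close> give \<open>\<epsilon> = \<alpha> + 1\<close> and the blocks \<open>024\<close>, \<open>2 5 10\<close>
  give \<open>\<alpha>\<^sup>2 = 1\<close>. For \<open>\<alpha> = 1\<close> the block \<open>2 5 10\<close> says \<open>1 = 0\<close>; for \<open>\<alpha> = -1\<close> the number \<open>\<epsilon>\<close> vanishes,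
  although it is invertible by the block \<open>149\<close>.
\<close>

lemma eleven_quadrangle_impossible:
  assumes v: "realizes 11 eleven_quadrangle v"
  shows False
proof -
  note D = realizesD[OF v, unfolded eleven_quadrangle_def]
  define lead where "lead i = (if i \<in> {1, 3} then 1 else 0 :: nat)" for i :: nat
  obtain w where W: "normal_coordinates 7 8 9 10 lead v w"
    using normal_frame[of v 7 8 9 10 lead] D[of 7 8 9] D[of 10 8 9] D[of 7 10 9] D[of 7 8 10] by auto
  note D = realizesD[OF normal_coordinates_realizes[OF W v], unfolded eleven_quadrangle_def]
  have frame: "w 7 = (1, 0, 0)" "w 8 = (0, 1, 0)" "w 9 = (0, 0, 1)" "w 10 = (1, 1, 1)"
    using W by (simp_all add: normal_coordinates_def)
  have red: "reducedv (w i)" for i using W by (simp add: normal_coordinates_def)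
  have lead: "i \<notin> {7, 8, 9, 10} \<Longrightarrow> coord (lead i) (w i) \<noteq> 0 \<Longrightarrow> coord (lead i) (w i) = 1" for i
    using W by (simp add: normal_coordinates_def)
  note lead = lead[unfolded lead_def]
  obtain \<alpha> where w0: "w 0 = (1, 1, \<alpha>)"
  proof (cases "w 0")
    case (fields x y z)
    then show ?thesis using that[of z] D[of 0 9 10] D[of 8 9 0] red[of 0] lead[of 0]
      by (simp del: One_nat_def add: frame normalize)
  qed
  obtain \<beta> where w1: "w 1 = (\<beta>, 1, 1)"
  proof (cases "w 1")
    case (fields x y z)
    then show ?thesis using that[of x] D[of 7 1 10] D[of 7 9 1] red[of 1] lead[of 1]
      by (simp del: One_nat_def add: frame normalize)
  qed
  obtain \<gamma> where w2: "w 2 = (1, \<gamma>, 0)"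
  proof (cases "w 2")
    case (fields x y z)
    then show ?thesis using that[of y] D[of 7 8 2] D[of 8 9 2] red[of 2] lead[of 2]
      by (simp del: One_nat_def add: frame normalize)
  qed
  obtain \<delta> where w3: "w 3 = (0, 1, \<delta>)"
  proof (cases "w 3")
    case (fields x y z)
    then show ?thesis using that[of z] D[of 8 9 3] D[of 7 9 3] red[of 3] lead[of 3]
      by (simp del: One_nat_def add: frame normalize)
  qed
  obtain \<epsilon> where w4: "w 4 = (1, \<epsilon>, 1)"
  proof (cases "w 4")
    case (fields x y z)
    then show ?thesis using that[of y] D[of 8 4 10] D[of 8 9 4] red[of 4] lead[of 4]
      by (simp del: One_nat_def add: frame normalize)
  qed
  have "reduced \<alpha>" using red[of 0] by (simp add: w0)
  then have w5: "w 5 = (1, 0, \<alpha>)"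
  proof (cases "w 5")
    case (fields x y z)
    then show ?thesis using \<open>reduced \<alpha>\<close> D[of 7 9 5] D[of 8 0 5] D[of 8 9 5] red[of 5] lead[of 5]
      by (simp del: One_nat_def add: frame w0 normalize)
  qed
  have "Z (det3 (w 2) (w 5) (w 10))" "Z (det3 (w 1) (w 4) (w 9))" "Z (det3 (w 3) (w 4) (w 7))"
    "Z (det3 (w 0) (w 2) (w 4))" "Z (det3 (w 1) (w 3) (w 5))"
    using D[of 2 5 10] D[of 1 4 9] D[of 3 4 7] D[of 0 2 4] D[of 1 3 5] by simp_all
  note eqs = this[unfolded w0 w1 w2 w3 w4 w5 frame det3_simp]
  have r1: "Z (\<alpha> * \<gamma> - \<alpha> - \<gamma>)"
    by (rule Z_combination[OF eqs(1) Z_0 Z_0 Z_0, of _ 1 0 0 0]) (simp add: algebra_simps)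
  have r2: "Z (\<beta> * \<epsilon> - 1)"
    by (rule Z_combination[OF eqs(2) Z_0 Z_0 Z_0, of _ 1 0 0 0]) (simp add: algebra_simps)
  have r3: "Z (\<delta> * \<epsilon> - 1)"
    by (rule Z_combination[OF eqs(3) Z_0 Z_0 Z_0, of _ "- 1" 0 0 0]) (simp add: algebra_simps)
  have r4: "Z (\<gamma> - 1 + \<alpha> * \<epsilon> - \<alpha> * \<gamma>)"
    by (rule Z_combination[OF eqs(4) Z_0 Z_0 Z_0, of _ 1 0 0 0]) (simp add: algebra_simps)
  have r5: "Z (\<alpha> * \<beta> + \<delta> - 1)"
    by (rule Z_combination[OF eqs(5) Z_0 Z_0 Z_0, of _ 1 0 0 0]) (simp add: algebra_simps)
  have eta: "Z (\<epsilon> - \<alpha> - 1)"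
    by (rule Z_combination[OF r5 r2 r3 Z_0, of _ "- \<epsilon>" \<alpha> 1 0]) (simp add: algebra_simps)
  have "Z ((\<alpha> - 1) * (\<alpha> + 1))"
    by (rule Z_combination[OF r4 r1 eta Z_0, of _ 1 1 "- \<alpha>" 0]) (simp add: algebra_simps)
  then consider "Z (\<alpha> - 1)" | "Z (\<alpha> + 1)" by auto
  then show False
  proof cases
    case 1
    have "Z 1"
      by (rule Z_combination[OF 1 r1 Z_0 Z_0, of _ "\<gamma> - 1" "- 1" 0 0]) (simp add: algebra_simps)
    then show False by simp
  next
    case 2
    have "Z 1"
      by (rule Z_combination[OF 2 eta r2 Z_0, of _ \<beta> \<beta> "- 1" 0]) (simp add: algebra_simps)
    then show False by simp
  qed
qed

text \<open>
  Coordinates for the four 1-factors in terms of a single parameter \<open>c\<close> with \<open>c\<^sup>2 = c + 1\<close>. The conditions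
  on the index 10 prepare the addition of the point that carries the fifth factor.
\<close>

definition hexagon_points :: "'r \<Rightarrow> (nat \<Rightarrow> 'r vec) \<Rightarrow> (nat \<Rightarrow> 'r vec) \<Rightarrow> bool" where
  "hexagon_points c v w \<longleftrightarrow>
    (\<forall>i j k. Z (det3 (w i) (w j) (w k)) \<longleftrightarrow> Z (det3 (v i) (v j) (v k))) \<and>
    Z (c * c - c - 1) \<and>
    w 4 = (1, 0, 0) \<and> w 5 = (0, 1, 0) \<and> w 6 = (c - 1, 1, c) \<and> w 7 = (1, c - 1, c) \<and>
    w 8 = (1, 1, 1) \<and> w 9 = (0, 0, 1) \<and>
    w 0 = (2 - c, 0, 1) \<and> w 1 = (0, 1, c + 1) \<and> w 2 = (1, c - 1, 1) \<and> w 3 = (c - 1, 1, 1) \<and>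
    reducedv (w 10) \<and> (coord 0 (w 10) \<noteq> 0 \<longrightarrow> coord 0 (w 10) = 1)"

text \<open>
  In the frame \<open>4, 5, 9, 8\<close> eight of the twelve blocks express everything by \<open>a\<close> and \<open>c\<close>. The
  last blocks \<open>078\<close> and \<open>168\<close> become \<open>a = 2 * c - c\<^sup>2\<close> and \<open>2 * a * c - a\<^sup>2 - c = 0\<close>; elimination of
  \<open>a\<close> leaves \<open>c * (c - 1) * (c\<^sup>2 - c - 1) = 0\<close>, where the first two factors are not zero.
\<close>

lemma hexagon_coordinates:
  fixes v :: "nat \<Rightarrow> 'r vec"
  assumes D: "\<And>i j k. i < 10 \<Longrightarrow> j \<in> {4..<10} \<Longrightarrow> k \<in> {4..<10} \<Longrightarrow> i \<noteq> j \<Longrightarrow> i \<noteq> k \<Longrightarrow> j \<noteq> k \<Longrightarrow>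
      Z (det3 (v i) (v j) (v k)) \<longleftrightarrow> list_ex (\<lambda>B. {i, j, k} \<subseteq> set B) hexagon_factors"
  shows "\<exists>w c. hexagon_points c v w"
proof -
  note D = D[unfolded hexagon_factors_def]
  define lead where "lead i = (if i \<in> {1, 3, 6} then 1 else if i = 0 then 2 else 0 :: nat)" for i :: nat
  obtain w where W: "normal_coordinates 4 5 9 8 lead v w"
    using normal_frame[of v 4 5 9 8 lead] D[of 4 5 9] D[of 8 5 9] D[of 4 8 9] D[of 4 5 8] by auto
  have same: "Z (det3 (w i) (w j) (w k)) \<longleftrightarrow> Z (det3 (v i) (v j) (v k))" for i j k
    using W by (simp add: normal_coordinates_def)
  have frame: "w 4 = (1, 0, 0)" "w 5 = (0, 1, 0)" "w 9 = (0, 0, 1)" "w 8 = (1, 1, 1)"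
    using W by (simp_all add: normal_coordinates_def)
  have red: "reducedv (w i)" for i using W by (simp add: normal_coordinates_def)
  have lead: "i \<notin> {4, 5, 9, 8} \<Longrightarrow> coord (lead i) (w i) \<noteq> 0 \<Longrightarrow> coord (lead i) (w i) = 1" for i
    using W by (simp add: normal_coordinates_def)
  have lead10: "coord 0 (w 10) \<noteq> 0 \<Longrightarrow> coord 0 (w 10) = 1" using lead[of 10] by (simp add: lead_def)
  note lead = lead[unfolded lead_def]
  obtain p where w0: "w 0 = (p, 0, 1)"
  proof (cases "w 0")
    case (fields x y z)
    then show ?thesis using that[of x] same[of 0 4 9] same[of 0 4 5] D[of 0 4 9] D[of 0 4 5] red[of 0] lead[of 0]
      by (simp del: One_nat_def add: frame normalize)
  qed
  obtain s where w1: "w 1 = (0, 1, s)"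
  proof (cases "w 1")
    case (fields x y z)
    then show ?thesis using that[of z] same[of 1 5 9] same[of 1 4 9] D[of 1 5 9] D[of 1 4 9] red[of 1] lead[of 1]
      by (simp del: One_nat_def add: frame normalize)
  qed
  obtain t where w2: "w 2 = (1, t, 1)"
  proof (cases "w 2")
    case (fields x y z)
    then show ?thesis using that[of y] same[of 2 5 8] same[of 2 5 9] D[of 2 5 8] D[of 2 5 9] red[of 2] lead[of 2]
      by (simp del: One_nat_def add: frame normalize)
  qed
  obtain a where w3: "w 3 = (a, 1, 1)"
  proof (cases "w 3")
    case (fields x y z)
    then show ?thesis using that[of x] same[of 3 4 8] same[of 3 4 9] D[of 3 4 8] D[of 3 4 9] red[of 3] lead[of 3]
      by (simp del: One_nat_def add: frame normalize)
  qed
  have ra: "reduced a" and rt: "reduced t" using red[of 3] red[of 2] by (simp_all add: w3 w2)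
  obtain f where w7: "w 7 = (1, t, f)"
  proof (cases "w 7")
    case (fields x y z)
    then show ?thesis using that[of z] same[of 7 5 9] same[of 2 7 9] D[of 7 5 9] D[of 2 7 9] red[of 7] lead[of 7] rt
      by (simp del: One_nat_def add: frame w2 normalize)
  qed
  obtain c where w6: "w 6 = (a, 1, c)"
  proof (cases "w 6")
    case (fields x y z)
    then show ?thesis using that[of z] same[of 6 4 9] same[of 3 6 9] D[of 6 4 9] D[of 3 6 9] red[of 6] lead[of 6] ra
      by (simp del: One_nat_def add: frame w3 normalize)
  qed
  have "Z (det3 (w 0) (w 5) (w 6))" "Z (det3 (w 1) (w 4) (w 7))" "Z (det3 (w 2) (w 4) (w 6))"
    "Z (det3 (w 3) (w 5) (w 7))" "Z (det3 (w 0) (w 7) (w 8))" "Z (det3 (w 1) (w 6) (w 8))"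
    using same D[of 0 5 6] D[of 1 4 7] D[of 2 4 6] D[of 3 5 7] D[of 0 7 8] D[of 1 6 8] by simp_all
  note eqs = this[unfolded w0 w1 w2 w3 w6 w7 frame det3_simp]
  have r1: "Z (a - p * c)"
    by (rule Z_combination[OF eqs(1) Z_0 Z_0 Z_0, of _ "- 1" 0 0 0]) (simp add: algebra_simps)
  have r2: "Z (f - s * t)"
    by (rule Z_combination[OF eqs(2) Z_0 Z_0 Z_0, of _ "- 1" 0 0 0]) (simp add: algebra_simps)
  have r3: "Z (t * c - 1)"
    by (rule Z_combination[OF eqs(3) Z_0 Z_0 Z_0, of _ "- 1" 0 0 0]) (simp add: algebra_simps)
  have r4: "Z (a * f - 1)"
    by (rule Z_combination[OF eqs(4) Z_0 Z_0 Z_0, of _ 1 0 0 0]) (simp add: algebra_simps)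
  have r5: "Z (p * (t - f) + 1 - t)"
    by (rule Z_combination[OF eqs(5) Z_0 Z_0 Z_0, of _ 1 0 0 0]) (simp add: algebra_simps)
  have r6: "Z (c - a + s * (a - 1))"
    by (rule Z_combination[OF eqs(6) Z_0 Z_0 Z_0, of _ 1 0 0 0]) (simp add: algebra_simps)
  have c0: "\<not> Z c"
  proof
    assume "Z c"
    then have "Z 1"
      by (rule Z_combination[OF _ r3 Z_0 Z_0, of _ _ t "- 1" 0 0]) (simp add: algebra_simps)
    then show False by simp
  qed
  have "\<not> Z (det3 (w 4) (w 6) (w 8))" using same[of 4 6 8] D[of 4 6 8] by simp
  then have c1: "\<not> Z (c - 1)" by (simp add: w6 frame det3_simp Z_diff_commute)
  have g1: "Z (a - 2 * c + c * c)"
    by (rule Z_combination[OF r5 r1 r3 r4, of _ "c * c" "c * t - c * f" "c - a" c]) (simp add: algebra_simps)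
  have sa: "Z (s * a - c)"
    by (rule Z_combination[OF r4 r2 r3 Z_0, of _ c "- (a * c)" "- (s * a)" 0]) (simp add: algebra_simps)
  have g2: "Z (2 * a * c - a * a - c)"
    by (rule Z_combination[OF r6 sa Z_0 Z_0, of _ a "- (a - 1)" 0 0]) (simp add: algebra_simps)
  have "Z (c * (c - 1) * (c * c - c - 1))"
    by (rule Z_combination[OF g2 g1 Z_0 Z_0, of _ "- 1" "c * c - a" 0 0]) (simp add: algebra_simps)
  then have h: "Z (c * c - c - 1)" using c0 c1 by simp
  have za: "Z (a - (c - 1))"
    by (rule Z_combination[OF g1 h Z_0 Z_0, of _ 1 "- 1" 0 0]) (simp add: algebra_simps)
  have zf: "Z (f - c)"
    by (rule Z_combination[OF r4 za h Z_0, of _ c "- (f * c)" "- f" 0]) (simp add: algebra_simps)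
  have zt: "Z (t - (c - 1))"
    by (rule Z_combination[OF r3 h Z_0 Z_0, of _ "c - 1" "- t" 0 0]) (simp add: algebra_simps)
  have zs: "Z (s - (c + 1))"
    by (rule Z_combination[OF sa za h Z_0, of _ c "- (s * c)" "1 - s" 0]) (simp add: algebra_simps)
  have zp: "Z (p - (2 - c))"
    by (rule Z_combination[OF r1 za h Z_0, of _ "- (c - 1)" "c - 1" "1 - p" 0]) (simp add: algebra_simps)
  \<comment> \<open>All parameters are now polynomials in \<open>c\<close>; the vectors may be replaced by the polynomial ones.\<close>
  let ?w = "w(0 := (2 - c, 0, 1), 1 := (0, 1, c + 1), 2 := (1, c - 1, 1), 3 := (c - 1, 1, 1),
    6 := (c - 1, 1, c), 7 := (1, c - 1, c))"
  have vals: "val a = val (c - 1)" "val f = val c" "val t = val (c - 1)" "val s = val (c + 1)" "val p = val (2 - c)"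
    using za zf zt zs zp by (simp_all only: val_eq_iff)
  have val_w: "valv (?w i) = valv (w i)" for i
    by (simp del: One_nat_def add: w0 w1 w2 w3 w6 w7 vals)
  have "Z (det3 (?w i) (?w j) (?w k)) \<longleftrightarrow> Z (det3 (v i) (v j) (v k))" for i j k
    using det3_cong[OF val_w val_w val_w, of i j k] same[of i j k] unfolding Z_def by simp
  then have "hexagon_points c v ?w"
    using h frame red[of 10] lead10 unfolding hexagon_points_def by simp
  then show ?thesis by blast
qed

lemma hexagon_frame:
  assumes "realizes n T v" "10 \<le> n"
    and "\<And>i j k. i < 10 \<Longrightarrow> j \<in> {4..<10} \<Longrightarrow> k \<in> {4..<10} \<Longrightarrow> i \<noteq> j \<Longrightarrow> i \<noteq> k \<Longrightarrow> j \<noteq> k \<Longrightarrow>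
      list_ex (\<lambda>B. {i, j, k} \<subseteq> set B) T \<longleftrightarrow> list_ex (\<lambda>B. {i, j, k} \<subseteq> set B) hexagon_factors"
  shows "\<exists>w c. hexagon_points c v w"
proof (rule hexagon_coordinates)
  fix i j k :: nat
  assume ijk: "i < 10" "j \<in> {4..<10}" "k \<in> {4..<10}" "i \<noteq> j" "i \<noteq> k" "j \<noteq> k"
  show "Z (det3 (v i) (v j) (v k)) \<longleftrightarrow> list_ex (\<lambda>B. {i, j, k} \<subseteq> set B) hexagon_factors"
    using realizesD[OF assms(1), of i j k] assms(2) assms(3)[OF ijk] ijk by simp
qed

text \<open>
  Modulo \<open>c\<^sup>2 - c - 1\<close> the two determinants are \<open>2 * (c - 1)\<close> and \<open>2 * (1 - c)\<close>, and \<open>c\<close> is the inverse of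
  \<open>c - 1\<close>.
\<close>

lemma hexagon_collinear_iff_two:
  assumes "hexagon_points c v w"
  shows "Z (det3 (v 1) (v 2) (v 3)) \<Longrightarrow> Z 2" and "Z 2 \<Longrightarrow> Z (det3 (v 0) (v 1) (v 2))"
proof -
  have same: "Z (det3 (w i) (w j) (w k)) \<longleftrightarrow> Z (det3 (v i) (v j) (v k))" for i j k
    using assms by (simp add: hexagon_points_def)
  have w: "w 0 = (2 - c, 0, 1)" "w 1 = (0, 1, c + 1)" "w 2 = (1, c - 1, 1)" "w 3 = (c - 1, 1, 1)"
    and h: "Z (c * c - c - 1)"
    using assms by (simp_all add: hexagon_points_def)
  show "Z 2" if "Z (det3 (v 1) (v 2) (v 3))"
    by (rule Z_combination[OF that[folded same] h Z_0 Z_0, of _ c "c * c - 2" 0 0])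
      (simp del: One_nat_def add: w det3_simp algebra_simps)
  show "Z (det3 (v 0) (v 1) (v 2))" if "Z 2"
    unfolding same[symmetric]
    by (rule Z_combination[OF that h Z_0 Z_0, of _ "1 - c" "c - 1" 0 0])
      (simp del: One_nat_def add: w det3_simp algebra_simps)
qed

lemma ten_triple_impossible:
  assumes v: "realizes 10 ten_triple v"
  shows False
proof -
  obtain w c where "hexagon_points c v w"
    using hexagon_frame[OF v] by (auto simp: ten_triple_def)
  then show False
    using hexagon_collinear_iff_two realizesD[OF v, of 1 2 3] realizesD[OF v, of 0 1 2]
    by (simp add: ten_triple_def hexagon_factors_def)
qed

lemma ten_quadruple_field:
  assumes v: "realizes 10 ten_quadruple v"
  obtains c where "Z 2" "Z (c * c + c + 1)"
proof -
  obtain w c where w: "hexagon_points c v w"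
    using hexagon_frame[OF v] by (auto simp: ten_quadruple_def)
  then have two: "Z 2"
    using hexagon_collinear_iff_two realizesD[OF v, of 1 2 3]
    by (simp add: ten_quadruple_def hexagon_factors_def)
  have "Z (c * c - c - 1)" using w by (simp add: hexagon_points_def)
  then have "Z (c * c + c + 1)"
    by (rule Z_combination[OF _ two Z_0 Z_0, of _ _ 1 "c + 1" 0 0]) (simp add: algebra_simps)
  then show ?thesis using that two by blast
qed

text \<open>
  The fifth factor adds the point \<open>(1, 1, 0)\<close>, and its block \<open>6 7 10\<close> again says \<open>2 = 0\<close>. Then \<open>0, 1, 2\<close>
  would be in a block, although \<open>01\<close> is a missed pair.
\<close>

lemma eleven_hexagon_impossible:
  assumes v: "realizes 11 eleven_hexagon v"
  shows False
proof -
  note D = realizesD[OF v, unfolded eleven_hexagon_def hexagon_factors_def]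
  obtain w c where w: "hexagon_points c v w"
    using hexagon_frame[OF v] by (auto simp: eleven_hexagon_def)
  have same: "Z (det3 (w i) (w j) (w k)) \<longleftrightarrow> Z (det3 (v i) (v j) (v k))" for i j k
    using w by (simp add: hexagon_points_def)
  have pts: "w 4 = (1, 0, 0)" "w 5 = (0, 1, 0)" "w 6 = (c - 1, 1, c)" "w 7 = (1, c - 1, c)"
    "w 8 = (1, 1, 1)" "w 9 = (0, 0, 1)" and h: "Z (c * c - c - 1)"
    using w by (simp_all add: hexagon_points_def)
  have w10: "w 10 = (1, 1, 0)"
  proof (cases "w 10")
    case (fields x y z)
    then show ?thesis
      using w same[of 4 5 10] same[of 8 9 10] same[of 4 9 10] D[of 4 5 10] D[of 8 9 10] D[of 4 9 10]
      by (simp add: hexagon_points_def pts normalize)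
  qed
  have "Z (det3 (w 6) (w 7) (w 10))" using same[of 6 7 10] D[of 6 7 10] by simp
  then have "Z 2"
    by (rule Z_combination[OF _ h Z_0 Z_0, of _ _ c "2 * c - 2" 0 0])
      (simp add: pts w10 det3_simp algebra_simps)
  then show False using hexagon_collinear_iff_two(2)[OF w] D[of 0 1 2] by simp
qed

end

section \<open>Configurations from explicit coordinates\<close>

text \<open>
  The conditions on a block system, in a form that can be evaluated.
\<close>

definition valid_blocks :: "nat \<Rightarrow> nat list list \<Rightarrow> bool" where
  "valid_blocks n T \<longleftrightarrow> distinct T \<and>
    list_all (\<lambda>B. distinct B \<and> 3 \<le> length B \<and> list_all (\<lambda>i. i < n) B) T \<and>
    list_all (\<lambda>B. list_all (\<lambda>B'. B = B' \<or> length (filter (\<lambda>i. i \<in> set B') B) \<le> 1) T) T"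

lemma valid_blocksD:
  assumes "valid_blocks n T"
  shows "distinct T" "B \<in> set T \<Longrightarrow> distinct B" "B \<in> set T \<Longrightarrow> 3 \<le> length B" "B \<in> set T \<Longrightarrow> set B \<subseteq> {..<n}"
    and "B \<in> set T \<Longrightarrow> B' \<in> set T \<Longrightarrow> i \<in> set B \<Longrightarrow> j \<in> set B \<Longrightarrow> i \<in> set B' \<Longrightarrow> j \<in> set B' \<Longrightarrow> i \<noteq> j \<Longrightarrow> B = B'"
proof -
  show "distinct T" "B \<in> set T \<Longrightarrow> distinct B" "B \<in> set T \<Longrightarrow> 3 \<le> length B" "B \<in> set T \<Longrightarrow> set B \<subseteq> {..<n}"
    using assms by (auto simp: valid_blocks_def list_all_iff)
  assume h: "B \<in> set T" "B' \<in> set T" "i \<in> set B" "j \<in> set B" "i \<in> set B'" "j \<in> set B'" "i \<noteq> j"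
  show "B = B'"
  proof (rule ccontr)
    assume "B \<noteq> B'"
    then have "length (filter (\<lambda>i. i \<in> set B') B) \<le> 1"
      using assms h(1,2) by (auto simp: valid_blocks_def list_all_iff)
    moreover have "card {i, j} \<le> card (set (filter (\<lambda>i. i \<in> set B') B))"
      using h by (intro card_mono) auto
    ultimately show False using h(7) card_length[of "filter (\<lambda>i. i \<in> set B') B"] by simp
  qed
qed

context field_presentation
begin

text \<open>
  Knowledge of the vanishing determinants is knowledge of the block system: a block is recovered from
  two of its elements as the set of all elements that are in a block with both.
\<close>

lemma realizes_blocks:
  assumes v: "distinct_lines n v" and T: "valid_blocks n T" and r: "realizes n T v"
  shows "blocks n v = set ` set T"
proof
  note V = valid_blocksD[OF T]
  have in_T: "(\<exists>B \<in> blocks n v. {i, j, k} \<subseteq> B) \<longleftrightarrow> (\<exists>B \<in> set T. {i, j, k} \<subseteq> set B)"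
    if "i < n" "j < n" "k < n" "i \<noteq> j" "i \<noteq> k" "j \<noteq> k" for i j k
    using det3_iff_block[OF v that] realizesD[OF r that] by (simp add: list_ex_iff)
  have third: "\<exists>k \<in> B. k \<noteq> i \<and> k \<noteq> j" if "3 \<le> card B" for B :: "nat set" and i j
  proof (rule ccontr)
    assume "\<not> ?thesis"
    then have "B \<subseteq> {i, j}" by blast
    then have "card B \<le> card {i, j}" by (intro card_mono) auto
    then show False using that card_insert_le_m1[of 2 "{j}" i] by simp
  qed
  have cardT: "3 \<le> card (set B)" if "B \<in> set T" for B
    using V(2,3)[OF that] distinct_card by metis
  have key: "A = set B" if A: "A \<in> blocks n v" and B: "B \<in> set T" and ij: "i \<in> A" "j \<in> A" "i \<in> set B" "j \<in> set B" "i \<noteq> j" for A B i j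
  proof
    show "A \<subseteq> set B"
    proof
      fix k assume k: "k \<in> A"
      show "k \<in> set B"
      proof (cases "k = i \<or> k = j")
        case False
        then have "\<exists>B' \<in> set T. {i, j, k} \<subseteq> set B'"
          using in_T[of i j k] A ij k block_subset[OF A] by auto
        then show ?thesis using V(5)[OF B, of _ i j] ij by auto
      qed (use ij in auto)
    qed
    show "set B \<subseteq> A"
    proof
      fix k assume k: "k \<in> set B"
      show "k \<in> A"
      proof (cases "k = i \<or> k = j")
        case False
        then have "\<exists>A' \<in> blocks n v. {i, j, k} \<subseteq> A'"
          using in_T[of i j k] B ij k V(4)[OF B] by auto
        then show ?thesis using block_unique[OF v A, of _ i j] ij by auto
      qed (use ij in auto)
    qed
  qed
  show "blocks n v \<subseteq> set ` set T"
  proof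
    fix A assume A: "A \<in> blocks n v"
    obtain i j where ij: "i \<in> A" "j \<in> A" "i \<noteq> j" using two_in_block[OF block_card[OF A]] .
    obtain k where "k \<in> A" "k \<noteq> i" "k \<noteq> j" using third[OF block_card[OF A]] by blast
    then obtain B where "B \<in> set T" "{i, j, k} \<subseteq> set B"
      using in_T[of i j k] A ij block_subset[OF A] by auto
    then show "A \<in> set ` set T" using key[OF A _ ij(1,2) _ _ ij(3)] by auto
  qed
  show "set ` set T \<subseteq> blocks n v"
  proof
    fix S assume "S \<in> set ` set T"
    then obtain B where B: "B \<in> set T" "S = set B" by blast
    obtain i j where ij: "i \<in> set B" "j \<in> set B" "i \<noteq> j" using two_in_block[OF cardT[OF B(1)]] .
    obtain k where "k \<in> set B" "k \<noteq> i" "k \<noteq> j" using third[OF cardT[OF B(1)]] by blast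
    then obtain A where "A \<in> blocks n v" "{i, j, k} \<subseteq> A"
      using in_T[of i j k] B ij V(4)[OF B(1)] by auto
    then show "S \<in> blocks n v" using key[OF _ B(1) _ _ ij(1,2,3)] B(2) by auto
  qed
qed

lemma card_points_realization:
  assumes v: "distinct_lines n v" and T: "valid_blocks n T" and r: "realizes n T v"
  shows "card (multiplicity_ge3_points R (config n v)) = length T"
    and "card (triple_points R (config n v)) = length (filter (\<lambda>B. length B = 3) T)"
proof -
  note V = valid_blocksD[OF T]
  have inj: "inj_on set (set T)"
  proof (rule inj_onI)
    fix B B' assume B: "B \<in> set T" "B' \<in> set T" "set B = set B'"
    have "3 \<le> card (set B)" using V(2,3)[OF B(1)] distinct_card by metis
    then obtain i j where "i \<in> set B" "j \<in> set B" "i \<noteq> j" by (rule two_in_block)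
    then show "B = B'" using V(5)[OF B(1,2)] B(3) by blast
  qed
  note blocks = realizes_blocks[OF assms]
  show "card (multiplicity_ge3_points R (config n v)) = length T"
    using bij_betw_same_card[OF bij_betw_blocks(1)[OF v]] card_image[OF inj] distinct_card[OF V(1)] blocks by simp
  have "{A \<in> blocks n v. card A = 3} = set ` set (filter (\<lambda>B. length B = 3) T)"
    using V(2) distinct_card unfolding blocks by fastforce
  moreover have "card (set ` set (filter (\<lambda>B. length B = 3) T)) = card (set (filter (\<lambda>B. length B = 3) T))"
    by (rule card_image[OF inj_on_subset[OF inj]]) auto
  moreover have "card (set (filter (\<lambda>B. length B = 3) T)) = length (filter (\<lambda>B. length B = 3) T)"
    using V(1) by (intro distinct_card) simp
  ultimately show "card (triple_points R (config n v)) = length (filter (\<lambda>B. length B = 3) T)"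
    using bij_betw_same_card[OF bij_betw_blocks(2)[OF v]] by simp
qed

text \<open>
  Three vectors orthogonal to a fourth one are linearly dependent; the identity is Cramer's rule for
  the linear system with the solution \<open>m\<close>.
\<close>

lemma Z_det3_orthogonal:
  assumes "\<not> null m" "Z (dot m a)" "Z (dot m b)" "Z (dot m c)"
  shows "Z (det3 a b c)"
proof -
  obtain x y z where m: "m = (x, y, z)" by (cases m)
  have *: "smul (det3 a b c) m = (case cross b c of (x1, y1, z1) \<Rightarrow> case cross c a of (x2, y2, z2) \<Rightarrow> case cross a b of (x3, y3, z3) \<Rightarrow>
     (dot m a * x1 + dot m b * x2 + dot m c * x3, dot m a * y1 + dot m b * y2 + dot m c * y3,
      dot m a * z1 + dot m b * z2 + dot m c * z3))"
    by (cases a; cases b; cases c) (simp add: m det3_simp algebra_simps)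
  have "null (smul (det3 a b c) m)"
    unfolding * using assms(2-4) by (auto split: prod.splits intro!: Z_add simp del: dot.simps)
  then show ?thesis using assms(1) by (auto simp: m)
qed

lemma null_cross_det3: "null (cross u v) \<Longrightarrow> Z (det3 w u v)"
  by (cases w; cases u; cases v) (auto simp: det3_def intro!: Z_add)

lemma distinct_lines_realization:
  assumes r: "realizes n T v" and
    T: "\<And>i j. i < n \<Longrightarrow> j < n \<Longrightarrow> i \<noteq> j \<Longrightarrow> \<exists>k<n. k \<noteq> i \<and> k \<noteq> j \<and> \<not> list_ex (\<lambda>B. {k, i, j} \<subseteq> set B) T"
    and n: "2 \<le> n"
  shows "distinct_lines n v"
proof -
  have cross: "\<not> null (cross (v i) (v j))" if ij: "i < n" "j < n" "i \<noteq> j" for i j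
  proof
    assume null: "null (cross (v i) (v j))"
    obtain k where k: "k < n" "k \<noteq> i" "k \<noteq> j" "\<not> list_ex (\<lambda>B. {k, i, j} \<subseteq> set B) T"
      using T[OF ij] by blast
    then have "\<not> Z (det3 (v k) (v i) (v j))"
      using realizesD[OF r k(1) ij(1,2) k(2,3) ij(3)] by blast
    then show False using null_cross_det3[OF null] by blast
  qed
  have "\<not> null (v i)" if "i < n" for i
  proof
    assume null: "null (v i)"
    obtain j where "j < n" "j \<noteq> i" using n that by (metis Suc_1 Suc_le_eq less_2_cases_iff less_trans nat_neq_iff zero_less_Suc)
    moreover have "null (cross (v i) (v j))"
      using null by (cases "v i"; cases "v j") (auto intro!: Z_diff)
    ultimately show False using cross[OF that] by blast
  qed
  then show ?thesis using cross by (simp add: distinct_lines_def)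
qed

lemma distinct_lines_mono: "distinct_lines n v \<Longrightarrow> m \<le> n \<Longrightarrow> distinct_lines m v"
  by (simp add: distinct_lines_def)

end

text \<open>
  The vectors \<open>vs\<close> have coordinates in a ring \<open>'s\<close> of constants, and \<open>zt\<close> decides whether a constant
  vanishes in the field. In a field of unknown characteristic this is possible only for some
  constants; the predicate \<open>P\<close> singles these out.
\<close>

definition incidences :: "('s::comm_ring_1 \<Rightarrow> bool) \<Rightarrow> ('s \<Rightarrow> bool) \<Rightarrow> 's vec list \<Rightarrow> nat list list \<Rightarrow> bool" where
  "incidences zt P vs T \<longleftrightarrow>
    list_all (\<lambda>i. list_all (\<lambda>j. list_all (\<lambda>k. let d = det3 (vs ! i) (vs ! j) (vs ! k) in
      P d \<and> (zt d \<longleftrightarrow> list_ex (\<lambda>B. i \<in> set B \<and> j \<in> set B \<and> k \<in> set B) T))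
      [Suc j..<length vs]) [Suc i..<length vs]) [0..<length vs]"

text \<open>
  Vectors of the system are pairwise independent as soon as every pair is completed to an independent
  triple, which can be read off the blocks.
\<close>

definition spread :: "nat \<Rightarrow> nat list list \<Rightarrow> bool" where
  "spread n T \<longleftrightarrow> list_all (\<lambda>i. list_all (\<lambda>j. i = j \<or> list_ex (\<lambda>k. k \<noteq> i \<and> k \<noteq> j \<and>
     \<not> list_ex (\<lambda>B. k \<in> set B \<and> i \<in> set B \<and> j \<in> set B) T) [0..<n]) [0..<n]) [0..<n]"

fun mapv :: "('s \<Rightarrow> 'r) \<Rightarrow> 's vec \<Rightarrow> 'r vec" where
  "mapv h (x, y, z) = (h x, h y, h z)"

text \<open>
  \<open>Eis a b\<close> stands for \<open>a + b * \<omega>\<close> with \<open>\<omega>\<^sup>2 = - \<omega> - 1\<close>, which is where the product comes from.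
\<close>

datatype eisenstein = Eis int int

instantiation eisenstein :: comm_ring_1
begin

definition zero_eisenstein where "0 = Eis 0 0"
definition one_eisenstein where "1 = Eis 1 0"
fun plus_eisenstein where "Eis a b + Eis c d = Eis (a + c) (b + d)"
fun uminus_eisenstein where "- Eis a b = Eis (- a) (- b)"
fun minus_eisenstein where "Eis a b - Eis c d = Eis (a - c) (b - d)"
fun times_eisenstein where "Eis a b * Eis c d = Eis (a * c - b * d) (a * d + b * c - b * d)"

instance
proof
  fix x y z :: eisenstein
  show "x + y + z = x + (y + z)" by (cases x; cases y; cases z) simp
  show "x + y = y + x" by (cases x; cases y) simp
  show "0 + x = x" by (cases x) (simp add: zero_eisenstein_def)
  show "- x + x = 0" by (cases x) (simp add: zero_eisenstein_def)
  show "x - y = x + - y" by (cases x; cases y) simp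
  show "x * y * z = x * (y * z)" by (cases x; cases y; cases z) (simp add: algebra_simps)
  show "x * y = y * x" by (cases x; cases y) (simp add: algebra_simps)
  show "1 * x = x" by (cases x) (simp add: one_eisenstein_def)
  show "(x + y) * z = x * z + y * z" by (cases x; cases y; cases z) (simp add: algebra_simps)
  show "(0 :: eisenstein) \<noteq> 1" by (simp add: zero_eisenstein_def one_eisenstein_def)
qed

end

fun eisenstein_norm :: "eisenstein \<Rightarrow> int" where
  "eisenstein_norm (Eis a b) = a * a - a * b + b * b"

fun eisenstein_value :: "'r::comm_ring_1 \<Rightarrow> eisenstein \<Rightarrow> 'r" where
  "eisenstein_value w (Eis a b) = of_int a + of_int b * w"

context field_presentation
begin

definition hom_mod :: "('s::comm_ring_1 \<Rightarrow> 'r) \<Rightarrow> bool" where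
  "hom_mod h \<longleftrightarrow> (\<forall>x y. val (h (x + y)) = val (h x + h y) \<and> val (h (x * y)) = val (h x * h y))"

lemma hom_mod_of_int: "hom_mod of_int"
  by (simp add: hom_mod_def)

lemma hom_mod_eisenstein_value:
  assumes "Z (w * w + w + 1)" shows "hom_mod (eisenstein_value w)"
  unfolding hom_mod_def val_eq_iff
proof (intro allI conjI)
  fix x y :: eisenstein
  obtain a b c d where xy: "x = Eis a b" "y = Eis c d" by (cases x; cases y)
  have "eisenstein_value w (x + y) - (eisenstein_value w x + eisenstein_value w y) = 0"
    by (simp add: xy algebra_simps)
  then show "Z (eisenstein_value w (x + y) - (eisenstein_value w x + eisenstein_value w y))" by simp
  have "eisenstein_value w (x * y) - eisenstein_value w x * eisenstein_value w y =
      - (of_int b * of_int d) * (w * w + w + 1)"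
    by (simp add: xy algebra_simps)
  then show "Z (eisenstein_value w (x * y) - eisenstein_value w x * eisenstein_value w y)"
    using assms by simp
qed

lemma val_hom_det3:
  assumes h: "hom_mod h"
  shows "val (h (det3 u v t)) = val (det3 (mapv h u) (mapv h v) (mapv h t))"
proof -
  have add: "val (h (x + y)) = val (h x) \<oplus> val (h y)" and mult: "val (h (x * y)) = val (h x) \<otimes> val (h y)" for x y
    using h by (simp_all add: hom_mod_def val_add val_mult)
  have "val (h 0) = \<zero>"
    using add[of 0 0] by (simp add: add.l_cancel_one')
  then have minus: "val (h (- x)) = \<ominus> val (h x)" for x
    using minus_equality[of "val (h (- x))" "val (h x)"] add[of "- x" x] by simp
  show ?thesis
    by (cases u; cases v; cases t)
      (simp add: det3_simp add mult minus val_add val_mult val_minus diff_conv_add_uminus del: add_uminus_conv_diff)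
qed

lemma realizes_sorted:
  assumes "\<And>i j k. i < j \<Longrightarrow> j < k \<Longrightarrow> k < n \<Longrightarrow>
    Z (det3 (v i) (v j) (v k)) \<longleftrightarrow> list_ex (\<lambda>B. {i, j, k} \<subseteq> set B) T"
  shows "realizes n T v"
  unfolding realizes_def
proof (intro allI impI)
  fix i j k assume n: "i < n" "j < n" "k < n" and "i \<noteq> j" "i \<noteq> k" "j \<noteq> k"
  have swap: "Z (det3 (v b) (v a) (v c)) \<longleftrightarrow> Z (det3 (v a) (v b) (v c))" for a b c
    using det3_swap[of "v b" "v a" "v c"] by simp
  have rot: "Z (det3 (v b) (v c) (v a)) \<longleftrightarrow> Z (det3 (v a) (v b) (v c))" for a b c
    using det3_rotate[of "v b" "v c" "v a"] by simp
  consider "i < j" "j < k" | "i < k" "k < j" | "j < i" "i < k" | "j < k" "k < i" | "k < i" "i < j" | "k < j" "j < i"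
    using \<open>i \<noteq> j\<close> \<open>i \<noteq> k\<close> \<open>j \<noteq> k\<close> by linarith
  then show "Z (det3 (v i) (v j) (v k)) \<longleftrightarrow> list_ex (\<lambda>B. {i, j, k} \<subseteq> set B) T"
  proof cases
    case 1 then show ?thesis using assms n by simp
  next
    case 2 then show ?thesis using assms[of i k j] n swap[of i k j] rot[of i j k] by (simp add: insert_commute)
  next
    case 3 then show ?thesis using assms[of j i k] n swap[of i j k] by (simp add: insert_commute)
  next
    case 4 then show ?thesis using assms[of j k i] n rot[of j k i] by (simp add: insert_commute)
  next
    case 5 then show ?thesis using assms[of k i j] n rot[of i j k] by (simp add: insert_commute)
  next
    case 6 then show ?thesis using assms[of k j i] n swap[of j i k] rot[of j i k] by (simp add: insert_commute)
  qed
qed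

lemma realizes_of_incidences:
  assumes h: "hom_mod h" and test: "\<And>x. P x \<Longrightarrow> Z (h x) \<longleftrightarrow> zt x"
    and check: "incidences zt P vs T"
  shows "realizes (length vs) T (\<lambda>i. mapv h (vs ! i))"
proof (rule realizes_sorted)
  fix i j k assume "i < j" "j < k" "k < length vs"
  then have "i \<in> set [0..<length vs]" "j \<in> set [Suc i..<length vs]" "k \<in> set [Suc j..<length vs]" by auto
  then have c: "P (det3 (vs ! i) (vs ! j) (vs ! k))"
    "zt (det3 (vs ! i) (vs ! j) (vs ! k)) \<longleftrightarrow> list_ex (\<lambda>B. i \<in> set B \<and> j \<in> set B \<and> k \<in> set B) T"
    using check unfolding incidences_def list_all_iff Let_def by blast+
  have "Z (det3 (mapv h (vs ! i)) (mapv h (vs ! j)) (mapv h (vs ! k))) \<longleftrightarrow> Z (h (det3 (vs ! i) (vs ! j) (vs ! k)))"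
    by (simp add: Z_def val_hom_det3[OF h])
  then show "Z (det3 (mapv h (vs ! i)) (mapv h (vs ! j)) (mapv h (vs ! k))) \<longleftrightarrow> list_ex (\<lambda>B. {i, j, k} \<subseteq> set B) T"
    using test[OF c(1)] c(2) by simp
qed

lemma distinct_lines_spread:
  assumes "realizes n T v" "spread n T" "2 \<le> n"
  shows "distinct_lines n v"
proof (rule distinct_lines_realization[OF assms(1)])
  fix i j assume "i < n" "j < n" "i \<noteq> j"
  then have "i \<in> set [0..<n]" "j \<in> set [0..<n]" by auto
  then have "list_ex (\<lambda>k. k \<noteq> i \<and> k \<noteq> j \<and>
     \<not> list_ex (\<lambda>B. k \<in> set B \<and> i \<in> set B \<and> j \<in> set B) T) [0..<n]"
    using assms(2) \<open>i \<noteq> j\<close> unfolding spread_def list_all_iff by blast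
  then show "\<exists>k<n. k \<noteq> i \<and> k \<noteq> j \<and> \<not> list_ex (\<lambda>B. {k, i, j} \<subseteq> set B) T"
    by (auto simp: list_ex_iff)
qed (use assms in simp)

lemma explicit_configuration:
  assumes "hom_mod h" "\<And>x. P x \<Longrightarrow> Z (h x) \<longleftrightarrow> zt x" "incidences zt P vs T"
    and "valid_blocks (length vs) T" "spread (length vs) T" "2 \<le> length vs"
  obtains v where "v = (\<lambda>i. mapv h (vs ! i))" "distinct_lines (length vs) v" "realizes (length vs) T v"
    "line_configuration R (length vs) (config (length vs) v)"
    "card (multiplicity_ge3_points R (config (length vs) v)) = length T"
    "card (triple_points R (config (length vs) v)) = length (filter (\<lambda>B. length B = 3) T)"
proof -
  let ?v = "\<lambda>i. mapv h (vs ! i)"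
  have r: "realizes (length vs) T ?v" by (rule realizes_of_incidences[OF assms(1-3)])
  have d: "distinct_lines (length vs) ?v" by (rule distinct_lines_spread[OF r assms(5,6)])
  show ?thesis
    using that[of ?v] d r line_configuration_config[OF d] card_points_realization[OF d assms(4) r] by blast
qed

text \<open>
  Since all blocks are triples, the first \<open>n\<close> lines keep exactly the triple points whose three lines
  are among them.
\<close>

lemma subconfiguration:
  assumes v: "distinct_lines m v" and r: "realizes m T v" and T: "valid_blocks m T"
    and three: "list_all (\<lambda>B. length B = 3) T" and n: "n \<le> m"
  shows "line_configuration R n (config n v)"
    "card (triple_points R (config n v)) = length (filter (list_all (\<lambda>i. i < n)) T)"
proof -
  let ?T = "filter (list_all (\<lambda>i. i < n)) T"
  have d: "distinct_lines n v" by (rule distinct_lines_mono[OF v n])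
  have "realizes n ?T v"
    unfolding realizes_def
  proof (intro allI impI)
    fix i j k assume ijk: "i < n" "j < n" "k < n" "i \<noteq> j" "i \<noteq> k" "j \<noteq> k"
    have "set B = {i, j, k}" if "B \<in> set T" "{i, j, k} \<subseteq> set B" for B
    proof (rule card_seteq[symmetric])
      show "card (set B) \<le> card {i, j, k}"
        using card_length[of B] three that(1) ijk by (simp add: list_all_iff)
    qed (use that in auto)
    then have "list_ex (\<lambda>B. {i, j, k} \<subseteq> set B) ?T \<longleftrightarrow> list_ex (\<lambda>B. {i, j, k} \<subseteq> set B) T"
      using ijk by (fastforce simp: list_ex_iff list_all_iff)
    then show "Z (det3 (v i) (v j) (v k)) \<longleftrightarrow> list_ex (\<lambda>B. {i, j, k} \<subseteq> set B) ?T"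
      using realizesD[OF r, of i j k] ijk n by simp
  qed
  moreover have "valid_blocks n ?T" using T by (auto simp: valid_blocks_def list_all_iff)
  moreover have "filter (\<lambda>B. length B = 3) ?T = ?T"
    using three by (intro filter_True) (simp add: list_all_iff)
  ultimately show "line_configuration R n (config n v)"
    "card (triple_points R (config n v)) = length (filter (list_all (\<lambda>i. i < n)) T)"
    using line_configuration_config[OF d] card_points_realization(2)[OF d] by metis+
qed

end

text \<open>
  The six lines through pairs of four points in general position, ordered in such a way that
  the first \<open>s\<close> of them have the largest number of triple points for every \<open>s \<le> 6\<close>.
\<close>

definition quadrilateral_vectors :: "int vec list" where
  "quadrilateral_vectors = [(1, 0, 0), (0, 1, 0), (1, -1, 0), (0, 0, 1), (1, 0, -1), (0, 1, -1)]"

definition quadrilateral_blocks :: "nat list list" where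
  "quadrilateral_blocks = [[0, 1, 2], [0, 3, 4], [1, 3, 5], [2, 4, 5]]"

definition fano_vectors :: "int vec list" where
  "fano_vectors = [(1, 0, 0), (0, 1, 0), (1, 1, 0), (0, 0, 1), (1, 0, 1), (0, 1, 1), (1, 1, 1)]"

text \<open>
  The dual Hesse configuration \<open>(x\<^sup>3 - y\<^sup>3) * (y\<^sup>3 - z\<^sup>3) * (z\<^sup>3 - x\<^sup>3) = 0\<close>.
\<close>

definition hesse_vectors :: "eisenstein vec list" where
  "hesse_vectors = (let w0 = Eis (-1) 0; w1 = Eis 0 (-1); w2 = Eis 1 1 in
    [(1, w0, 0), (1, w1, 0), (1, w2, 0), (0, 1, w0), (0, 1, w1), (0, 1, w2), (w0, 0, 1), (w1, 0, 1), (w2, 0, 1)])"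

definition hesse_blocks :: "nat list list" where
  "hesse_blocks = [[0, 1, 2], [3, 4, 5], [6, 7, 8], [0, 3, 6], [0, 4, 8], [0, 5, 7], [1, 3, 8], [1, 4, 7], [1, 5, 6],
    [2, 3, 7], [2, 4, 6], [2, 5, 8]]"

text \<open>
  The coordinates of \<open>hexagon_points\<close> for \<open>c = \<omega>\<close>, reduced modulo 2.
\<close>

definition quadruple_vectors :: "eisenstein vec list" where
  "quadruple_vectors = (let c = Eis 0 1; d = Eis 1 1 in
    [(c, 0, 1), (0, 1, d), (1, d, 1), (d, 1, 1), (1, 0, 0), (0, 1, 0), (d, 1, c), (1, d, c), (1, 1, 1), (0, 0, 1)])"

text \<open>
  The solution found in \<open>menelaus_characteristic\<close> with \<open>g = 3\<close>, reduced modulo 5.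
\<close>

definition menelaus_vectors :: "int vec list" where
  "menelaus_vectors = [(2, 1, 4), (1, 0, 0), (0, 1, 0), (0, 0, 1), (1, 2, 0), (1, 1, 1), (1, 0, 3), (1, 2, 1), (0, 1, 1), (1, 1, 3)]"

text \<open>
  Integer representatives of eleven lines over the field with five elements.
\<close>

definition eleven_vectors :: "int vec list" where
  "eleven_vectors = [(1, 0, 1), (1, 1, 0), (1, 1, 1), (1, 1, 2), (1, 2, 1), (1, 2, 2), (1, 4, 0), (1, 4, 2), (1, 4, 4), (0, 1, 2), (0, 1, 3)]"

definition eleven_blocks :: "nat list list" where
  "eleven_blocks = [[0, 1, 7], [0, 2, 4], [0, 3, 6], [0, 5, 10], [0, 8, 9], [1, 2, 3], [1, 5, 9], [1, 8, 10], [2, 5, 8],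
    [2, 6, 10], [2, 7, 9], [3, 4, 8], [3, 5, 7], [4, 6, 9], [4, 7, 10], [6, 7, 8]]"

fun even_eisenstein where "even_eisenstein (Eis a b) \<longleftrightarrow> even a \<and> even b"

text \<open>
  The determinants of the quadrilateral are \<open>0\<close>, \<open>1\<close>, \<open>-1\<close> and those of the dual Hesse configuration are \<open>0\<close>
  or of norm 1 or 3. The latter do not vanish, because in characteristic 3 the only third root of 1 is
  trivial. The other configurations are considered in characteristic 2 or 5 only.
\<close>

lemma quadrilateral_check: "incidences (\<lambda>x. x = 0) (\<lambda>x. x \<in> {-1, 0, 1}) quadrilateral_vectors quadrilateral_blocks"
  by code_simp

lemma fano_check: "incidences even (\<lambda>_. True) fano_vectors fano"
  by code_simp

lemma hesse_check: "incidences (\<lambda>x. x = Eis 0 0) (\<lambda>x. x = Eis 0 0 \<or> eisenstein_norm x \<in> {1, 3}) hesse_vectors hesse_blocks"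
  by code_simp

lemma quadruple_check: "incidences even_eisenstein (\<lambda>_. True) quadruple_vectors ten_quadruple"
  by code_simp

lemma menelaus_check: "incidences (\<lambda>x. 5 dvd x) (\<lambda>_. True) menelaus_vectors ten_menelaus"
  by code_simp

lemma eleven_check: "incidences (\<lambda>x. 5 dvd x) (\<lambda>_. True) eleven_vectors eleven_blocks"
  by code_simp

context field_presentation
begin

section \<open>The characteristic\<close>

lemma val_of_nat: "val (of_nat n) = [n] \<cdot> \<one>"
  by (induction n) (simp_all add: val_add val_1 add.nat_pow_Suc a_comm)

lemma Z_of_nat_iff: "Z (of_nat n) \<longleftrightarrow> ring_characteristic R dvd n"
proof -
  have "Z (of_nat n) \<longleftrightarrow> \<one> [^]\<^bsub>add_monoid R\<^esub> n = \<one>\<^bsub>add_monoid R\<^esub>"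
    by (simp add: Z_def val_of_nat add_pow_def)
  also have "\<dots> \<longleftrightarrow> group.ord (add_monoid R) \<one> dvd n"
    by (rule group.pow_eq_id[OF a_group]) simp
  finally show ?thesis by (simp add: ring_characteristic_def)
qed

lemma ring_characteristic_prime_iff:
  assumes "Factorial_Ring.prime p" shows "ring_characteristic R = p \<longleftrightarrow> Z (of_nat p)"
proof
  assume "Z (of_nat p)"
  then have "ring_characteristic R dvd p" by (simp add: Z_of_nat_iff)
  moreover have "ring_characteristic R \<noteq> 1" using Z_of_nat_iff[of 1] Z_1 by auto
  ultimately show "ring_characteristic R = p" using assms prime_nat_iff by blast
qed (simp add: Z_of_nat_iff)

lemma characteristic_two: "ring_characteristic R = 2 \<longleftrightarrow> Z 2"
  using ring_characteristic_prime_iff[OF two_is_prime_nat] by simp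

lemma characteristic_five: "ring_characteristic R = 5 \<longleftrightarrow> Z 5"
proof -
  have "Factorial_Ring.prime (5 :: nat)" by simp
  then show ?thesis using ring_characteristic_prime_iff[of 5] by simp
qed

lemma Z_of_int_iff: "Z (of_int n) \<longleftrightarrow> int (ring_characteristic R) dvd n"
proof (cases n)
  case (nonneg m)
  then show ?thesis by (simp add: Z_of_nat_iff)
next
  case (neg m)
  have "Z (of_int n) \<longleftrightarrow> Z (of_nat (Suc m))" unfolding neg by (simp only: of_int_minus of_int_of_nat_eq Z_minus)
  then show ?thesis unfolding neg by (simp only: Z_of_nat_iff dvd_minus_iff int_dvd_int_iff)
qed

lemma cube_root_iff:
  "has_nontrivial_cube_root_of_one R \<longleftrightarrow> (\<exists>w. Z (w * w + w + 1) \<and> \<not> Z (w - 1))"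
proof -
  have pow: "val w [^] (3::nat) = val (w * w * w)" for w
    by (simp add: numeral_3_eq_3 val_mult m_assoc)
  have "val w [^] (3::nat) = \<one> \<and> val w \<noteq> \<one> \<longleftrightarrow> Z (w * w + w + 1) \<and> \<not> Z (w - 1)" for w
  proof -
    have "w * w * w - 1 = (w - 1) * (w * w + w + 1)" by (simp add: algebra_simps)
    then have "val (w * w * w) = val 1 \<longleftrightarrow> Z (w - 1) \<or> Z (w * w + w + 1)" by (simp add: val_eq_iff)
    moreover have "val w = \<one> \<longleftrightarrow> Z (w - 1)" using val_eq_iff[of w 1] by (simp add: val_1)
    ultimately show ?thesis by (auto simp: pow val_1)
  qed
  then show ?thesis
    unfolding has_nontrivial_cube_root_of_one_def using val_surj by (metis val_closed)
qed

lemma not_Z_3: assumes "Z (w * w + w + 1)" "\<not> Z (w - 1)" shows "\<not> Z 3"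
proof
  assume "Z 3"
  then have "Z ((w - 1) * (w - 1))"
    by (rule Z_combination[OF _ assms(1) Z_0 Z_0, of _ _ "- w" 1 0 0]) (simp add: algebra_simps)
  then show False using assms(2) by simp
qed

lemma cube_root_characteristic_two:
  assumes "Z 2" "Z (c * c + c + 1)" shows "has_nontrivial_cube_root_of_one R"
proof -
  have "\<not> Z (c - 1)"
  proof
    assume "Z (c - 1)"
    then have "Z 1"
      by (rule Z_combination[OF _ assms Z_0, of _ _ "- c - 2" "- 1" 1 0]) (simp add: algebra_simps)
    then show False by simp
  qed
  then show ?thesis using assms(2) cube_root_iff by blast
qed

text \<open>
  The norm is the product with the conjugate \<open>a - b - b * \<omega>\<close>.
\<close>

lemma Z_norm: assumes "Z (w * w + w + 1)" "Z (eisenstein_value w x)"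
  shows "Z (of_int (eisenstein_norm x))"
proof -
  obtain a b where x: "x = Eis a b" by (cases x)
  show ?thesis
    by (rule Z_combination[OF assms Z_0 Z_0, of _ "of_int b * of_int b"
        "of_int a - of_int b - of_int b * w" 0 0]) (simp add: x algebra_simps)
qed

section \<open>Existence\<close>

lemma quadrilateral_exists:
  assumes "1 \<le> s" "s \<le> 6"
  shows "\<exists>C. line_configuration R s C \<and> int (card (triple_points R C)) = U3 s"
proof -
  have test: "Z (of_int x) \<longleftrightarrow> x = 0" if "x \<in> {-1, 0, 1}" for x :: int
    using that by auto
  have "length quadrilateral_vectors = 6" "valid_blocks 6 quadrilateral_blocks" "spread 6 quadrilateral_blocks"
    by code_simp+
  then obtain v where v: "distinct_lines 6 v" "realizes 6 quadrilateral_blocks v"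
    using explicit_configuration[OF hom_mod_of_int test quadrilateral_check] by force
  have "valid_blocks 6 quadrilateral_blocks" "list_all (\<lambda>B. length B = 3) quadrilateral_blocks"
    by code_simp+
  note sub = subconfiguration[OF v this assms(2)]
  have "s \<in> {1, 2, 3, 4, 5, 6}" using assms by auto
  then have "int (card (triple_points R (config s v))) = U3 s"
    unfolding sub(2) by (auto simp: quadrilateral_blocks_def U3_def)
  then show ?thesis using sub(1) by blast
qed

lemma fano_exists:
  assumes "Z 2"
  shows "line_configuration R 7 (config 7 (\<lambda>i. mapv of_int (fano_vectors ! i)))"
    "card (triple_points R (config 7 (\<lambda>i. mapv of_int (fano_vectors ! i)))) = 7"
proof -
  have test: "Z (of_int x) \<longleftrightarrow> even x" if True for x
    using assms characteristic_two by (simp add: Z_of_int_iff)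
  have "length fano_vectors = 7" "valid_blocks 7 fano" "spread 7 fano" "length (filter (\<lambda>B. length B = 3) fano) = 7"
    by code_simp+
  then show "line_configuration R 7 (config 7 (\<lambda>i. mapv of_int (fano_vectors ! i)))"
    "card (triple_points R (config 7 (\<lambda>i. mapv of_int (fano_vectors ! i)))) = 7"
    using explicit_configuration[OF hom_mod_of_int test fano_check] by simp_all
qed

text \<open>
  The seven coefficient vectors of the Fano configuration are all nonzero vectors over the field with
  two elements.
\<close>

lemma two_element_plane:
  assumes "card (carrier R) = 2"
  shows "line_configuration R 7 (lines R)" "card (triple_points R (lines R)) = 7"
proof -
  have "\<zero> \<in> carrier R" "\<one> \<in> carrier R" "\<zero> \<noteq> \<one>" by simp_all
  moreover have "finite (carrier R)" using assms card.infinite by fastforce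
  ultimately have "carrier R = {\<zero>, \<one>}" using assms by (intro card_seteq[symmetric]) auto
  then have val01: "val x = val 0 \<or> val x = val 1" for x using val_closed[of x] by (auto simp: val_1)
  have "Z 2"
  proof (rule ccontr)
    assume "\<not> Z 2"
    then have "Z (2 - 1)" using val01[of 2] by (auto simp: Z_def val_eq_iff)
    then show False by simp
  qed
  let ?v = "\<lambda>i. mapv of_int (fano_vectors ! i)"
  have "lines R = config 7 ?v"
  proof
    show "config 7 ?v \<subseteq> lines R"
      using fano_exists(1)[OF \<open>Z 2\<close>] by (simp add: line_configuration_def)
    show "lines R \<subseteq> config 7 ?v"
    proof
      fix L assume "L \<in> lines R"
      then obtain u where u: "\<not> null u" "L = ln u" by (auto simp: lines_eq)
      obtain x y z where xyz: "u = (x, y, z)" by (cases u)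
      have "valv u \<in> (\<lambda>t. valv (mapv of_int t)) ` set fano_vectors"
        using u(1) val01[of x] val01[of y] val01[of z] by (auto simp: fano_vectors_def xyz Z_def val_1)
      then obtain i where "i < length fano_vectors" "valv u = valv (?v i)"
        by (auto simp: in_set_conv_nth)
      then show "L \<in> config 7 ?v"
        unfolding u(2) config_def ln_def by (auto simp: fano_vectors_def)
    qed
  qed
  then show "line_configuration R 7 (lines R)" "card (triple_points R (lines R)) = 7"
    using fano_exists[OF \<open>Z 2\<close>] by simp_all
qed

lemma hesse_exists:
  assumes "has_nontrivial_cube_root_of_one R"
  shows "\<exists>C. line_configuration R 9 C \<and> card (triple_points R C) = 12"
    "\<exists>C. line_configuration R 8 C \<and> card (triple_points R C) = 8"
proof -
  obtain w where w: "Z (w * w + w + 1)" "\<not> Z (w - 1)" using assms cube_root_iff by blast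
  have test: "Z (eisenstein_value w x) \<longleftrightarrow> x = Eis 0 0" if x: "x = Eis 0 0 \<or> eisenstein_norm x \<in> {1, 3}" for x
  proof
    assume "Z (eisenstein_value w x)"
    then have "Z (of_int (eisenstein_norm x))" by (rule Z_norm[OF w(1)])
    then show "x = Eis 0 0" using x not_Z_3[OF w] by auto
  qed simp
  have "length hesse_vectors = 9" "valid_blocks 9 hesse_blocks" "spread 9 hesse_blocks" by code_simp+
  then obtain v where v: "distinct_lines 9 v" "realizes 9 hesse_blocks v"
    using explicit_configuration[OF hom_mod_eisenstein_value[OF w(1)] test hesse_check] by force
  have "valid_blocks 9 hesse_blocks" "list_all (\<lambda>B. length B = 3) hesse_blocks" by code_simp+
  note sub = subconfiguration[OF v this]
  have "length (filter (list_all (\<lambda>i. i < 9)) hesse_blocks) = 12" by code_simp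
  then show "\<exists>C. line_configuration R 9 C \<and> card (triple_points R C) = 12" using sub[of 9] by fastforce
  have "length (filter (list_all (\<lambda>i. i < 8)) hesse_blocks) = 8" by code_simp
  then show "\<exists>C. line_configuration R 8 C \<and> card (triple_points R C) = 8" using sub[of 8] by fastforce
qed

lemma quadruple_exists:
  assumes "Z 2" "has_nontrivial_cube_root_of_one R"
  shows "\<exists>C. line_configuration R 10 C \<and> card (multiplicity_ge3_points R C) = 13"
proof -
  obtain w where w: "Z (w * w + w + 1)" using assms(2) cube_root_iff by blast
  have even_iff: "Z (of_int n) \<longleftrightarrow> even n" for n
    using assms(1) characteristic_two by (simp add: Z_of_int_iff)
  have test: "Z (eisenstein_value w x) \<longleftrightarrow> even_eisenstein x" if True for x
  proof -
    obtain a b where x: "x = Eis a b" by (cases x)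
    show ?thesis
    proof
      assume "Z (eisenstein_value w x)"
      then have "even (eisenstein_norm x)" using Z_norm[OF w] even_iff by blast
      then show "even_eisenstein x" by (auto simp: x)
    next
      assume "even_eisenstein x"
      then have "Z (of_int a)" "Z (of_int b)" by (simp_all add: x even_iff)
      then show "Z (eisenstein_value w x)" by (simp add: x Z_add)
    qed
  qed
  have "length quadruple_vectors = 10" "valid_blocks 10 ten_quadruple" "spread 10 ten_quadruple" "length ten_quadruple = 13"
    by code_simp+
  then show ?thesis
    using explicit_configuration[OF hom_mod_eisenstein_value[OF w] test quadruple_check] by force
qed

lemma menelaus_exists:
  assumes "Z 5"
  shows "\<exists>C. line_configuration R 10 C \<and> card (multiplicity_ge3_points R C) = 13"
proof -
  have test: "Z (of_int x) \<longleftrightarrow> 5 dvd x" if True for x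
    using assms characteristic_five by (simp add: Z_of_int_iff)
  have "length menelaus_vectors = 10" "valid_blocks 10 ten_menelaus" "spread 10 ten_menelaus" "length ten_menelaus = 13"
    by code_simp+
  then show ?thesis
    using explicit_configuration[OF hom_mod_of_int test menelaus_check] by force
qed

end

text \<open>
  The ninth line \<open>8\<close> passes through the intersections of the missed pairs of the Moebius-Kantor system.
\<close>

definition hesse_extension :: "nat list list" where
  "hesse_extension = moebius_kantor @ [[0, 1, 8], [2, 3, 8], [4, 5, 8], [6, 7, 8]]"

definition mate :: "nat \<Rightarrow> nat" where "mate i = (if even i then i + 1 else i - 1)"

lemma mates_in_no_block:
  assumes "i < 8" "j < 8" "j \<noteq> i" "j \<noteq> mate i"
  shows "\<not> list_ex (\<lambda>B. {i, j, mate i} \<subseteq> set B) moebius_kantor"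
proof -
  have "list_all (\<lambda>i. list_all (\<lambda>j. j = i \<or> j = mate i \<or>
      \<not> list_ex (\<lambda>B. i \<in> set B \<and> j \<in> set B \<and> mate i \<in> set B) moebius_kantor) [0..<8]) [0..<8]"
    by code_simp
  moreover have "i \<in> set [0..<8]" "j \<in> set [0..<8]" using assms by auto
  ultimately have "\<not> list_ex (\<lambda>B. i \<in> set B \<and> j \<in> set B \<and> mate i \<in> set B) moebius_kantor"
    using assms(3,4) unfolding list_all_iff by blast
  then show ?thesis by simp
qed

context field_presentation
begin

text \<open>
  If \<open>q\<close> were the line \<open>v i\<close>, this line would pass through the intersection of a missed pair.
\<close>

lemma ninth_line_not_parallel:
  assumes v: "realizes 8 moebius_kantor v" and d: "distinct_lines 8 v"
    and q: "\<not> null q" "Z (det3 (v 0) (v 1) q)" "Z (det3 (v 2) (v 3) q)"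
    and i: "i < 8"
  shows "\<not> null (cross (v i) q)"
proof
  assume null: "null (cross (v i) q)"
  then obtain c where c: "valv q = valv (smul c (v i))"
    using parallel_multiple d i by (metis distinct_lines_def)
  have "\<not> Z c"
  proof
    assume "Z c"
    with c q(1) show False by (cases "v i"; cases q) (auto simp: Z_def val_mult)
  qed
  have "val (det3 x y q) = val (c * det3 x y (v i))" for x y
    using det3_cong[of x x y y q "smul c (v i)"] c det3_smul[of 1 x 1 y c "v i"]
    by (cases x; cases y) simp
  then have eq: "Z (det3 x y q) \<longleftrightarrow> Z (det3 x y (v i))" for x y
    using \<open>\<not> Z c\<close> by (metis Z_def Z_mult_iff)
  show False
  proof (cases "i < 2")
    case True
    then have "\<not> Z (det3 (v 2) (v 3) (v i))"
      using realizesD[OF v, of 2 3 i] by (auto simp: moebius_kantor_def)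
    then show False using eq q(3) by blast
  next
    case False
    then have "\<not> Z (det3 (v 0) (v 1) (v i))"
      using realizesD[OF v, of 0 1 i] i by (auto simp: moebius_kantor_def)
    then show False using eq q(2) by blast
  qed
qed

text \<open>
  If the new line met \<open>v i\<close> in a point of a further line \<open>v j\<close>, this point would be the intersection of
  \<open>v i\<close> with its mate, and \<open>i\<close>, \<open>j\<close> and the mate would form a block. So the new triple points are
  the four intersections of mates, and no old triple point is on the new line.
\<close>

lemma moebius_kantor_extension:
  assumes v: "realizes 8 moebius_kantor v" and d: "distinct_lines 8 v"
  shows "\<exists>D L. line_configuration R 9 D \<and> card (triple_points R D) = 12 \<and> L \<in> D \<and> config 8 v = D - {L}"
proof -
  obtain q where q: "\<not> null q" "Z (det3 (v 0) (v 1) q)" "Z (det3 (v 2) (v 3) q)"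
    "Z (det3 (v 4) (v 5) q)" "Z (det3 (v 6) (v 7) q)"
    using moebius_kantor_ninth_line[OF v] by blast
  have nq: "\<not> null (cross (v i) q)" if "i < 8" for i
    by (rule ninth_line_not_parallel[OF v d q(1-3) that])
  have mate: "Z (det3 (v i) (v (mate i)) q)" "mate i < 8" "mate i \<noteq> i" if "i < 8" for i
  proof -
    have "i \<in> {0, 1, 2, 3, 4, 5, 6, 7}" using that by auto
    then show "Z (det3 (v i) (v (mate i)) q)" "mate i < 8" "mate i \<noteq> i"
      using q det3_swap[of "v 0" "v 1" q] det3_swap[of "v 2" "v 3" q] det3_swap[of "v 4" "v 5" q] det3_swap[of "v 6" "v 7" q]
      by (auto simp: mate_def)
  qed
  have only_mate: "Z (det3 (v i) (v j) q) \<longleftrightarrow> j = mate i" if ij: "i < 8" "j < 8" "i \<noteq> j" for i j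
  proof
    assume z: "Z (det3 (v i) (v j) q)"
    show "j = mate i"
    proof (rule ccontr)
      assume "j \<noteq> mate i"
      have dot: "dot (cross (v i) q) x = - det3 (v i) x q" for x
        by (cases "v i"; cases q; cases x) (simp add: det3_simp algebra_simps)
      have "Z (det3 (v i) (v j) (v (mate i)))"
        by (rule Z_det3_orthogonal[OF nq[OF ij(1)]]) (use z mate(1)[OF ij(1)] in \<open>simp_all add: dot\<close>)
      then have "list_ex (\<lambda>B. {i, j, mate i} \<subseteq> set B) moebius_kantor"
        using realizesD[OF v ij(1,2) mate(2)[OF ij(1)] ij(3)] mate(3)[OF ij(1)] \<open>j \<noteq> mate i\<close> by simp
      then show False using mates_in_no_block[OF ij(1,2)] ij(3) \<open>j \<noteq> mate i\<close> by simp
    qed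
  qed (use mate(1) ij in simp)
  let ?w = "v(8 := q)"
  have r: "realizes 9 hesse_extension ?w"
  proof (rule realizes_sorted)
    fix i j k :: nat assume ijk: "i < j" "j < k" "k < 9"
    show "Z (det3 (?w i) (?w j) (?w k)) \<longleftrightarrow> list_ex (\<lambda>B. {i, j, k} \<subseteq> set B) hesse_extension"
    proof (cases "k = 8")
      case True
      have "Z (det3 (?w i) (?w j) (?w k)) \<longleftrightarrow> j = mate i"
        using only_mate[of i j] ijk True by simp
      also have "\<dots> \<longleftrightarrow> (i, j) \<in> {(0, 1), (2, 3), (4, 5), (6, 7)}"
      proof -
        have "i \<in> {0, 1, 2, 3, 4, 5, 6, 7}" using ijk by auto
        then show ?thesis using ijk True by (auto simp: mate_def)
      qed
      also have "\<dots> \<longleftrightarrow> list_ex (\<lambda>B. {i, j, k} \<subseteq> set B) hesse_extension"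
        using ijk True by (auto simp: hesse_extension_def moebius_kantor_def)
      finally show ?thesis .
    next
      case False
      then show ?thesis using realizesD[OF v, of i j k] ijk
        by (auto simp: hesse_extension_def)
    qed
  qed
  have checks: "spread 9 hesse_extension" "valid_blocks 9 hesse_extension"
    "length (filter (\<lambda>B. length B = 3) hesse_extension) = 12" by code_simp+
  have d9: "distinct_lines 9 ?w" by (rule distinct_lines_spread[OF r checks(1)]) simp
  have "card (triple_points R (config 9 ?w)) = 12"
    using card_points_realization(2)[OF d9 checks(2) r] checks(3) by simp
  moreover have "line_configuration R 9 (config 9 ?w)" by (rule line_configuration_config[OF d9])
  moreover have nine: "{..<9 :: nat} = insert 8 {..<8}" by auto
  then have "config 9 ?w = insert (ln q) (config 8 v)" by (auto simp: config_def)
  moreover have "ln q \<notin> config 8 v"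
    using nq ln_neqI unfolding config_def by blast
  ultimately show ?thesis by (intro exI[of _ "config 9 ?w"] exI[of _ "ln q"]) auto
qed

lemma card_blocks:
  assumes "distinct_lines n v"
  shows "card (multiplicity_ge3_points R (config n v)) = card (blocks n v)"
    "card (triple_points R (config n v)) = card {B \<in> blocks n v. card B = 3}"
  using bij_betw_blocks[OF assms] by (simp_all add: bij_betw_same_card)

lemma seven_lines:
  assumes "line_configuration R 7 C" "card (triple_points R C) = 7"
  shows "Z 2"
proof -
  obtain v where v: "distinct_lines 7 v" "C = config 7 v" using obtain_config[OF assms(1)] .
  interpret block_system "{..<7}" "blocks 7 v" by (rule block_system_blocks[OF v(1)])
  have "has_model 7 fano {..<7} (blocks 7 v)"
    using fano_unique assms(2) card_blocks(2)[OF v(1)] v(2) by simp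
  moreover have "list_all (\<lambda>B. set B \<subseteq> {..<7}) fano" by (simp add: fano_def)
  ultimately obtain w where "realizes 7 fano w" using realization[OF v(1)] by blast
  then show ?thesis by (rule fano_characteristic)
qed

lemma eight_lines:
  assumes "line_configuration R 8 C" "card (triple_points R C) = 8"
  shows "\<exists>D L. line_configuration R 9 D \<and> card (triple_points R D) = 12 \<and> L \<in> D \<and> C = D - {L}"
proof -
  obtain v where v: "distinct_lines 8 v" "C = config 8 v" using obtain_config[OF assms(1)] .
  interpret block_system "{..<8}" "blocks 8 v" by (rule block_system_blocks[OF v(1)])
  have "has_model 8 moebius_kantor {..<8} (blocks 8 v)"
    using moebius_kantor_unique assms(2) card_blocks(2)[OF v(1)] v(2) by simp
  moreover have "list_all (\<lambda>B. set B \<subseteq> {..<8}) moebius_kantor" by (simp add: moebius_kantor_def)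
  ultimately obtain w where "realizes 8 moebius_kantor w" "distinct_lines 8 w" "config 8 w = C"
    using realization[OF v(1)] v(2) by metis
  then show ?thesis using moebius_kantor_extension by metis
qed

lemma ten_lines:
  assumes C: "line_configuration R 10 C" "card (multiplicity_ge3_points R C) = 13"
  shows "(Z 10 \<and> \<not> Z 2) \<or>
    (Z 2 \<and> has_nontrivial_cube_root_of_one R \<and> (\<exists>P \<in> multiplicity_ge3_points R C. point_multiplicity C P = 4))"
proof -
  obtain v where v: "distinct_lines 10 v" "C = config 10 v" using obtain_config[OF C(1)] .
  interpret block_system "{..<10}" "blocks 10 v" by (rule block_system_blocks[OF v(1)])
  have sub: "list_all (\<lambda>B. set B \<subseteq> {..<10}) ten_menelaus" "list_all (\<lambda>B. set B \<subseteq> {..<10}) ten_triple"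
    "list_all (\<lambda>B. set B \<subseteq> {..<10}) ten_quadruple"
    by (simp_all add: ten_menelaus_def ten_triple_def ten_quadruple_def hexagon_factors_def)
  have "card (blocks 10 v) = 13" using C(2) card_blocks(1)[OF v(1)] v(2) by simp
  then consider "has_model 10 ten_menelaus {..<10} (blocks 10 v)" | "has_model 10 ten_triple {..<10} (blocks 10 v)"
    | "has_model 10 ten_quadruple {..<10} (blocks 10 v)"
    using ten_lines_classification by auto
  then show ?thesis
  proof cases
    case 1
    then obtain w where "realizes 10 ten_menelaus w" using realization[OF v(1) _ sub(1)] by blast
    then show ?thesis using menelaus_characteristic by blast
  next
    case 2
    then obtain w where "realizes 10 ten_triple w" using realization[OF v(1) _ sub(2)] by blast
    then show ?thesis using ten_triple_impossible by blast
  next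
    case 3
    obtain w where "realizes 10 ten_quadruple w" using realization[OF v(1) 3 sub(3)] by blast
    then obtain c where c: "Z 2" "Z (c * c + c + 1)" using ten_quadruple_field by blast
    obtain \<phi> where \<phi>: "bij_betw \<phi> {..<10} {..<10}" "blocks 10 v = (\<lambda>B. \<phi> ` set B) ` set ten_quadruple"
      using 3 by (auto simp: has_model_def)
    define Q where "Q = \<phi> ` set [0, 1, 2, 3]"
    have "Q \<in> blocks 10 v" unfolding \<phi>(2) by (simp add: Q_def ten_quadruple_def)
    moreover have "blocks 10 v = through 10 v ` multiplicity_ge3_points R C"
      using bij_betw_blocks(1)[OF v(1)] v(2) by (simp add: bij_betw_def)
    ultimately obtain P where P: "P \<in> multiplicity_ge3_points R C" "Q = through 10 v P" by blast
    have "inj_on \<phi> (set [0, 1, 2, 3])"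
      by (rule inj_on_subset[of \<phi> "{..<10}"]) (use \<phi>(1) in \<open>auto simp: bij_betw_def\<close>)
    then have "card (set [0, 1, 2, 3 :: nat]) = card Q" unfolding Q_def by (simp only: card_image)
    then have "card (through 10 v P) = 4" using P(2) by simp
    then have "\<exists>P \<in> multiplicity_ge3_points R C. point_multiplicity C P = 4"
      using point_multiplicity_config[OF v(1)] v(2) P(1) by auto
    then show ?thesis using c cube_root_characteristic_two by blast
  qed
qed

lemma ten_lines_iff:
  "(\<exists>C. line_configuration R 10 C \<and> card (multiplicity_ge3_points R C) = 13) \<longleftrightarrow>
    (ring_characteristic R = 2 \<and> has_nontrivial_cube_root_of_one R) \<or> ring_characteristic R = 5"
proof -
  have "Z 10 \<and> \<not> Z 2 \<Longrightarrow> Z 5"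
    using Z_mult_iff[of 2 5] by simp
  then show ?thesis
    unfolding characteristic_two characteristic_five
    using ten_lines quadruple_exists menelaus_exists by metis
qed

lemma eleven_lines:
  assumes C: "line_configuration R 11 C" "card (triple_points R C) = 17"
  shows False
proof -
  obtain v where v: "distinct_lines 11 v" "C = config 11 v" using obtain_config[OF C(1)] .
  interpret block_system "{..<11}" "blocks 11 v" by (rule block_system_blocks[OF v(1)])
  have sub: "list_all (\<lambda>B. set B \<subseteq> {..<11}) eleven_hexagon" "list_all (\<lambda>B. set B \<subseteq> {..<11}) eleven_quadrangle"
    by (simp_all add: eleven_hexagon_def eleven_quadrangle_def hexagon_factors_def)
  have "has_model 11 eleven_hexagon {..<11} (blocks 11 v) \<or> has_model 11 eleven_quadrangle {..<11} (blocks 11 v)"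
    using eleven_lines_classification C(2) card_blocks(2)[OF v(1)] v(2) by simp
  then show False
    using realization[OF v(1) _ sub(1)] realization[OF v(1) _ sub(2)]
      eleven_hexagon_impossible eleven_quadrangle_impossible by metis
qed

end

lemma field_presentation_generic:
  assumes "field F" shows "field_presentation F (generic_val F)"
proof -
  interpret field F by (rule assms)
  note hom = generic_val_hom[OF is_cring]
  show ?thesis by unfold_locales (rule hom | erule hom)+
qed

lemma eleven_lines_sixteen_points: "configuration_over_some_field 11 16"
proof -
  have "Factorial_Ring.prime (5 :: nat)" by simp
  then have F: "field (residue_ring 5)"
    using residues_prime.is_field[OF residues_prime.intro, of 5] by simp
  interpret field_presentation "residue_ring 5" "generic_val (residue_ring 5)"
    by (rule field_presentation_generic[OF F])
  have "generic_val (residue_ring 5) (1 + 1 + 1 + 1 + 1) = \<zero>\<^bsub>residue_ring 5\<^esub>"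
    unfolding val_add val_1 by (simp add: residue_ring_def)
  then have five: "Z 5" by (simp add: Z_def)
  have test: "Z (of_int x) \<longleftrightarrow> 5 dvd x" if True for x
    using five characteristic_five by (simp add: Z_of_int_iff)
  have "length eleven_vectors = 11" "valid_blocks 11 eleven_blocks" "spread 11 eleven_blocks"
    "length (filter (\<lambda>B. length B = 3) eleven_blocks) = 16" by code_simp+
  then obtain C where "line_configuration (residue_ring 5) 11 C" "card (triple_points (residue_ring 5) C) = 16"
    using explicit_configuration[OF hom_mod_of_int test eleven_check] by force
  then show ?thesis unfolding configuration_over_some_field_def using F by blast
qed

section \<open>Small configurations with many triple points\<close>

theorem theorem2p1:
  shows
  "\<comment> \<open>(a)\<close>
   (\<forall>s::nat. 1 \<le> s \<and> s \<le> 6 \<longrightarrow>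
      (\<forall>F :: 'a ring. field F \<longrightarrow>
         (\<exists>C. line_configuration F s C \<and> int (card (triple_points F C)) = U3 s)))
   \<and> \<comment> \<open>(b)\<close>
   (\<forall>F :: 'a ring. field F \<longrightarrow>
      (\<exists>C. line_configuration F 7 C \<and> card (triple_points F C) = 7) \<longrightarrow>
      ring_characteristic F = 2)
   \<and>
   (\<forall>F :: 'a ring. field F \<longrightarrow> ring_characteristic F = 2 \<longrightarrow>
      (\<exists>C. line_configuration F 7 C \<and> card (triple_points F C) = 7))
   \<and>
   (\<forall>F :: 'a ring. field F \<longrightarrow> card (carrier F) = 2 \<longrightarrow>
      line_configuration F 7 (lines F) \<and> card (triple_points F (lines F)) = 7)
   \<and> \<comment> \<open>(c)\<close>
   (\<forall>F :: 'a ring. field F \<longrightarrow> has_nontrivial_cube_root_of_one F \<longrightarrow>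
      (\<exists>C. line_configuration F 8 C \<and> card (triple_points F C) = 8))
   \<and>
   (\<forall>F :: 'a ring. field F \<longrightarrow>
      (\<forall>C. line_configuration F 8 C \<and> card (triple_points F C) = 8 \<longrightarrow>
         (\<exists>D L. line_configuration F 9 D \<and> card (triple_points F D) = 12 \<and>
            L \<in> D \<and> C = D - {L})))
   \<and> \<comment> \<open>(d)\<close>
   (\<forall>F :: 'a ring. field F \<longrightarrow> has_nontrivial_cube_root_of_one F \<longrightarrow>
      (\<exists>C. line_configuration F 9 C \<and> card (triple_points F C) = 12))
   \<and> \<comment> \<open>(e)\<close>
   (\<forall>F :: 'a ring. field F \<longrightarrow>
      ((\<exists>C. line_configuration F 10 C \<and> card (multiplicity_ge3_points F C) = 13) \<longleftrightarrow>
         (ring_characteristic F = 2 \<and> has_nontrivial_cube_root_of_one F) \<or>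
         ring_characteristic F = 5))
   \<and>
   (\<forall>F :: 'a ring. field F \<longrightarrow>
      ring_characteristic F = 2 \<and> has_nontrivial_cube_root_of_one F \<longrightarrow>
      (\<forall>C. line_configuration F 10 C \<and> card (multiplicity_ge3_points F C) = 13 \<longrightarrow>
         (\<exists>P \<in> multiplicity_ge3_points F C. point_multiplicity C P = 4)))
   \<and> \<comment> \<open>(f)\<close>
   (\<forall>F :: 'a ring. field F \<longrightarrow>
      \<not> (\<exists>C. line_configuration F 11 C \<and> card (triple_points F C) = 17))
   \<and>
   configuration_over_some_field 11 16"
proof (intro conjI allI impI)
  fix s :: nat and F :: "'a ring"
  assume "1 \<le> s \<and> s \<le> 6" "field F"
  then show "\<exists>C. line_configuration F s C \<and> int (card (triple_points F C)) = U3 s"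
    using field_presentation.quadrilateral_exists[OF field_presentation_generic] by blast
next
  fix F :: "'a ring"
  assume F: "field F" and "\<exists>C. line_configuration F 7 C \<and> card (triple_points F C) = 7"
  then show "ring_characteristic F = 2"
    using field_presentation.seven_lines[OF field_presentation_generic[OF F]]
      field_presentation.characteristic_two[OF field_presentation_generic[OF F]] by blast
next
  fix F :: "'a ring"
  assume F: "field F" and "ring_characteristic F = 2"
  then show "\<exists>C. line_configuration F 7 C \<and> card (triple_points F C) = 7"
    using field_presentation.fano_exists[OF field_presentation_generic[OF F]]
      field_presentation.characteristic_two[OF field_presentation_generic[OF F]] by blast
next
  fix F :: "'a ring"
  assume "field F" "card (carrier F) = 2"
  then show "line_configuration F 7 (lines F)" "card (triple_points F (lines F)) = 7"
    using field_presentation.two_element_plane[OF field_presentation_generic] by blast+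
next
  fix F :: "'a ring"
  assume "field F" "has_nontrivial_cube_root_of_one F"
  then show "\<exists>C. line_configuration F 8 C \<and> card (triple_points F C) = 8"
    using field_presentation.hesse_exists(2)[OF field_presentation_generic] by blast
next
  fix F :: "'a ring" and C
  assume "field F" "line_configuration F 8 C \<and> card (triple_points F C) = 8"
  then show "\<exists>D L. line_configuration F 9 D \<and> card (triple_points F D) = 12 \<and> L \<in> D \<and> C = D - {L}"
    using field_presentation.eight_lines[OF field_presentation_generic] by blast
next
  fix F :: "'a ring"
  assume "field F" "has_nontrivial_cube_root_of_one F"
  then show "\<exists>C. line_configuration F 9 C \<and> card (triple_points F C) = 12"
    using field_presentation.hesse_exists(1)[OF field_presentation_generic] by blast
next
  fix F :: "'a ring"
  assume F: "field F"
  show "(\<exists>C. line_configuration F 10 C \<and> card (multiplicity_ge3_points F C) = 13) \<longleftrightarrow>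
      (ring_characteristic F = 2 \<and> has_nontrivial_cube_root_of_one F) \<or> ring_characteristic F = 5"
    by (rule field_presentation.ten_lines_iff[OF field_presentation_generic[OF F]])
next
  fix F :: "'a ring" and C
  assume F: "field F" and "ring_characteristic F = 2 \<and> has_nontrivial_cube_root_of_one F"
    and "line_configuration F 10 C \<and> card (multiplicity_ge3_points F C) = 13"
  then show "\<exists>P \<in> multiplicity_ge3_points F C. point_multiplicity C P = 4"
    using field_presentation.ten_lines[OF field_presentation_generic[OF F], of C]
      field_presentation.characteristic_two[OF field_presentation_generic[OF F]] by blast
next
  fix F :: "'a ring"
  assume "field F"
  then show "\<not> (\<exists>C. line_configuration F 11 C \<and> card (triple_points F C) = 17)"
    using field_presentation.eleven_lines[OF field_presentation_generic] by blast
next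
  show "configuration_over_some_field 11 16" by (rule eleven_lines_sixteen_points)
qed

end
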